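(* Let $\mathbf{A}$ be a countable saturated structure with universe $A$ such that $\operatorname{Aut}(\mathbf{A})$ has automatic homeomorphicity and such that $\operatorname{Aut}(\mathbf{A})$ has a trivial center. Then the monoid $\operatorname{EEmb}(\mathbf{A})$ of elementary self-embeddings of $\mathbf{A}$ has automatic homeomorphicity.
   Context: $A^A$ carries the topology of pointwise convergence (product of discrete topologies), with subbasis $\{f\in A^A: f(a)=b\}$ for $a,b\in A$; transformation monoids $M\le A^A$ (under composition) and permutation groups $G\le\operatorname{Sym}(A)$ carry the subspace topology. A transformation monoid on $A$ is closed if it is closed in $A^A$; a permutation group on $A$ is closed if it is closed in $\operatorname{Sym}(A)$. A closed permutation group $G$ on a countable set $A$ has automatic homeomorphicity if every group isomorphism from $G$ onto a closed permutation group on $A$ is a homeomorphism. A closed transformation monoid $M$ on $A$ has automatic homeomorphicity if every monoid isomorphism from $M$ onto a closed transformation monoid on $A$ is a homeomorphism. A structure $\mathbf{A}$ is $\lambda$-saturated if for every $\kappa<\lambda$, every $\bar a\in A^\kappa$, every elementary extension $\mathbf{B}\succeq\mathbf{A}$ and every $b\in B$ there is $c\in A$ with $(\mathbf{B},\bar a b)\equiv(\mathbf{A},\bar a c)$; it is saturated if it is $|A|$-saturated. *)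

theory Defs
  imports "HOL-Analysis.Function_Topology" "HOL-Algebra.Bij" "HOL-Library.Countable_Set"
begin

unbundle cardinal_syntax

section \<open>First-order logic\<close>

text \<open>
  A language is a set of function symbols and a set of relation symbols, each paired with its
  arity; constants are function symbols of arity 0. No restriction is put on its cardinality.
\<close>

record ('f, 'r) language =
  funs :: "('f \<times> nat) set"
  rels :: "('r \<times> nat) set"

datatype 'f trm = Var nat | Fn 'f "'f trm list"

datatype ('f, 'r) fm =
    Eq "'f trm" "'f trm"
  | Rel 'r "'f trm list"
  | Neg "('f, 'r) fm"
  | Conj "('f, 'r) fm" "('f, 'r) fm"
  | Ex nat "('f, 'r) fm"

primrec L_trm :: "('f, 'r) language \<Rightarrow> 'f trm \<Rightarrow> bool" where
  "L_trm L (Var x) \<longleftrightarrow> True"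
| "L_trm L (Fn f ts) \<longleftrightarrow> (f, length ts) \<in> funs L \<and> list_all (L_trm L) ts"

primrec L_fm :: "('f, 'r) language \<Rightarrow> ('f, 'r) fm \<Rightarrow> bool" where
  "L_fm L (Eq s t) \<longleftrightarrow> L_trm L s \<and> L_trm L t"
| "L_fm L (Rel r ts) \<longleftrightarrow> (r, length ts) \<in> rels L \<and> list_all (L_trm L) ts"
| "L_fm L (Neg \<phi>) \<longleftrightarrow> L_fm L \<phi>"
| "L_fm L (Conj \<phi> \<psi>) \<longleftrightarrow> L_fm L \<phi> \<and> L_fm L \<psi>"
| "L_fm L (Ex x \<phi>) \<longleftrightarrow> L_fm L \<phi>"

primrec fv_trm :: "'f trm \<Rightarrow> nat set" where
  "fv_trm (Var x) = {x}"
| "fv_trm (Fn f ts) = \<Union> (set (map fv_trm ts))"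

primrec fv :: "('f, 'r) fm \<Rightarrow> nat set" where
  "fv (Eq s t) = fv_trm s \<union> fv_trm t"
| "fv (Rel r ts) = (\<Union>t\<in>set ts. fv_trm t)"
| "fv (Neg \<phi>) = fv \<phi>"
| "fv (Conj \<phi> \<psi>) = fv \<phi> \<union> fv \<psi>"
| "fv (Ex x \<phi>) = fv \<phi> - {x}"

definition L_sentence :: "('f, 'r) language \<Rightarrow> ('f, 'r) fm \<Rightarrow> bool" where
  "L_sentence L \<phi> \<longleftrightarrow> L_fm L \<phi> \<and> fv \<phi> = {}"

record ('u, 'f, 'r) fo_structure =
  univ :: "'u set"
  fint :: "'f \<Rightarrow> 'u list \<Rightarrow> 'u"
  rint :: "'r \<Rightarrow> 'u list \<Rightarrow> bool"

definition is_structure :: "('f, 'r) language \<Rightarrow> ('u, 'f, 'r) fo_structure \<Rightarrow> bool" where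
  "is_structure L \<A> \<longleftrightarrow> univ \<A> \<noteq> {} \<and>
     (\<forall>(f, n) \<in> funs L. \<forall>xs \<in> lists (univ \<A>). length xs = n \<longrightarrow> fint \<A> f xs \<in> univ \<A>)"

primrec val :: "('u, 'f, 'r) fo_structure \<Rightarrow> (nat \<Rightarrow> 'u) \<Rightarrow> 'f trm \<Rightarrow> 'u" where
  "val \<A> e (Var x) = e x"
| "val \<A> e (Fn f ts) = fint \<A> f (map (val \<A> e) ts)"

primrec sat :: "('u, 'f, 'r) fo_structure \<Rightarrow> (nat \<Rightarrow> 'u) \<Rightarrow> ('f, 'r) fm \<Rightarrow> bool" where
  "sat \<A> e (Eq s t) \<longleftrightarrow> val \<A> e s = val \<A> e t"
| "sat \<A> e (Rel r ts) \<longleftrightarrow> rint \<A> r (map (val \<A> e) ts)"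
| "sat \<A> e (Neg \<phi>) \<longleftrightarrow> \<not> sat \<A> e \<phi>"
| "sat \<A> e (Conj \<phi> \<psi>) \<longleftrightarrow> sat \<A> e \<phi> \<and> sat \<A> e \<psi>"
| "sat \<A> e (Ex x \<phi>) \<longleftrightarrow> (\<exists>a \<in> univ \<A>. sat \<A> (e(x := a)) \<phi>)"

definition models :: "('u, 'f, 'r) fo_structure \<Rightarrow> ('f, 'r) fm \<Rightarrow> bool" where
  "models \<A> \<phi> \<longleftrightarrow> (\<forall>e \<in> UNIV \<rightarrow> univ \<A>. sat \<A> e \<phi>)"

definition elem_equiv ::
  "('f, 'r) language \<Rightarrow> ('u, 'f, 'r) fo_structure \<Rightarrow> ('v, 'f, 'r) fo_structure \<Rightarrow> bool" where
  "elem_equiv L \<A> \<B> \<longleftrightarrow> (\<forall>\<phi>. L_sentence L \<phi> \<longrightarrow> models \<A> \<phi> = models \<B> \<phi>)"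

definition elem_embedding ::
  "('f, 'r) language \<Rightarrow> ('u, 'f, 'r) fo_structure \<Rightarrow> ('v, 'f, 'r) fo_structure \<Rightarrow> ('u \<Rightarrow> 'v) \<Rightarrow> bool"
  where
  "elem_embedding L \<A> \<B> h \<longleftrightarrow> h \<in> univ \<A> \<rightarrow> univ \<B> \<and>
     (\<forall>\<phi>. L_fm L \<phi> \<longrightarrow> (\<forall>e \<in> UNIV \<rightarrow> univ \<A>. sat \<A> e \<phi> = sat \<B> (h \<circ> e) \<phi>))"


section \<open>Saturation\<close>

text \<open>
  Expansion of a language by new constant symbols, and of a structure by an interpretation of
  these symbols; this is the pair of a structure and a tuple that occurs in
  the definition of saturation.
\<close>

definition lang_consts :: "('f, 'r) language \<Rightarrow> 'c set \<Rightarrow> ('f + 'c, 'r) language" where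
  "lang_consts L C =
     \<lparr>funs = {(Inl f, n) | f n. (f, n) \<in> funs L} \<union> {(Inr c, 0) | c. c \<in> C}, rels = rels L\<rparr>"

definition expand ::
  "('u, 'f, 'r) fo_structure \<Rightarrow> ('c \<Rightarrow> 'u) \<Rightarrow> ('u, 'f + 'c, 'r) fo_structure" where
  "expand \<A> a =
     \<lparr>univ = univ \<A>, fint = case_sum (fint \<A>) (\<lambda>c _. a c), rint = rint \<A>\<rparr>"

text \<open>
  A tuple of length \<open>\<kappa> < \<mu>\<close>, for a cardinal \<open>\<mu>\<close>, is indexed by a subset \<open>I\<close> of the
  field of \<open>\<mu>\<close> with \<open>|I| = \<kappa>\<close>. In the expansions, the constants \<open>Some i\<close> name the entries of
  the tuple and \<open>None\<close> names the additional element.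

  An elementary extension of \<open>\<A>\<close> is given up to renaming of its elements, as an elementary
  embedding \<open>h\<close> of \<open>\<A>\<close> into \<open>\<B>\<close>. The elements of \<open>\<B>\<close> are taken from the type
  \<open>'u + ('f, 'r) fm\<close>, as HOL does not allow quantifying over all types. This is no restriction:
  the type has cardinality at least \<open>|A| + |L| + \<aleph>\<^sub>0\<close>, so by the downward Loewenheim-Skolem
  theorem an arbitrary elementary extension has an elementary substructure that contains \<open>\<A>\<close>
  and \<open>b\<close> and is isomorphic to a structure over this type.
\<close>

definition card_saturated ::
  "('f, 'r) language \<Rightarrow> 'k rel \<Rightarrow> ('u, 'f, 'r) fo_structure \<Rightarrow> bool" where
  "card_saturated L \<mu> \<A> \<longleftrightarrow>
     (\<forall>I \<subseteq> Field \<mu>. |I| <o \<mu> \<longrightarrow>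
       (\<forall>a \<in> I \<rightarrow> univ \<A>.
        \<forall>(\<B> :: ('u + ('f, 'r) fm, 'f, 'r) fo_structure) h.
          is_structure L \<B> \<and> elem_embedding L \<A> \<B> h \<longrightarrow>
          (\<forall>b \<in> univ \<B>. \<exists>c \<in> univ \<A>.
             elem_equiv (lang_consts L (insert None (Some ` I)))
               (expand \<B> (case_option b (h \<circ> a)))
               (expand \<A> (case_option c a)))))"

definition saturated :: "('f, 'r) language \<Rightarrow> ('u, 'f, 'r) fo_structure \<Rightarrow> bool" where
  "saturated L \<A> \<longleftrightarrow> card_saturated L |univ \<A>| \<A>"


section \<open>Automorphisms and elementary self-embeddings\<close>

text \<open>Self-maps of a set \<open>A\<close> are represented by extensional functions, as in \<^const>\<open>Bij\<close>.\<close>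

definition Aut :: "('f, 'r) language \<Rightarrow> ('u, 'f, 'r) fo_structure \<Rightarrow> ('u \<Rightarrow> 'u) set" where
  "Aut L \<A> = {h \<in> Bij (univ \<A>).
     (\<forall>(f, n) \<in> funs L. \<forall>xs \<in> lists (univ \<A>). length xs = n \<longrightarrow>
        h (fint \<A> f xs) = fint \<A> f (map h xs)) \<and>
     (\<forall>(r, n) \<in> rels L. \<forall>xs \<in> lists (univ \<A>). length xs = n \<longrightarrow>
        rint \<A> r xs = rint \<A> r (map h xs))}"

definition EEmb :: "('f, 'r) language \<Rightarrow> ('u, 'f, 'r) fo_structure \<Rightarrow> ('u \<Rightarrow> 'u) set" where
  "EEmb L \<A> = {h \<in> univ \<A> \<rightarrow>\<^sub>E univ \<A>. elem_embedding L \<A> \<A> h}"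


section \<open>Automatic homeomorphicity\<close>

definition pointwise_topology :: "'a set \<Rightarrow> ('a \<Rightarrow> 'a) topology" where
  "pointwise_topology A = product_topology (\<lambda>_. discrete_topology A) A"

definition full_trans_monoid :: "'a set \<Rightarrow> ('a \<Rightarrow> 'a) monoid" where
  "full_trans_monoid A = \<lparr>carrier = A \<rightarrow>\<^sub>E A, mult = compose A, one = \<lambda>x\<in>A. x\<rparr>"

definition closed_perm_group :: "'a set \<Rightarrow> ('a \<Rightarrow> 'a) set \<Rightarrow> bool" where
  "closed_perm_group A G \<longleftrightarrow>
     subgroup G (BijGroup A) \<and> closedin (subtopology (pointwise_topology A) (Bij A)) G"

definition closed_trans_monoid :: "'a set \<Rightarrow> ('a \<Rightarrow> 'a) set \<Rightarrow> bool" where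
  "closed_trans_monoid A M \<longleftrightarrow>
     submonoid M (full_trans_monoid A) \<and> closedin (pointwise_topology A) M"

definition group_auto_homeo :: "'a set \<Rightarrow> ('a \<Rightarrow> 'a) set \<Rightarrow> bool" where
  "group_auto_homeo A G \<longleftrightarrow>
     closed_perm_group A G \<and>
     (\<forall>H \<theta>. closed_perm_group A H \<and>
        \<theta> \<in> iso (BijGroup A\<lparr>carrier := G\<rparr>) (BijGroup A\<lparr>carrier := H\<rparr>) \<longrightarrow>
        homeomorphic_map (subtopology (pointwise_topology A) G)
                         (subtopology (pointwise_topology A) H) \<theta>)"

text \<open>
  A monoid isomorphism is an element of \<^const>\<open>iso\<close>: a bijective multiplicative map between
  monoids preserves the unit.
\<close>

definition monoid_auto_homeo :: "'a set \<Rightarrow> ('a \<Rightarrow> 'a) set \<Rightarrow> bool" where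
  "monoid_auto_homeo A M \<longleftrightarrow>
     closed_trans_monoid A M \<and>
     (\<forall>N \<theta>. closed_trans_monoid A N \<and>
        \<theta> \<in> iso (full_trans_monoid A\<lparr>carrier := M\<rparr>) (full_trans_monoid A\<lparr>carrier := N\<rparr>) \<longrightarrow>
        homeomorphic_map (subtopology (pointwise_topology A) M)
                         (subtopology (pointwise_topology A) N) \<theta>)"

definition group_center :: "('g, 'm) monoid_scheme \<Rightarrow> 'g set" where
  "group_center G = {z \<in> carrier G. \<forall>g \<in> carrier G. z \<otimes>\<^bsub>G\<^esub> g = g \<otimes>\<^bsub>G\<^esub> z}"

end

(*
  Let G = Aut(A) and M = EEmb(A). An isomorphism from M onto a closed monoid N restricts to a
  homeomorphism of G onto the closed group of units of N; as G is dense in M, the restriction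
  extends to a continuous homomorphism from M to N. Composing it with the inverse of the given
  isomorphism yields an endomorphism iota of M that is the identity on G, and it remains to show
  that iota is the identity.

  If the range of f in M is the set of fixed points of an automorphism, then iota f = f k for some
  k in M. If moreover densely many automorphisms extend along f, then k commutes with G, is
  therefore onto, and lies in the trivial center, so that iota f = f. For every h in M there is a
  u in M such that both u and u h have these two properties; hence u h = iota (u h) = u (iota h)
  and iota h = h. The embedding u arises from a chain of amalgamations in which two elementary
  extensions of a common elementary submodel meet in that submodel only.
*)

theory Submission
  imports Defs
begin

text \<open>Nothing is known about the given isomorphism off \<open>Aut L \<A>\<close>, so a
  self-embedding f can be pinned down only by equations \<sigma> f = f and \<alpha> f = f \<beta>
  with automorphisms, since these survive every endomorphism that is the identity on them. Hence u
  must make automorphisms extend, and the amalgams must be strong: otherwise an extension of the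
  identity on the range of u could fix points outside that range. A chain serves only countably many
  partial maps, which is enough because a countable set of automorphisms is dense.

  The language may be uncountable, and saturation quantifies over elementary extensions on one fixed
  type. Ultrapowers are therefore cut down to Skolem hulls, which inject into the formulas. From
  then on, saturation serves to realise complete types in countably many variables, one variable at
  a time. This gives homogeneity, density and the amalgams inside \<open>\<A>\<close> itself, so
  that chains consist of self-embeddings. The limit of such a chain is again \<open>\<A>\<close>, by
  closedness and density, and from the locale \<open>amalgamated_monoid\<close> on no formula is
  inspected.\<close>

section \<open>Renaming and substitution in formulas\<close>

lemma finite_fv_trm: "finite (fv_trm t)"
  by (induction t) auto

lemma finite_fv: "finite (fv \<phi>)"
  by (induction \<phi>) (auto simp: finite_fv_trm)

lemma val_cong: "(\<And>x. x \<in> fv_trm t \<Longrightarrow> e x = e' x) \<Longrightarrow> val \<A> e t = val \<A> e' t"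
proof (induction t)
  case (Fn f ts)
  then have "map (val \<A> e) ts = map (val \<A> e') ts" by (auto intro!: map_cong)
  then show ?case by (simp del: map_eq_conv)
qed simp

lemma sat_cong: "(\<And>x. x \<in> fv \<phi> \<Longrightarrow> e x = e' x) \<Longrightarrow> sat \<A> e \<phi> = sat \<A> e' \<phi>"
proof (induction \<phi> arbitrary: e e')
  case (Eq s t)
  then have "val \<A> e s = val \<A> e' s" "val \<A> e t = val \<A> e' t"
    by (auto intro!: val_cong)
  then show ?case by simp
next
  case (Rel r ts)
  have "val \<A> e t = val \<A> e' t" if "t \<in> set ts" for t
    using that Rel by (intro val_cong) auto
  then have "map (val \<A> e) ts = map (val \<A> e') ts" by simp
  then show ?case by (simp del: map_eq_conv)
next
  case (Conj \<phi> \<psi>)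
  have "sat \<A> e \<phi> = sat \<A> e' \<phi>" using Conj.prems by (intro Conj.IH(1)) auto
  moreover have "sat \<A> e \<psi> = sat \<A> e' \<psi>" using Conj.prems by (intro Conj.IH(2)) auto
  ultimately show ?case by simp
next
  case (Neg \<phi>)
  have "sat \<A> e \<phi> = sat \<A> e' \<phi>" using Neg.prems by (intro Neg.IH) auto
  then show ?case by simp
next
  case (Ex x \<phi>)
  have "sat \<A> (e(x := a)) \<phi> = sat \<A> (e'(x := a)) \<phi>" for a
    using Ex.prems by (intro Ex.IH) auto
  then show ?case by simp
qed

lemma is_structureD:
  assumes "is_structure L \<A>" "(f, n) \<in> funs L" "xs \<in> lists (univ \<A>)" "length xs = n"
  shows "fint \<A> f xs \<in> univ \<A>"
  using assms unfolding is_structure_def by blast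

lemma val_in_univ:
  "is_structure L \<A> \<Longrightarrow> L_trm L t \<Longrightarrow> (\<And>x. e x \<in> univ \<A>) \<Longrightarrow> val \<A> e t \<in> univ \<A>"
proof (induction t)
  case (Fn f ts)
  then have "map (val \<A> e) ts \<in> lists (univ \<A>)" by (auto simp: list_all_iff)
  moreover have "(f, length ts) \<in> funs L" using Fn.prems by simp
  ultimately show ?case using is_structureD[OF Fn.prems(1), of f "length ts" "map (val \<A> e) ts"]
    by simp
qed auto

section \<open>Renaming variables and replacing variables by constants\<close>

primrec ren_trm :: "(nat \<Rightarrow> nat) \<Rightarrow> 'f trm \<Rightarrow> 'f trm" where
  "ren_trm \<sigma> (Var x) = Var (\<sigma> x)"
| "ren_trm \<sigma> (Fn f ts) = Fn f (map (ren_trm \<sigma>) ts)"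

text \<open>Capture is avoided by renaming each bound variable above all renamed free variables.\<close>

primrec ren :: "(nat \<Rightarrow> nat) \<Rightarrow> ('f, 'r) fm \<Rightarrow> ('f, 'r) fm" where
  "ren \<sigma> (Eq s t) = Eq (ren_trm \<sigma> s) (ren_trm \<sigma> t)"
| "ren \<sigma> (Rel r ts) = Rel r (map (ren_trm \<sigma>) ts)"
| "ren \<sigma> (Neg \<phi>) = Neg (ren \<sigma> \<phi>)"
| "ren \<sigma> (Conj \<phi> \<psi>) = Conj (ren \<sigma> \<phi>) (ren \<sigma> \<psi>)"
| "ren \<sigma> (Ex x \<phi>) =
    (let z = Suc (Max (insert 0 (\<sigma> ` fv \<phi>))) in Ex z (ren (\<sigma>(x := z)) \<phi>))"

lemma L_ren_trm: "L_trm L t \<Longrightarrow> L_trm L (ren_trm \<sigma> t)"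
  by (induction t) (auto simp: list_all_iff)

lemma L_ren: "L_fm L \<phi> \<Longrightarrow> L_fm L (ren \<sigma> \<phi>)"
  by (induction \<phi> arbitrary: \<sigma>) (auto simp: L_ren_trm list_all_iff Let_def)

lemma val_ren: "val \<A> e (ren_trm \<sigma> t) = val \<A> (\<lambda>y. e (\<sigma> y)) t"
proof (induction t)
  case (Fn f ts)
  then have "map (val \<A> e \<circ> ren_trm \<sigma>) ts = map (val \<A> (\<lambda>y. e (\<sigma> y))) ts" by auto
  then show ?case by (simp del: map_eq_conv)
qed auto

lemma sat_ren: "sat \<A> e (ren \<sigma> \<phi>) = sat \<A> (\<lambda>y. e (\<sigma> y)) \<phi>"
proof (induction \<phi> arbitrary: \<sigma> e)
  case (Rel r ts)
  have "map (val \<A> e \<circ> ren_trm \<sigma>) ts = map (val \<A> (\<lambda>y. e (\<sigma> y))) ts" by (auto simp: val_ren)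
  then show ?case by (simp del: map_eq_conv)
next
  case (Ex x \<phi>)
  define z where "z = Suc (Max (insert 0 (\<sigma> ` fv \<phi>)))"
  have z: "\<sigma> y \<noteq> z" if "y \<in> fv \<phi>" for y
  proof -
    have "\<sigma> y \<le> Max (insert 0 (\<sigma> ` fv \<phi>))" using that finite_fv by (intro Max_ge) auto
    then show ?thesis by (simp add: z_def)
  qed
  have "sat \<A> (\<lambda>y. (e(z := a)) ((\<sigma>(x := z)) y)) \<phi> = sat \<A> ((\<lambda>y. e (\<sigma> y))(x := a)) \<phi>" for a
    using z by (intro sat_cong) auto
  then show ?case by (simp add: Ex z_def[symmetric] Let_def)
qed (auto simp: val_ren)

text \<open>Turns formulas with parameters into sentences of the expanded language, which are what
  \<open>elem_equiv\<close> compares. Constants contain no variables, so nothing can be captured;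
  \<open>None\<close> marks a variable that stays, and a quantifier resets its own variable to
  it.\<close>

primrec sub_trm :: "(nat \<Rightarrow> 'c option) \<Rightarrow> 'f trm \<Rightarrow> ('f + 'c) trm" where
  "sub_trm \<sigma> (Var x) = (case \<sigma> x of None \<Rightarrow> Var x | Some c \<Rightarrow> Fn (Inr c) [])"
| "sub_trm \<sigma> (Fn f ts) = Fn (Inl f) (map (sub_trm \<sigma>) ts)"

primrec sub :: "(nat \<Rightarrow> 'c option) \<Rightarrow> ('f, 'r) fm \<Rightarrow> ('f + 'c, 'r) fm" where
  "sub \<sigma> (Eq s t) = Eq (sub_trm \<sigma> s) (sub_trm \<sigma> t)"
| "sub \<sigma> (Rel r ts) = Rel r (map (sub_trm \<sigma>) ts)"
| "sub \<sigma> (Neg \<phi>) = Neg (sub \<sigma> \<phi>)"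
| "sub \<sigma> (Conj \<phi> \<psi>) = Conj (sub \<sigma> \<phi>) (sub \<sigma> \<psi>)"
| "sub \<sigma> (Ex x \<phi>) = Ex x (sub (\<sigma>(x := None)) \<phi>)"

lemma val_sub:
  "val (expand \<A> a) e (sub_trm \<sigma> t) = val \<A> (\<lambda>x. case \<sigma> x of None \<Rightarrow> e x | Some c \<Rightarrow> a c) t"
proof (induction t)
  case (Var x)
  then show ?case by (auto simp: expand_def split: option.split)
next
  case (Fn f ts)
  have "map (val (expand \<A> a) e \<circ> sub_trm \<sigma>) ts
      = map (val \<A> (\<lambda>x. case \<sigma> x of None \<Rightarrow> e x | Some c \<Rightarrow> a c)) ts" using Fn by auto
  moreover have "fint (expand \<A> a) (Inl f) = fint \<A> f" by (simp add: expand_def)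
  ultimately show ?case by (simp del: map_eq_conv)
qed

lemma sat_sub:
  "sat (expand \<A> a) e (sub \<sigma> \<phi>) = sat \<A> (\<lambda>x. case \<sigma> x of None \<Rightarrow> e x | Some c \<Rightarrow> a c) \<phi>"
proof (induction \<phi> arbitrary: \<sigma> e)
  case (Rel r ts)
  have "map (val (expand \<A> a) e \<circ> sub_trm \<sigma>) ts
      = map (val \<A> (\<lambda>x. case \<sigma> x of None \<Rightarrow> e x | Some c \<Rightarrow> a c)) ts" by (auto simp: val_sub)
  moreover have "rint (expand \<A> a) r = rint \<A> r" by (simp add: expand_def)
  ultimately show ?case by (simp del: map_eq_conv)
next
  case (Ex x \<phi>)
  have "(\<lambda>y. case (\<sigma>(x := None)) y of None \<Rightarrow> (e(x := b)) y | Some c \<Rightarrow> a c)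
      = (\<lambda>y. case \<sigma> y of None \<Rightarrow> e y | Some c \<Rightarrow> a c)(x := b)" for b
    by (rule ext) (simp split: option.split)
  moreover have "univ (expand \<A> a) = univ \<A>" by (simp add: expand_def)
  ultimately show ?case by (simp add: Ex)
qed (auto simp: val_sub)

lemma fv_sub_trm: "fv_trm (sub_trm \<sigma> t) = fv_trm t \<inter> {x. \<sigma> x = None}"
  by (induction t) (auto split: option.split)

lemma fv_sub: "fv (sub \<sigma> \<phi>) = fv \<phi> \<inter> {x. \<sigma> x = None}"
  by (induction \<phi> arbitrary: \<sigma>) (auto simp: fv_sub_trm)

lemma L_sub_trm:
  "L_trm L t \<Longrightarrow> (\<And>x c. x \<in> fv_trm t \<Longrightarrow> \<sigma> x = Some c \<Longrightarrow> c \<in> C) \<Longrightarrow>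
    L_trm (lang_consts L C) (sub_trm \<sigma> t)"
proof (induction t)
  case (Var x)
  then show ?case by (auto simp: lang_consts_def split: option.split)
next
  case (Fn f ts)
  have "L_trm (lang_consts L C) (sub_trm \<sigma> t)" if "t \<in> set ts" for t
    using Fn that by (auto simp: list_all_iff)
  then show ?case using Fn.prems by (auto simp: list_all_iff lang_consts_def)
qed

lemma L_sub:
  "L_fm L \<phi> \<Longrightarrow> (\<And>x c. x \<in> fv \<phi> \<Longrightarrow> \<sigma> x = Some c \<Longrightarrow> c \<in> C) \<Longrightarrow>
    L_fm (lang_consts L C) (sub \<sigma> \<phi>)"
proof (induction \<phi> arbitrary: \<sigma>)
  case (Rel r ts)
  have "L_trm (lang_consts L C) (sub_trm \<sigma> t)" if "t \<in> set ts" for t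
    using Rel that by (intro L_sub_trm) (auto simp: list_all_iff)
  then show ?case using Rel.prems by (auto simp: list_all_iff lang_consts_def)
next
  case (Ex x \<phi>)
  have "L_fm (lang_consts L C) (sub (\<sigma>(x := None)) \<phi>)"
    using Ex.prems by (intro Ex.IH) (auto split: if_splits)
  then show ?case by simp
qed (auto intro: L_sub_trm)

text \<open>There is no constant for truth in \<open>fm\<close>; a valid equation stands in for it,
  which is where the 0 in \<open>fv_conj_list\<close> comes from.\<close>

primrec conj_list :: "('f, 'r) fm list \<Rightarrow> ('f, 'r) fm" where
  "conj_list [] = Eq (Var 0) (Var 0)"
| "conj_list (\<phi> # \<phi>s) = Conj \<phi> (conj_list \<phi>s)"

lemma sat_conj_list: "sat \<A> e (conj_list \<phi>s) \<longleftrightarrow> (\<forall>\<phi> \<in> set \<phi>s. sat \<A> e \<phi>)"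
  by (induction \<phi>s) auto

lemma L_conj_list: "L_fm L (conj_list \<phi>s) \<longleftrightarrow> (\<forall>\<phi> \<in> set \<phi>s. L_fm L \<phi>)"
  by (induction \<phi>s) auto

lemma fv_conj_list: "fv (conj_list \<phi>s) = insert 0 (\<Union> (fv ` set \<phi>s))"
  by (induction \<phi>s) auto

section \<open>Existence of ultrafilters, and ultrapowers restricted to Skolem hulls\<close>

section \<open>Ultrafilters and ultrapowers\<close>

definition ultra :: "'i filter \<Rightarrow> bool" where
  "ultra U \<longleftrightarrow> U \<noteq> bot \<and> (\<forall>P. eventually P U \<or> eventually (\<lambda>x. \<not> P x) U)"

lemma ultra_not: "ultra U \<Longrightarrow> eventually (\<lambda>x. \<not> P x) U \<longleftrightarrow> \<not> eventually P U"
  using eventually_conj[of P U "\<lambda>x. \<not> P x"] unfolding ultra_def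
  by (auto simp: eventually_False)

text \<open>Zorn's lemma for proper filters, finer ones being larger. The infimum of a chain is
  proper because whatever holds eventually in it already does so in a member. A maximal filter
  decides \<open>P\<close>, as otherwise its restriction to \<open>P\<close> would be proper and
  strictly finer.\<close>

lemma ultra_ex:
  fixes F :: "'i filter"
  assumes "F \<noteq> bot"
  shows "\<exists>U \<le> F. ultra U"
proof -
  define S where "S = {X. X \<noteq> bot \<and> X \<le> F}"
  define r where "r = {(X, Y). X \<in> S \<and> Y \<in> S \<and> Y \<le> X}"
  have "\<exists>m \<in> Field r. \<forall>a \<in> Field r. (m, a) \<in> r \<longrightarrow> a = m"
  proof (rule Zorns_po_lemma)
    show "Partial_order r"
    proof -
      have "Field r = S" by (auto simp: Field_def r_def)
      moreover have "refl_on S r" "trans r" "antisym r"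
        by (auto simp: r_def refl_on_def trans_def antisym_def)
      moreover have "r \<subseteq> S \<times> S" by (auto simp: r_def)
      ultimately show ?thesis by (simp add: partial_order_on_def preorder_on_def)
    qed
    fix C assume C: "C \<in> Chains r"
    show "\<exists>u \<in> Field r. \<forall>a \<in> C. (a, u) \<in> r"
    proof (cases "C = {}")
      case True
      have "F \<in> Field r" using assms by (auto simp: Field_def r_def S_def)
      with True show ?thesis by auto
    next
      case False
      have sub: "C \<subseteq> S" using C by (auto simp: Chains_def r_def)
      have ev: "eventually P (Inf C) \<longleftrightarrow> (\<exists>b \<in> C. eventually P b)" for P
      proof (rule eventually_Inf_base[OF False])
        fix a b assume "a \<in> C" "b \<in> C"
        then have "(a, b) \<in> r \<or> (b, a) \<in> r" using C by (auto simp: Chains_def)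
        then show "\<exists>x \<in> C. x \<le> inf a b" using \<open>a \<in> C\<close> \<open>b \<in> C\<close>
          unfolding r_def by (auto simp: le_inf_iff)
      qed
      have "\<not> eventually (\<lambda>_. False) (Inf C)"
        unfolding ev using sub by (auto simp: S_def eventually_False)
      then have "Inf C \<noteq> bot" by (simp add: eventually_False)
      moreover obtain c where "c \<in> C" using False by blast
      then have "Inf C \<le> c" "c \<le> F" using sub by (auto simp: S_def intro: Inf_lower)
      then have "Inf C \<le> F" by (rule order_trans)
      ultimately have "Inf C \<in> S" by (simp add: S_def)
      then show ?thesis using sub by (intro bexI[of _ "Inf C"]) (auto simp: r_def Field_def Inf_lower)
    qed
  qed
  then obtain U where U: "U \<in> S" and max: "\<And>X. X \<in> S \<Longrightarrow> X \<le> U \<Longrightarrow> X = U"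
    by (auto simp: r_def Field_def)
  have "eventually P U \<or> eventually (\<lambda>x. \<not> P x) U" for P
  proof (rule ccontr)
    assume n: "\<not> ?thesis"
    define X where "X = inf U (principal {x. P x})"
    have "X \<noteq> bot"
      using n unfolding X_def eventually_False[symmetric] eventually_inf_principal by simp
    moreover have "X \<le> U" by (simp add: X_def)
    ultimately have "X = U" using U by (intro max) (auto simp: S_def)
    moreover have "eventually P X" by (simp add: X_def eventually_inf_principal)
    ultimately show False using n by simp
  qed
  then show ?thesis using U unfolding ultra_def S_def by blast
qed

lemma ultra_fip:
  fixes S :: "'i set set"
  assumes "\<And>X. finite X \<Longrightarrow> X \<subseteq> S \<Longrightarrow> \<Inter> X \<noteq> {}"
  shows "\<exists>U. ultra U \<and> (\<forall>s \<in> S. eventually (\<lambda>x. x \<in> s) U)"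
proof -
  define F where "F = (INF s \<in> S. principal s)"
  have "F \<noteq> bot"
  proof
    assume "F = bot"
    then have "eventually (\<lambda>_. False) F" by simp
    then have "\<exists>X \<subseteq> S. finite X \<and> eventually (\<lambda>_. False) (INF s \<in> X. principal s)"
      unfolding F_def by (subst (asm) eventually_INF)
    then obtain X where X: "X \<subseteq> S" "finite X"
      and ev: "eventually (\<lambda>_. False) (INF s \<in> X. principal s)"
      by blast
    have "(INF s \<in> X. principal s) = principal (\<Inter>s \<in> X. s)"
      using X(2) by (rule INF_principal_finite)
    with ev have "eventually (\<lambda>_. False) (principal (\<Inter>s \<in> X. s))" by (simp only:)
    then have "\<Inter> X = {}" by (auto simp only: eventually_principal image_ident)
    with assms[OF X(2,1)] show False by contradiction
  qed
  then obtain U where U: "U \<le> F" "ultra U" using ultra_ex by blast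
  have "eventually (\<lambda>x. x \<in> s) U" if "s \<in> S" for s
  proof -
    have "F \<le> principal s" unfolding F_def using that by (rule INF_lower)
    with U(1) have "U \<le> principal s" by (rule order_trans)
    then show ?thesis by (simp add: le_principal)
  qed
  with U show ?thesis by blast
qed

text \<open>
  The closure of countably many elements under a family of Skolem functions, indexed by
  formulas, is the range of a map defined on formulas, as these can code finite lists.
\<close>

fun hull_list ::
  "(nat \<Rightarrow> 'e) \<Rightarrow> (nat \<Rightarrow> ('f, 'r) fm \<Rightarrow> 'e list \<Rightarrow> 'e) \<Rightarrow> ('f, 'r) fm \<Rightarrow> 'e list" where
  "hull_list b w (Eq (Var n) t) = [b n]"
| "hull_list b w (Conj \<phi> \<psi>) = hull_list b w \<phi> @ hull_list b w \<psi>"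
| "hull_list b w (Ex x (Conj \<phi> \<psi>)) = [w x \<phi> (hull_list b w \<psi>)]"
| "hull_list b w _ = []"

text \<open>\<open>k\<close> picks a code of the one-element list, so the hull is no larger than the
  type of formulas. This is exactly the room that \<open>card_saturated\<close> leaves for
  elementary extensions.\<close>

lemma skolem_hull:
  fixes b :: "nat \<Rightarrow> 'e" and w :: "nat \<Rightarrow> ('f, 'r) fm \<Rightarrow> 'e list \<Rightarrow> 'e"
  shows "\<exists>H (k :: 'e \<Rightarrow> ('f, 'r) fm). inj_on k H \<and> range b \<subseteq> H \<and>
    (\<forall>x \<phi> ts. set ts \<subseteq> H \<longrightarrow> w x \<phi> ts \<in> H)"
proof -
  define H where "H = {e. \<exists>\<phi>. hull_list b w \<phi> = [e]}"
  define k where "k = (\<lambda>e. SOME \<phi>. hull_list b w \<phi> = [e])"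
  have k: "hull_list b w (k e) = [e]" if "e \<in> H" for e
    using that unfolding H_def k_def mem_Collect_eq by (rule someI_ex)
  have "inj_on k H"
  proof (rule inj_onI)
    fix e e' assume e: "e \<in> H" "e' \<in> H" and eq: "k e = k e'"
    have "[e] = [e']" unfolding k[OF e(1), symmetric] k[OF e(2), symmetric] eq by (rule refl)
    then show "e = e'" by simp
  qed
  moreover have "b n \<in> H" for n
  proof -
    have "hull_list b w (Eq (Var n) (Var 0)) = [b n]" by simp
    then show ?thesis unfolding H_def by blast
  qed
  moreover have "w x \<phi> ts \<in> H" if "set ts \<subseteq> H" for x \<phi> ts
  proof -
    have "\<exists>\<psi>. hull_list b w \<psi> = ts" using that
    proof (induction ts)
      case Nil
      have "hull_list b w (Neg (Eq (Var 0) (Var 0))) = []" by simp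
      then show ?case by blast
    next
      case (Cons t ts)
      then obtain \<psi> where "hull_list b w \<psi> = ts" by auto
      then have "hull_list b w (Conj (k t) \<psi>) = t # ts"
        using k[of t] Cons.prems by simp
      then show ?case by blast
    qed
    then obtain \<psi> where "hull_list b w \<psi> = ts" by blast
    then have "hull_list b w (Ex x (Conj \<phi> \<psi>)) = [w x \<phi> ts]" by simp
    then show ?thesis unfolding H_def by blast
  qed
  ultimately show ?thesis by blast
qed

lemma bounded_vars: "\<exists>N. \<forall>n \<in> fv \<phi>. n < N"
proof -
  have "\<forall>n \<in> fv \<phi>. n < Suc (Max (fv \<phi>))" using finite_fv[of \<phi>] by (simp add: le_imp_less_Suc)
  then show ?thesis by blast
qed

text \<open>The full ultrapower may be too large for the prescribed type, so only classes of
  functions in a Skolem-closed set \<open>H\<close> are kept. The theorem of Los survives this: a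
  witness of an existential formula is chosen coordinate by coordinate by a Skolem function and thus
  stays in \<open>H\<close>. The element \<open>b\<close> is the class of \<open>b0\<close>.\<close>

lemma ultrapower_extension:
  fixes \<A> :: "('u, 'f, 'r) fo_structure" and U :: "'i filter" and b0 :: "'i \<Rightarrow> 'u"
  assumes str: "is_structure L \<A>" and ctbl: "countable (univ \<A>)" and U: "ultra U"
    and b0: "\<And>i. b0 i \<in> univ \<A>"
  shows "\<exists>(\<B> :: ('u + ('f, 'r) fm, 'f, 'r) fo_structure) h b.
    is_structure L \<B> \<and> elem_embedding L \<A> \<B> h \<and> b \<in> univ \<B> \<and>
    (\<forall>\<phi> e n. L_fm L \<phi> \<longrightarrow> (\<forall>m. e m \<in> univ \<A>) \<longrightarrow>
      sat \<B> ((h \<circ> e)(n := b)) \<phi> = eventually (\<lambda>i. sat \<A> (e(n := b0 i)) \<phi>) U)"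
proof -
  let ?A = "univ \<A>"
  have ne: "?A \<noteq> {}" using str by (simp add: is_structure_def)
  have Ubot: "U \<noteq> bot" using U by (simp add: ultra_def)
  \<comment> \<open>The generators are \<open>b0\<close> and the constant functions, through which
    \<open>\<A>\<close> embeds; countability of the universe makes them a sequence.\<close>
  define gen where "gen = (\<lambda>n. case n of 0 \<Rightarrow> b0 | Suc m \<Rightarrow> (\<lambda>_::'i. from_nat_into ?A m))"
  \<comment> \<open>Skolem functions acting coordinatewise, with variable n read as entry n of the
    list. The default \<open>b0 i\<close> keeps the values in the universe.\<close>
  define w where "w = (\<lambda>x (\<phi> :: ('f, 'r) fm) ts i.
    if \<exists>d \<in> ?A. sat \<A> ((\<lambda>n. (ts ! n) i)(x := d)) \<phi>
    then SOME d. d \<in> ?A \<and> sat \<A> ((\<lambda>n. (ts ! n) i)(x := d)) \<phi> else b0 i)"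
  obtain H' and k :: "('i \<Rightarrow> 'u) \<Rightarrow> ('f, 'r) fm" where inj: "inj_on k H'" and gen: "range gen \<subseteq> H'"
    and w_H': "\<And>x \<phi> ts. set ts \<subseteq> H' \<Longrightarrow> w x \<phi> ts \<in> H'"
    using skolem_hull[of gen w] by blast
  \<comment> \<open>The hull is known to be closed but not to be least, so functions with values
    outside the universe have to be discarded.\<close>
  define H where "H = H' \<inter> {t. \<forall>i. t i \<in> ?A}"
  have w_A: "w x \<phi> ts i \<in> ?A" for x \<phi> ts i
  proof (cases "\<exists>d \<in> ?A. sat \<A> ((\<lambda>n. (ts ! n) i)(x := d)) \<phi>")
    case True
    then have "\<exists>d. d \<in> ?A \<and> sat \<A> ((\<lambda>n. (ts ! n) i)(x := d)) \<phi>" by blast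
    from someI_ex[OF this] True show ?thesis by (simp only: w_def if_True)
  next
    case False
    then show ?thesis by (simp only: w_def if_False b0)
  qed
  have w_sat: "sat \<A> ((\<lambda>n. (ts ! n) i)(x := w x \<phi> ts i)) \<phi>"
    if "\<exists>d \<in> ?A. sat \<A> ((\<lambda>n. (ts ! n) i)(x := d)) \<phi>" for x \<phi> ts i
  proof -
    have "\<exists>d. d \<in> ?A \<and> sat \<A> ((\<lambda>n. (ts ! n) i)(x := d)) \<phi>" using that by blast
    from someI_ex[OF this] that show ?thesis by (simp only: w_def if_True)
  qed
  have w_H: "w x \<phi> ts \<in> H" if "set ts \<subseteq> H" for x \<phi> ts
    using w_H'[of ts x \<phi>] that w_A by (auto simp: H_def)
  have H_A: "t i \<in> ?A" if "t \<in> H" for t i using that by (simp add: H_def)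
  have b0_H: "b0 \<in> H"
  proof -
    have "gen 0 \<in> H'" using gen by blast
    then show ?thesis using b0 by (simp add: gen_def H_def)
  qed
  have const_H: "(\<lambda>_. a) \<in> H" if a: "a \<in> ?A" for a
  proof -
    obtain m where m: "from_nat_into ?A m = a" using from_nat_into_surj[OF ctbl a] by blast
    have "gen (Suc m) \<in> H'" using gen by blast
    then show ?thesis using a by (simp add: gen_def H_def m)
  qed
  define eqv where "eqv = (\<lambda>t t'. eventually (\<lambda>i. t i = (t' i :: 'u)) U)"
  have eqv_refl: "eqv t t" for t by (simp add: eqv_def)
  have eqv_sym: "eqv t' t" if "eqv t t'" for t t' using that unfolding eqv_def
    by (rule eventually_mono) simp
  have eqv_trans: "eqv t t''" if "eqv t t'" "eqv t' t''" for t t' t''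
    using that unfolding eqv_def by eventually_elim simp
  define rep where "rep = (\<lambda>t. SOME t'. t' \<in> H \<and> eqv t' t)"
  have rep: "rep t \<in> H \<and> eqv (rep t) t" if "t \<in> H" for t
  proof -
    have "\<exists>t'. t' \<in> H \<and> eqv t' t" using that eqv_refl by blast
    from someI_ex[OF this] show ?thesis by (simp only: rep_def)
  qed
  \<comment> \<open>A class is named by the code of its chosen representative and so lies in the
    summand of formulas.\<close>
  define cls :: "('i \<Rightarrow> 'u) \<Rightarrow> 'u + ('f, 'r) fm" where "cls = (\<lambda>t. Inr (k (rep t)))"
  have cls_eq: "cls t = cls t'" if "eqv t t'" for t t'
  proof -
    have "eqv s t \<longleftrightarrow> eqv s t'" for s
      using that eqv_trans eqv_sym by blast
    then show ?thesis by (simp add: cls_def rep_def)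
  qed
  have eqv_cls: "eqv t t'" if "cls t = cls t'" "t \<in> H" "t' \<in> H" for t t'
  proof -
    have r: "rep t \<in> H" "eqv (rep t) t" "rep t' \<in> H" "eqv (rep t') t'"
      using rep[OF that(2)] rep[OF that(3)] by auto
    then have "rep t = rep t'" using that(1) inj by (simp add: cls_def inj_on_def H_def)
    with r show ?thesis using eqv_trans eqv_sym by metis
  qed
  define dec where "dec = (\<lambda>z. SOME t. t \<in> H \<and> cls t = z)"
  have dec: "dec z \<in> H" "cls (dec z) = z" if "z \<in> cls ` H" for z
  proof -
    have "\<exists>t. t \<in> H \<and> cls t = z" using that by blast
    from someI_ex[OF this] show "dec z \<in> H" "cls (dec z) = z" by (auto simp only: dec_def)
  qed
  have dec_cls: "eqv (dec (cls t)) t" if "t \<in> H" for t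
    using dec[of "cls t"] that by (intro eqv_cls) auto
  define \<B> where "\<B> = \<lparr>univ = cls ` H,
    fint = (\<lambda>f zs. cls (\<lambda>i. fint \<A> f (map (\<lambda>z. dec z i) zs))),
    rint = (\<lambda>r zs. eventually (\<lambda>i. rint \<A> r (map (\<lambda>z. dec z i) zs)) U)\<rparr>"
  have univ_B: "univ \<B> = cls ` H" by (simp add: \<B>_def)
  have fint_B: "fint \<B> f zs = cls (\<lambda>i. fint \<A> f (map (\<lambda>z. dec z i) zs))" for f zs
    by (simp add: \<B>_def)
  have rint_B: "rint \<B> r zs = eventually (\<lambda>i. rint \<A> r (map (\<lambda>z. dec z i) zs)) U" for r zs
    by (simp add: \<B>_def)
  have fn_H: "(\<lambda>i. fint \<A> f (map (\<lambda>z. dec z i) zs)) \<in> H"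
    if f: "(f, length zs) \<in> funs L" and zs: "set zs \<subseteq> univ \<B>" for f zs
  proof -
    let ?n = "length zs" and ?ts = "map dec zs"
    \<comment> \<open>The value of \<open>f\<close> is the only witness for this formula, so the
      Skolem function must return it; closure under Skolem functions thereby covers the function
      symbols.\<close>
    let ?\<phi> = "Eq (Var ?n) (Fn f (map Var [0..<?n])) :: ('f, 'r) fm"
    have ts: "set ?ts \<subseteq> H" using zs dec by (auto simp: univ_B)
    have args: "map (val \<A> ((\<lambda>n. (?ts ! n) i)(?n := d))) (map Var [0..<?n]) = map (\<lambda>z. dec z i) zs"
      for i d by (rule nth_equalityI) auto
    have "dec z i \<in> ?A" if "z \<in> set zs" for z i
      using ts that by (intro H_A) auto
    then have in_A: "fint \<A> f (map (\<lambda>z. dec z i) zs) \<in> ?A" for i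
      by (intro is_structureD[OF str f]) auto
    have sat_iff: "sat \<A> ((\<lambda>n. (?ts ! n) i)(?n := d)) ?\<phi> \<longleftrightarrow> d = fint \<A> f (map (\<lambda>z. dec z i) zs)"
      for i d
      using args[of i d] by (simp del: map_map map_eq_conv)
    have "w ?n ?\<phi> ?ts i = fint \<A> f (map (\<lambda>z. dec z i) zs)" for i
      using w_sat[where ts = ?ts and i = i and x = ?n and \<phi> = ?\<phi>] in_A[of i]
      unfolding sat_iff by blast
    then have "w ?n ?\<phi> ?ts = (\<lambda>i. fint \<A> f (map (\<lambda>z. dec z i) zs))" by (rule ext)
    with w_H[OF ts, of ?n ?\<phi>] show ?thesis by (simp only:)
  qed
  have str_B: "is_structure L \<B>"
  proof -
    have "univ \<B> \<noteq> {}" using b0_H by (auto simp: univ_B)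
    moreover have "fint \<B> f zs \<in> univ \<B>"
      if "(f, n) \<in> funs L" "zs \<in> lists (univ \<B>)" "length zs = n" for f n zs
    proof -
      have "set zs \<subseteq> univ \<B>" using that(2) by auto
      with that fn_H[of f zs] show ?thesis by (simp add: fint_B univ_B)
    qed
    ultimately show ?thesis unfolding is_structure_def by blast
  qed
  have val_B: "val \<B> e t \<in> univ \<B> \<and>
      eventually (\<lambda>i. dec (val \<B> e t) i = val \<A> (\<lambda>n. dec (e n) i) t) U"
    if "L_trm L t" and e: "\<And>m. e m \<in> univ \<B>" for e t
    using that(1)
  proof (induction t)
    case (Var x)
    then show ?case using e by simp
  next
    case (Fn f ts)
    have IH: "val \<B> e t \<in> univ \<B>"
      "eventually (\<lambda>i. dec (val \<B> e t) i = val \<A> (\<lambda>n. dec (e n) i) t) U" if "t \<in> set ts" for t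
      using Fn.IH[OF that] Fn.prems that by (auto simp: list_all_iff)
    let ?g = "\<lambda>i. fint \<A> f (map (\<lambda>z. dec z i) (map (val \<B> e) ts))"
    have g: "?g \<in> H" using Fn.prems IH by (intro fn_H) auto
    have "eventually (\<lambda>i. \<forall>t \<in> set ts. dec (val \<B> e t) i = val \<A> (\<lambda>n. dec (e n) i) t) U"
      using IH by (intro eventually_ball_finite) auto
    moreover have "eventually (\<lambda>i. dec (cls ?g) i = ?g i) U" using dec_cls[OF g] by (simp add: eqv_def)
    ultimately have "eventually (\<lambda>i. dec (val \<B> e (Fn f ts)) i = val \<A> (\<lambda>n. dec (e n) i) (Fn f ts)) U"
    proof eventually_elim
      case (elim i)
      have "map (\<lambda>z. dec z i) (map (val \<B> e) ts) = map (val \<A> (\<lambda>n. dec (e n) i)) ts"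
        using elim(1) by simp
      with elim(2) show ?case by (simp only: val.simps fint_B)
    qed
    then show ?case using g by (simp only: val.simps fint_B univ_B imageI simp_thms)
  qed
  have los: "sat \<B> e \<phi> = eventually (\<lambda>i. sat \<A> (\<lambda>n. dec (e n) i) \<phi>) U"
    if "L_fm L \<phi>" "\<And>m. e m \<in> univ \<B>" for e \<phi>
    using that
  proof (induction \<phi> arbitrary: e)
    case (Eq s t)
    have s: "val \<B> e s \<in> cls ` H" "eventually (\<lambda>i. dec (val \<B> e s) i = val \<A> (\<lambda>n. dec (e n) i) s) U"
      using val_B[of s e] Eq by (auto simp: univ_B)
    have t: "val \<B> e t \<in> cls ` H" "eventually (\<lambda>i. dec (val \<B> e t) i = val \<A> (\<lambda>n. dec (e n) i) t) U"
      using val_B[of t e] Eq by (auto simp: univ_B)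
    have "val \<B> e s = val \<B> e t \<longleftrightarrow> eqv (dec (val \<B> e s)) (dec (val \<B> e t))"
    proof
      assume "eqv (dec (val \<B> e s)) (dec (val \<B> e t))"
      from cls_eq[OF this] show "val \<B> e s = val \<B> e t" by (simp only: dec(2)[OF s(1)] dec(2)[OF t(1)])
    qed (simp add: eqv_refl)
    also have "\<dots> \<longleftrightarrow> eventually (\<lambda>i. val \<A> (\<lambda>n. dec (e n) i) s = val \<A> (\<lambda>n. dec (e n) i) t) U"
      unfolding eqv_def using eventually_conj[OF s(2) t(2)]
      by (intro eventually_subst) (auto elim: eventually_mono)
    finally show ?case by simp
  next
    case (Rel r ts)
    have "eventually (\<lambda>i. \<forall>t \<in> set ts. dec (val \<B> e t) i = val \<A> (\<lambda>n. dec (e n) i) t) U"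
      using val_B[of _ e] Rel by (intro eventually_ball_finite) (auto simp: list_all_iff)
    then have "eventually (\<lambda>i. rint \<A> r (map (\<lambda>z. dec z i) (map (val \<B> e) ts)) =
        rint \<A> r (map (val \<A> (\<lambda>n. dec (e n) i)) ts)) U"
    proof eventually_elim
      case (elim i)
      have "map (\<lambda>z. dec z i) (map (val \<B> e) ts) = map (val \<A> (\<lambda>n. dec (e n) i)) ts"
        using elim by simp
      then show ?case by (simp only:)
    qed
    then have "eventually (\<lambda>i. rint \<A> r (map (\<lambda>z. dec z i) (map (val \<B> e) ts))) U =
        eventually (\<lambda>i. rint \<A> r (map (val \<A> (\<lambda>n. dec (e n) i)) ts)) U"
      by (rule eventually_subst)
    then show ?case by (simp only: sat.simps rint_B)
  next
    case (Neg \<phi>)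
    have "sat \<B> e \<phi> = eventually (\<lambda>i. sat \<A> (\<lambda>n. dec (e n) i) \<phi>) U"
      using Neg.prems by (intro Neg.IH) auto
    then show ?case using ultra_not[OF U] by simp
  next
    case (Conj \<phi> \<psi>)
    have "sat \<B> e \<phi> = eventually (\<lambda>i. sat \<A> (\<lambda>n. dec (e n) i) \<phi>) U"
      using Conj.prems by (intro Conj.IH(1)) auto
    moreover have "sat \<B> e \<psi> = eventually (\<lambda>i. sat \<A> (\<lambda>n. dec (e n) i) \<psi>) U"
      using Conj.prems by (intro Conj.IH(2)) auto
    ultimately show ?case by (simp add: eventually_conj_iff)
  next
    case (Ex x \<phi>)
    have IH: "sat \<B> (e(x := z)) \<phi> = eventually (\<lambda>i. sat \<A> ((\<lambda>n. dec (e n) i)(x := dec z i)) \<phi>) U"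
      if "z \<in> univ \<B>" for z
    proof -
      have "sat \<B> (e(x := z)) \<phi> = eventually (\<lambda>i. sat \<A> (\<lambda>n. dec ((e(x := z)) n) i) \<phi>) U"
        using Ex.prems that by (intro Ex.IH) auto
      moreover have "(\<lambda>n. dec ((e(x := z)) n) i) = (\<lambda>n. dec (e n) i)(x := dec z i)" for i
        by (rule ext) simp
      ultimately show ?thesis by (simp only:)
    qed
    show ?case
    proof
      assume "sat \<B> e (Ex x \<phi>)"
      then obtain z where z: "z \<in> univ \<B>" "sat \<B> (e(x := z)) \<phi>" by auto
      have "eventually (\<lambda>i. sat \<A> ((\<lambda>n. dec (e n) i)(x := dec z i)) \<phi>) U" using IH[OF z(1)] z(2) by simp
      then show "eventually (\<lambda>i. sat \<A> (\<lambda>n. dec (e n) i) (Ex x \<phi>)) U"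
      proof eventually_elim
        case (elim i)
        have "dec z i \<in> ?A" using z(1) dec(1)[of z] H_A by (simp add: univ_B)
        with elim show ?case by auto
      qed
    next
      assume ev: "eventually (\<lambda>i. sat \<A> (\<lambda>n. dec (e n) i) (Ex x \<phi>)) U"
      \<comment> \<open>A bound on the free variables turns the assignment into a finite list, as
        the Skolem function requires.\<close>
      obtain N where N: "\<forall>n \<in> fv \<phi>. n < N" using bounded_vars by blast
      define ts where "ts = map (\<lambda>n. dec (e n)) [0..<N]"
      have ts: "set ts \<subseteq> H" using Ex.prems(2) dec(1) by (auto simp: ts_def univ_B)
      define t where "t = w x \<phi> ts"
      have t: "t \<in> H" unfolding t_def using ts by (rule w_H)
      have same: "sat \<A> ((\<lambda>n. (ts ! n) i)(x := d)) \<phi> = sat \<A> ((\<lambda>n. dec (e n) i)(x := d)) \<phi>" for i d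
        using N by (intro sat_cong) (auto simp: ts_def)
      have "eventually (\<lambda>i. dec (cls t) i = t i) U" using dec_cls[OF t] by (simp add: eqv_def)
      with ev have "eventually (\<lambda>i. sat \<A> ((\<lambda>n. dec (e n) i)(x := dec (cls t) i)) \<phi>) U"
      proof eventually_elim
        case (elim i)
        have "\<exists>d \<in> ?A. sat \<A> ((\<lambda>n. (ts ! n) i)(x := d)) \<phi>" using elim(1) by (simp add: same)
        from w_sat[OF this] show ?case unfolding same elim(2) by (simp only: t_def)
      qed
      moreover have "cls t \<in> univ \<B>" using t by (simp add: univ_B)
      ultimately show "sat \<B> e (Ex x \<phi>)" using IH by auto
    qed
  qed
  \<comment> \<open>The same with arbitrary representatives in place of decoded ones: for the
    finitely many free variables both agree almost everywhere simultaneously.\<close>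
  have los_cls: "sat \<B> (\<lambda>n. cls (\<tau> n)) \<phi> = eventually (\<lambda>i. sat \<A> (\<lambda>n. \<tau> n i) \<phi>) U"
    if "L_fm L \<phi>" "\<And>m. \<tau> m \<in> H" for \<tau> \<phi>
  proof -
    have "eventually (\<lambda>i. \<forall>n \<in> fv \<phi>. dec (cls (\<tau> n)) i = \<tau> n i) U"
      using dec_cls[OF that(2)] by (intro eventually_ball_finite) (auto simp: finite_fv eqv_def)
    then have "eventually (\<lambda>i. sat \<A> (\<lambda>n. dec (cls (\<tau> n)) i) \<phi> = sat \<A> (\<lambda>n. \<tau> n i) \<phi>) U"
      by eventually_elim (rule sat_cong, blast)
    then have "eventually (\<lambda>i. sat \<A> (\<lambda>n. dec (cls (\<tau> n)) i) \<phi>) U = eventually (\<lambda>i. sat \<A> (\<lambda>n. \<tau> n i) \<phi>) U"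
      by (rule eventually_subst)
    moreover have "cls (\<tau> m) \<in> univ \<B>" for m using that(2) by (simp add: univ_B)
    ultimately show ?thesis using los[OF that(1), of "\<lambda>n. cls (\<tau> n)"] by simp
  qed
  define h where "h = (\<lambda>a. cls (\<lambda>_. a))"
  have "elem_embedding L \<A> \<B> h"
    unfolding elem_embedding_def
  proof (intro conjI allI impI ballI)
    show "h \<in> ?A \<rightarrow> univ \<B>" using const_H by (auto simp: h_def univ_B)
    fix \<phi> :: "('f, 'r) fm" and e :: "nat \<Rightarrow> 'u" assume \<phi>: "L_fm L \<phi>" and e: "e \<in> UNIV \<rightarrow> ?A"
    have "sat \<B> (\<lambda>n. cls (\<lambda>_. e n)) \<phi> = eventually (\<lambda>i. sat \<A> e \<phi>) U"
      using los_cls[OF \<phi>, of "\<lambda>n _. e n"] const_H e by auto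
    then show "sat \<A> e \<phi> = sat \<B> (h \<circ> e) \<phi>"
      using Ubot by (simp add: h_def comp_def eventually_const)
  qed
  moreover have "sat \<B> ((h \<circ> e)(n := cls b0)) \<phi> = eventually (\<lambda>i. sat \<A> (e(n := b0 i)) \<phi>) U"
    if "L_fm L \<phi>" "\<forall>m. e m \<in> ?A" for \<phi> e n
  proof -
    let ?\<tau> = "(\<lambda>m _. e m)(n := b0)"
    have "(\<lambda>m. cls (?\<tau> m)) = (h \<circ> e)(n := cls b0)" by (auto simp: h_def)
    moreover have "(\<lambda>m. ?\<tau> m i) = e(n := b0 i)" for i by auto
    moreover have "?\<tau> m \<in> H" for m using that(2) b0_H const_H by simp
    ultimately show ?thesis using los_cls[OF that(1), of ?\<tau>] by (simp only:)
  qed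
  moreover have "cls b0 \<in> univ \<B>" using b0_H by (simp add: univ_B)
  ultimately show ?thesis using str_B by blast
qed

section \<open>Realising finitely satisfiable sets of formulas and complete types\<close>

section \<open>Saturation and complete types\<close>

text \<open>Take an ultrafilter containing the solution sets of all formulas in
  \<open>\<Phi>\<close>. The class of the identity function realises \<open>\<Phi>\<close> in the
  ultrapower, and saturation moves it into \<open>\<A>\<close>. A finite universe is treated apart,
  since there n parameters need not be fewer than the cardinality; one failing formula per element
  already gives a finite unsatisfiable subset.\<close>

lemma saturated_realises:
  fixes L :: "('f, 'r) language" and \<A> :: "('u, 'f, 'r) fo_structure"
  assumes str: "is_structure L \<A>" and ctbl: "countable (univ \<A>)" and sat: "saturated L \<A>"
    and c: "\<And>m. c m \<in> univ \<A>"
    and \<Phi>: "\<And>\<phi>. \<phi> \<in> \<Phi> \<Longrightarrow> L_fm L \<phi> \<and> fv \<phi> \<subseteq> {..n}"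
    and fin_sat: "\<And>\<Psi>. finite \<Psi> \<Longrightarrow> \<Psi> \<subseteq> \<Phi> \<Longrightarrow> \<exists>a \<in> univ \<A>. \<forall>\<phi> \<in> \<Psi>. sat \<A> (c(n := a)) \<phi>"
  shows "\<exists>d \<in> univ \<A>. \<forall>\<phi> \<in> \<Phi>. sat \<A> (c(n := d)) \<phi>"
proof (cases "finite (univ \<A>)")
  case True
  show ?thesis
  proof (rule ccontr)
    assume "\<not> ?thesis"
    then have "\<forall>d \<in> univ \<A>. \<exists>\<phi>. \<phi> \<in> \<Phi> \<and> \<not> sat \<A> (c(n := d)) \<phi>" by blast
    then obtain bad where bad: "\<And>d. d \<in> univ \<A> \<Longrightarrow> bad d \<in> \<Phi> \<and> \<not> sat \<A> (c(n := d)) (bad d)"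
      by metis
    have "finite (bad ` univ \<A>)" "bad ` univ \<A> \<subseteq> \<Phi>" using True bad by auto
    from fin_sat[OF this] bad show False by blast
  qed
next
  case False
  define S where "S = insert (univ \<A>) ((\<lambda>\<phi>. {a \<in> univ \<A>. sat \<A> (c(n := a)) \<phi>}) ` \<Phi>)"
  have "\<Inter> X \<noteq> {}" if X: "finite X" "X \<subseteq> S" for X
  proof -
    have "X - {univ \<A>} \<subseteq> (\<lambda>\<phi>. {a \<in> univ \<A>. sat \<A> (c(n := a)) \<phi>}) ` \<Phi>"
      using X(2) by (auto simp: S_def)
    then obtain \<Psi> where \<Psi>: "\<Psi> \<subseteq> \<Phi>" "finite \<Psi>"
      "X - {univ \<A>} = (\<lambda>\<phi>. {a \<in> univ \<A>. sat \<A> (c(n := a)) \<phi>}) ` \<Psi>"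
      using X(1) by (meson finite_Diff finite_subset_image)
    obtain a where a: "a \<in> univ \<A>" "\<forall>\<phi> \<in> \<Psi>. sat \<A> (c(n := a)) \<phi>" using fin_sat[OF \<Psi>(2,1)] by blast
    have "a \<in> s" if "s \<in> X" for s
    proof (cases "s = univ \<A>")
      case False
      then have "s \<in> X - {univ \<A>}" using that by simp
      then show ?thesis unfolding \<Psi>(3) using a by blast
    qed (simp add: a)
    then show ?thesis by blast
  qed
  then obtain U where U: "ultra U" and ev: "\<And>s. s \<in> S \<Longrightarrow> eventually (\<lambda>a. a \<in> s) U"
    using ultra_fip[of S] by blast
  define b0 where "b0 = (\<lambda>a. if a \<in> univ \<A> then a else c 0)"
  have b0: "b0 i \<in> univ \<A>" for i using c by (simp add: b0_def)
  obtain \<B> :: "('u + ('f, 'r) fm, 'f, 'r) fo_structure" and h b where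
    \<B>: "is_structure L \<B>" "elem_embedding L \<A> \<B> h" "b \<in> univ \<B>"
    and los: "\<And>\<phi> e n. L_fm L \<phi> \<Longrightarrow> (\<forall>m. e m \<in> univ \<A>) \<Longrightarrow>
      sat \<B> ((h \<circ> e)(n := b)) \<phi> = eventually (\<lambda>i. sat \<A> (e(n := b0 i)) \<phi>) U"
    using ultrapower_extension[OF str ctbl U, of b0] b0 by blast
  have b_sat: "sat \<B> ((h \<circ> c)(n := b)) \<phi>" if "\<phi> \<in> \<Phi>" for \<phi>
  proof -
    have "eventually (\<lambda>a. a \<in> {a \<in> univ \<A>. sat \<A> (c(n := a)) \<phi>}) U"
      using that by (intro ev) (auto simp: S_def)
    then have "eventually (\<lambda>i. sat \<A> (c(n := b0 i)) \<phi>) U"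
      by (rule eventually_mono) (simp add: b0_def)
    then show ?thesis using los[of \<phi> c n] \<Phi>[OF that] c by simp
  qed
  \<comment> \<open>Parameters serve as their own indices: the field of the cardinal of the universe
    is the universe itself, and the tuple becomes the identity.\<close>
  define I where "I = c ` {..<n}"
  have "finite I" by (simp add: I_def)
  then have "|I| <o |univ \<A>|" using False by (intro finite_ordLess_infinite) (simp_all add: card_of_well_order_on Field_card_of)
  moreover have "I \<subseteq> Field |univ \<A>|" using c by (auto simp: I_def Field_card_of)
  moreover have "(\<lambda>x. x) \<in> I \<rightarrow> univ \<A>" using c by (auto simp: I_def)
  ultimately have "\<exists>d \<in> univ \<A>. elem_equiv (lang_consts L (insert None (Some ` I)))
      (expand \<B> (case_option b (h \<circ> (\<lambda>x. x)))) (expand \<A> (case_option d (\<lambda>x. x)))"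
    using sat \<B> unfolding saturated_def card_saturated_def by blast
  then obtain d where d: "d \<in> univ \<A>" and equiv: "elem_equiv (lang_consts L (insert None (Some ` I)))
      (expand \<B> (case_option b (h \<circ> (\<lambda>x. x)))) (expand \<A> (case_option d (\<lambda>x. x)))" by blast
  \<comment> \<open>Variables below n become the constants naming the parameters, and variable n the
    constant \<open>None\<close> of the new element; no other variable is free in
    \<open>\<Phi>\<close>.\<close>
  define \<sigma> where "\<sigma> = (\<lambda>m. if m < n then Some (Some (c m)) else if m = n then Some None else None)"
  have "sat \<A> (c(n := d)) \<phi>" if \<phi>: "\<phi> \<in> \<Phi>" for \<phi>
  proof -
    have L: "L_sentence (lang_consts L (insert None (Some ` I))) (sub \<sigma> \<phi>)"
      unfolding L_sentence_def
    proof
      show "L_fm (lang_consts L (insert None (Some ` I))) (sub \<sigma> \<phi>)"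
        using \<Phi>[OF \<phi>] by (intro L_sub) (auto simp: \<sigma>_def I_def split: if_splits)
      have "fv (sub \<sigma> \<phi>) \<subseteq> {..n} \<inter> {x. \<sigma> x = None}" using \<Phi>[OF \<phi>] by (auto simp: fv_sub)
      also have "\<dots> = {}" by (auto simp: \<sigma>_def)
      finally show "fv (sub \<sigma> \<phi>) = {}" by simp
    qed
    have "models (expand \<B> (case_option b (h \<circ> (\<lambda>x. x)))) (sub \<sigma> \<phi>)"
      unfolding models_def sat_sub
    proof
      fix e
      show "sat \<B> (\<lambda>x. case \<sigma> x of None \<Rightarrow> e x | Some c \<Rightarrow> case_option b (h \<circ> (\<lambda>x. x)) c) \<phi>"
        using b_sat[OF \<phi>] \<Phi>[OF \<phi>] by (subst sat_cong[where e' = "(h \<circ> c)(n := b)"]) (auto simp: \<sigma>_def)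
    qed
    then have "models (expand \<A> (case_option d (\<lambda>x. x))) (sub \<sigma> \<phi>)"
      using equiv L unfolding elem_equiv_def by blast
    then have "sat (expand \<A> (case_option d (\<lambda>x. x))) (\<lambda>_. d) (sub \<sigma> \<phi>)"
      using d by (auto simp: models_def expand_def)
    then have "sat \<A> (\<lambda>x. case \<sigma> x of None \<Rightarrow> d | Some c \<Rightarrow> case_option d (\<lambda>x. x) c) \<phi>"
      by (simp only: sat_sub)
    then show ?thesis
      using \<Phi>[OF \<phi>] by (subst sat_cong[where e' = "\<lambda>x. case \<sigma> x of None \<Rightarrow> d | Some c \<Rightarrow> case_option d (\<lambda>x. x) c"])
        (auto simp: \<sigma>_def)
  qed
  with d show ?thesis by blast
qed

text \<open>
  A predicate \<open>p\<close> as below is a complete type in all variables, evaluated in some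
  elementary extension.
\<close>

definition complete_type :: "(('f, 'r) fm \<Rightarrow> bool) \<Rightarrow> bool" where
  "complete_type p \<longleftrightarrow> (\<forall>\<phi>. p (Neg \<phi>) \<longleftrightarrow> \<not> p \<phi>) \<and> (\<forall>\<phi> \<psi>. p (Conj \<phi> \<psi>) \<longleftrightarrow> p \<phi> \<and> p \<psi>) \<and>
    (\<forall>\<phi> n. p \<phi> \<longrightarrow> p (Ex n \<phi>)) \<and> p (Eq (Var 0) (Var 0))"

text \<open>Assignments are total, so \<open>c\<close> has values from n on as well; they are
  placeholders until an extension step overwrites them.\<close>

definition type_upto ::
  "('f, 'r) language \<Rightarrow> ('u, 'f, 'r) fo_structure \<Rightarrow> (('f, 'r) fm \<Rightarrow> bool) \<Rightarrow> nat \<Rightarrow> (nat \<Rightarrow> 'u) \<Rightarrow> bool"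
  where
  "type_upto L \<A> p n c \<longleftrightarrow> (\<forall>m. c m \<in> univ \<A>) \<and>
    (\<forall>\<phi>. L_fm L \<phi> \<longrightarrow> fv \<phi> \<subseteq> {..<n} \<longrightarrow> p \<phi> = sat \<A> c \<phi>)"

text \<open>Finitely many formulas in \<open>p\<close> have their conjunction in \<open>p\<close>,
  hence also its quantification over variable n. That formula mentions only variables below n, so it
  is true of \<open>c\<close>. Realising all of \<open>\<Phi>\<close> gives full agreement, because
  \<open>p\<close> contains a formula or its negation.\<close>

lemma type_forth:
  fixes L :: "('f, 'r) language" and \<A> :: "('u, 'f, 'r) fo_structure"
  assumes str: "is_structure L \<A>" and ctbl: "countable (univ \<A>)" and sat: "saturated L \<A>"
    and p: "complete_type p" and c: "type_upto L \<A> p n c"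
  shows "\<exists>d \<in> univ \<A>. type_upto L \<A> p (Suc n) (c(n := d))"
proof -
  define \<Phi> where "\<Phi> = {\<phi>. L_fm L \<phi> \<and> fv \<phi> \<subseteq> {..n} \<and> p \<phi>}"
  have p_neg: "p (Neg \<phi>) \<longleftrightarrow> \<not> p \<phi>" and p_conj: "p (Conj \<phi> \<psi>) \<longleftrightarrow> p \<phi> \<and> p \<psi>"
    and p_ex: "p \<phi> \<Longrightarrow> p (Ex m \<phi>)" and p_eq: "p (Eq (Var 0) (Var 0))" for \<phi> \<psi> m
    using p unfolding complete_type_def by auto
  have cA: "c m \<in> univ \<A>" for m using c by (simp add: type_upto_def)
  have "\<exists>d \<in> univ \<A>. \<forall>\<phi> \<in> \<Phi>. sat \<A> (c(n := d)) \<phi>"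
  proof (rule saturated_realises[OF str ctbl sat cA])
    show "L_fm L \<phi> \<and> fv \<phi> \<subseteq> {..n}" if "\<phi> \<in> \<Phi>" for \<phi> using that by (simp add: \<Phi>_def)
    fix \<Psi> assume "finite \<Psi>" and sub: "\<Psi> \<subseteq> \<Phi>"
    then obtain \<phi>s where \<phi>s: "set \<phi>s = \<Psi>" using finite_list by blast
    have "p (conj_list \<phi>s)" if "set \<phi>s \<subseteq> \<Phi>" for \<phi>s
      using that by (induction \<phi>s) (auto simp: p_conj p_eq \<Phi>_def)
    then have "p (Ex n (conj_list \<phi>s))" using sub \<phi>s by (intro p_ex) auto
    moreover have "L_fm L (Ex n (conj_list \<phi>s))" using sub \<phi>s by (auto simp: L_conj_list \<Phi>_def)
    moreover have "fv (conj_list \<phi>s) \<subseteq> {..n}" using sub \<phi>s by (auto simp: fv_conj_list \<Phi>_def)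
    then have "fv (Ex n (conj_list \<phi>s)) \<subseteq> {..<n}" by (auto simp: nat_less_le)
    ultimately have "sat \<A> c (Ex n (conj_list \<phi>s))" using c by (simp only: type_upto_def)
    then show "\<exists>a \<in> univ \<A>. \<forall>\<phi> \<in> \<Psi>. sat \<A> (c(n := a)) \<phi>" using \<phi>s by (simp add: sat_conj_list)
  qed
  then obtain d where d: "d \<in> univ \<A>" "\<And>\<phi>. \<phi> \<in> \<Phi> \<Longrightarrow> sat \<A> (c(n := d)) \<phi>" by blast
  have "p \<phi> = sat \<A> (c(n := d)) \<phi>" if "L_fm L \<phi>" "fv \<phi> \<subseteq> {..n}" for \<phi>
  proof (cases "p \<phi>")
    case True
    then show ?thesis using d(2)[of \<phi>] that by (auto simp: \<Phi>_def)
  next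
    case False
    then have "Neg \<phi> \<in> \<Phi>" using that by (auto simp: \<Phi>_def p_neg)
    from d(2)[OF this] False show ?thesis by simp
  qed
  then have "type_upto L \<A> p (Suc n) (c(n := d))" using cA d(1) by (simp add: type_upto_def lessThan_Suc_atMost)
  with d(1) show ?thesis by blast
qed

text \<open>The hypothesis on \<open>c0\<close> says that \<open>p\<close> and \<open>\<A>\<close>
  agree on sentences. Stage n changes coordinate n only, so coordinates stabilise, and each formula
  looks at finitely many of them.\<close>

lemma realise_complete_type:
  fixes L :: "('f, 'r) language" and \<A> :: "('u, 'f, 'r) fo_structure"
  assumes str: "is_structure L \<A>" and ctbl: "countable (univ \<A>)" and sat: "saturated L \<A>"
    and p: "complete_type p" and c0: "type_upto L \<A> p 0 c0"
  shows "\<exists>c. (\<forall>m. c m \<in> univ \<A>) \<and> (\<forall>\<phi>. L_fm L \<phi> \<longrightarrow> p \<phi> = sat \<A> c \<phi>)"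
proof -
  have "\<exists>f. \<forall>n. type_upto L \<A> p n (f n) \<and> (\<exists>d. f (Suc n) = (f n)(n := d))"
  proof (rule dependent_nat_choice)
    show "\<exists>c. type_upto L \<A> p 0 c" using c0 by blast
    show "\<exists>c'. type_upto L \<A> p (Suc n) c' \<and> (\<exists>d. c' = c(n := d))" if "type_upto L \<A> p n c" for c n
      using type_forth[OF str ctbl sat p that] by blast
  qed
  then obtain f where f: "\<And>n. type_upto L \<A> p n (f n)" and step: "\<And>n. \<exists>d. f (Suc n) = (f n)(n := d)"
    by blast
  define c where "c m = f (Suc m) m" for m
  have stable: "f (Suc m + k) m = c m" for m k
  proof (induction k)
    case (Suc k)
    obtain d where "f (Suc (Suc m + k)) = (f (Suc m + k))(Suc m + k := d)" using step by blast
    then have "f (Suc (Suc m + k)) m = f (Suc m + k) m" by simp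
    with Suc show ?case by simp
  qed (simp add: c_def)
  have fc: "f n m = c m" if "m < n" for m n
    using stable[of m "n - Suc m"] that by simp
  have "c m \<in> univ \<A>" for m using f[of "Suc m"] by (simp add: type_upto_def c_def)
  moreover have "p \<phi> = sat \<A> c \<phi>" if \<phi>: "L_fm L \<phi>" for \<phi>
  proof -
    obtain N where N: "\<forall>n \<in> fv \<phi>. n < N" using bounded_vars by blast
    then have "p \<phi> = sat \<A> (f N) \<phi>" using f[of N] \<phi> by (auto simp: type_upto_def)
    also have "\<dots> = sat \<A> c \<phi>" using N fc by (intro sat_cong) auto
    finally show ?thesis .
  qed
  ultimately show ?thesis by blast
qed

lemma complete_type_sat:
  assumes "\<And>m. e m \<in> univ \<A>"
  shows "complete_type (sat \<A> e)"
  unfolding complete_type_def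
proof (intro conjI allI impI)
  fix \<phi> n assume "sat \<A> e \<phi>"
  then have "sat \<A> (e(n := e n)) \<phi>" by simp
  then show "sat \<A> e (Ex n \<phi>)" unfolding sat.simps using assms[of n] by (rule bexI)
qed simp_all

lemma complete_type_ultra:
  assumes U: "ultra U" and t: "\<And>n. eventually (\<lambda>r. t n r \<in> univ \<A>) U"
  shows "complete_type (\<lambda>\<phi>. eventually (\<lambda>r. sat \<A> (\<lambda>n. t n r) \<phi>) U)"
  unfolding complete_type_def
proof (intro conjI allI impI)
  fix \<phi> n assume "eventually (\<lambda>r. sat \<A> (\<lambda>n. t n r) \<phi>) U"
  with t[of n] show "eventually (\<lambda>r. sat \<A> (\<lambda>n. t n r) (Ex n \<phi>)) U"
  proof eventually_elim
    case (elim r)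
    have "(\<lambda>n. t n r)(n := t n r) = (\<lambda>n. t n r)" by (rule ext) simp
    with elim(2) have "sat \<A> ((\<lambda>n. t n r)(n := t n r)) \<phi>" by (simp only:)
    then show ?case unfolding sat.simps using elim(1) by (rule bexI)
  qed
qed (simp_all add: ultra_not[OF U] eventually_conj_iff)

section \<open>Elementary self-embeddings as a closed monoid whose bijections are the
  automorphisms\<close>

section \<open>Elementary self-embeddings\<close>

lemma EEmbD:
  assumes "h \<in> EEmb L \<A>"
  shows "h \<in> univ \<A> \<rightarrow>\<^sub>E univ \<A>" "x \<in> univ \<A> \<Longrightarrow> h x \<in> univ \<A>"
    "L_fm L \<phi> \<Longrightarrow> (\<And>m. e m \<in> univ \<A>) \<Longrightarrow> sat \<A> (\<lambda>m. h (e m)) \<phi> = sat \<A> e \<phi>"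
  using assms unfolding EEmb_def elem_embedding_def by (auto simp: comp_def Pi_iff)

lemma EEmbI:
  assumes "h \<in> univ \<A> \<rightarrow>\<^sub>E univ \<A>"
    "\<And>\<phi> e. L_fm L \<phi> \<Longrightarrow> (\<And>m. e m \<in> univ \<A>) \<Longrightarrow> sat \<A> (\<lambda>m. h (e m)) \<phi> = sat \<A> e \<phi>"
  shows "h \<in> EEmb L \<A>"
  using assms unfolding EEmb_def elem_embedding_def by (auto simp: comp_def Pi_iff PiE_iff)

lemma EEmb_inj:
  assumes h: "h \<in> EEmb L \<A>"
  shows "inj_on h (univ \<A>)"
proof (rule inj_onI)
  fix x y assume xy: "x \<in> univ \<A>" "y \<in> univ \<A>" "h x = h y"
  let ?e = "\<lambda>m::nat. if m = 0 then x else y"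
  have "sat \<A> (\<lambda>m. h (?e m)) (Eq (Var 0) (Var 1)) = sat \<A> ?e (Eq (Var 0) (Var 1))"
    by (rule EEmbD(3)[OF h]) (auto simp: xy)
  with xy(3) show "x = y" by simp
qed

lemma EEmb_compose:
  fixes L :: "('f, 'r) language" and \<A> :: "('u, 'f, 'r) fo_structure"
  assumes f: "f \<in> EEmb L \<A>" and g: "g \<in> EEmb L \<A>"
  shows "compose (univ \<A>) f g \<in> EEmb L \<A>"
proof (rule EEmbI)
  show "compose (univ \<A>) f g \<in> univ \<A> \<rightarrow>\<^sub>E univ \<A>"
    using EEmbD(2)[OF f] EEmbD(2)[OF g] by (auto simp: compose_def)
  fix \<phi> :: "('f, 'r) fm" and e :: "nat \<Rightarrow> 'u" assume \<phi>: "L_fm L \<phi>" and e: "\<And>m. e m \<in> univ \<A>"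
  have "sat \<A> (\<lambda>m. f (g (e m))) \<phi> = sat \<A> (\<lambda>m. g (e m)) \<phi>"
    using e by (intro EEmbD(3)[OF f \<phi>] EEmbD(2)[OF g])
  also have "\<dots> = sat \<A> e \<phi>" using e by (intro EEmbD(3)[OF g \<phi>])
  finally have "sat \<A> (\<lambda>m. f (g (e m))) \<phi> = sat \<A> e \<phi>" .
  then show "sat \<A> (\<lambda>m. compose (univ \<A>) f g (e m)) \<phi> = sat \<A> e \<phi>" using e by (simp add: compose_def)
qed

text \<open>A formula has finitely many free variables, so elementarity is tested on finitely many
  points at a time.\<close>

lemma EEmb_closed:
  fixes L :: "('f, 'r) language" and \<A> :: "('u, 'f, 'r) fo_structure"
  assumes h: "h \<in> univ \<A> \<rightarrow>\<^sub>E univ \<A>"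
    and approx: "\<And>F. finite F \<Longrightarrow> F \<subseteq> univ \<A> \<Longrightarrow> \<exists>m \<in> EEmb L \<A>. \<forall>x \<in> F. m x = h x"
  shows "h \<in> EEmb L \<A>"
proof (rule EEmbI[OF h])
  fix \<phi> :: "('f, 'r) fm" and e :: "nat \<Rightarrow> 'u" assume \<phi>: "L_fm L \<phi>" and e: "\<And>m. e m \<in> univ \<A>"
  have "\<exists>m \<in> EEmb L \<A>. \<forall>x \<in> e ` fv \<phi>. m x = h x"
    using e finite_fv[of \<phi>] by (intro approx) auto
  then obtain m where m: "m \<in> EEmb L \<A>" "\<And>x. x \<in> e ` fv \<phi> \<Longrightarrow> m x = h x" by blast
  have "sat \<A> (\<lambda>n. h (e n)) \<phi> = sat \<A> (\<lambda>n. m (e n)) \<phi>" using m(2) by (intro sat_cong) auto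
  also have "\<dots> = sat \<A> e \<phi>" by (rule EEmbD(3)[OF m(1) \<phi> e])
  finally show "sat \<A> (\<lambda>m. h (e m)) \<phi> = sat \<A> e \<phi>" .
qed

lemma Aut_subset_EEmb:
  assumes str: "is_structure L \<A>"
  shows "Aut L \<A> \<subseteq> EEmb L \<A>"
proof
  fix h assume h: "h \<in> Aut L \<A>"
  then have bij: "bij_betw h (univ \<A>) (univ \<A>)" and hE: "h \<in> univ \<A> \<rightarrow>\<^sub>E univ \<A>"
    by (auto simp: Aut_def Bij_def PiE_def dest: bij_betw_apply)
  have fn: "h (fint \<A> f xs) = fint \<A> f (map h xs)" if "(f, length xs) \<in> funs L" "set xs \<subseteq> univ \<A>" for f xs
  proof -
    have "xs \<in> lists (univ \<A>)" using that by auto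
    then show ?thesis using h that(1) unfolding Aut_def by blast
  qed
  have rl: "rint \<A> r xs = rint \<A> r (map h xs)" if "(r, length xs) \<in> rels L" "set xs \<subseteq> univ \<A>" for r xs
  proof -
    have "xs \<in> lists (univ \<A>)" using that by auto
    then show ?thesis using h that(1) unfolding Aut_def by blast
  qed
  have val: "val \<A> (\<lambda>m. h (e m)) t = h (val \<A> e t)" if "L_trm L t" "\<And>m. e m \<in> univ \<A>" for e t
    using that(1)
  proof (induction t)
    case (Fn f ts)
    have "map (val \<A> (\<lambda>m. h (e m))) ts = map h (map (val \<A> e) ts)"
      using Fn by (auto simp: list_all_iff)
    moreover have "set (map (val \<A> e) ts) \<subseteq> univ \<A>"
      using Fn.prems that(2) by (auto simp: list_all_iff intro!: val_in_univ[OF str])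
    ultimately show ?case using fn[of f "map (val \<A> e) ts"] Fn.prems by (simp del: map_map map_eq_conv)
  qed simp
  have "sat \<A> (\<lambda>m. h (e m)) \<phi> = sat \<A> e \<phi>" if "L_fm L \<phi>" "\<And>m. e m \<in> univ \<A>" for e \<phi>
    using that
  proof (induction \<phi> arbitrary: e)
    case (Eq s t)
    have "val \<A> e s \<in> univ \<A>" "val \<A> e t \<in> univ \<A>" using Eq by (auto intro: val_in_univ[OF str])
    then have "h (val \<A> e s) = h (val \<A> e t) \<longleftrightarrow> val \<A> e s = val \<A> e t"
      using bij by (auto simp: bij_betw_def inj_on_def)
    then show ?case using val Eq by simp
  next
    case (Rel r ts)
    have "map (val \<A> (\<lambda>m. h (e m))) ts = map h (map (val \<A> e) ts)"
      using Rel val by (auto simp: list_all_iff)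
    moreover have "set (map (val \<A> e) ts) \<subseteq> univ \<A>"
      using Rel by (auto simp: list_all_iff intro!: val_in_univ[OF str])
    ultimately show ?case using rl[of r "map (val \<A> e) ts"] Rel.prems by (simp del: map_map map_eq_conv)
  next
    case (Neg \<phi>)
    have "sat \<A> (\<lambda>m. h (e m)) \<phi> = sat \<A> e \<phi>" using Neg.prems by (intro Neg.IH) auto
    then show ?case by simp
  next
    case (Conj \<phi> \<psi>)
    have "sat \<A> (\<lambda>m. h (e m)) \<phi> = sat \<A> e \<phi>" using Conj.prems by (intro Conj.IH(1)) auto
    moreover have "sat \<A> (\<lambda>m. h (e m)) \<psi> = sat \<A> e \<psi>" using Conj.prems by (intro Conj.IH(2)) auto
    ultimately show ?case by simp
  next
    case (Ex x \<phi>)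
    have IH: "sat \<A> ((\<lambda>m. h (e m))(x := h a)) \<phi> = sat \<A> (e(x := a)) \<phi>" if "a \<in> univ \<A>" for a
    proof -
      have "sat \<A> (\<lambda>m. h ((e(x := a)) m)) \<phi> = sat \<A> (e(x := a)) \<phi>"
        using Ex.prems that by (intro Ex.IH) auto
      moreover have "(\<lambda>m. h ((e(x := a)) m)) = (\<lambda>m. h (e m))(x := h a)" by (rule ext) simp
      ultimately show ?thesis by (simp only:)
    qed
    have "h ` univ \<A> = univ \<A>" using bij by (simp add: bij_betw_def)
    then have "(\<exists>b \<in> univ \<A>. sat \<A> ((\<lambda>m. h (e m))(x := b)) \<phi>)
        \<longleftrightarrow> (\<exists>a \<in> univ \<A>. sat \<A> ((\<lambda>m. h (e m))(x := h a)) \<phi>)"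
      by (metis (no_types, lifting) imageE imageI)
    also have "\<dots> \<longleftrightarrow> (\<exists>a \<in> univ \<A>. sat \<A> (e(x := a)) \<phi>)" using IH by blast
    finally show ?case by (simp only: sat.simps)
  qed
  with hE show "h \<in> EEmb L \<A>" by (intro EEmbI) auto
qed

text \<open>Graphs of function symbols and relations are defined by atomic formulas in distinct
  variables, and an elementary map respects these. The element \<open>a0\<close> fills the variables
  beyond them.\<close>

lemma EEmb_bij_Aut:
  fixes L :: "('f, 'r) language" and \<A> :: "('u, 'f, 'r) fo_structure"
  assumes str: "is_structure L \<A>" and h: "h \<in> EEmb L \<A>" and bij: "bij_betw h (univ \<A>) (univ \<A>)"
  shows "h \<in> Aut L \<A>"
proof -
  obtain a0 where a0: "a0 \<in> univ \<A>" using str by (auto simp: is_structure_def)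
  have "h \<in> Bij (univ \<A>)" using EEmbD(1)[OF h] bij by (auto simp: Bij_def PiE_def)
  moreover have "h (fint \<A> f xs) = fint \<A> f (map h xs)"
    if f: "(f, n) \<in> funs L" and xs: "xs \<in> lists (univ \<A>)" and n: "length xs = n" for f n xs
  proof -
    let ?\<phi> = "Eq (Var n) (Fn f (map Var [0..<n])) :: ('f, 'r) fm"
    let ?e = "\<lambda>m. if m < n then xs ! m else if m = n then fint \<A> f xs else a0"
    have in_A: "fint \<A> f xs \<in> univ \<A>" using is_structureD[OF str f xs n] .
    have "L_fm L ?\<phi>" using f by (simp add: list_all_iff)
    moreover have "?e m \<in> univ \<A>" for m using xs n in_A a0 by (auto simp: in_listsD)
    ultimately have "sat \<A> (\<lambda>m. h (?e m)) ?\<phi> = sat \<A> ?e ?\<phi>" by (rule EEmbD(3)[OF h])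
    moreover have "map (val \<A> ?e) (map Var [0..<n]) = xs" using n by (intro nth_equalityI) auto
    moreover have "map (val \<A> (\<lambda>m. h (?e m))) (map Var [0..<n]) = map h xs"
      using n by (intro nth_equalityI) auto
    ultimately show ?thesis by (simp del: map_map)
  qed
  moreover have "rint \<A> r xs = rint \<A> r (map h xs)"
    if r: "(r, n) \<in> rels L" and xs: "xs \<in> lists (univ \<A>)" and n: "length xs = n" for r n xs
  proof -
    let ?\<phi> = "Rel r (map Var [0..<n]) :: ('f, 'r) fm"
    let ?e = "\<lambda>m. if m < n then xs ! m else a0"
    have "L_fm L ?\<phi>" using r by (simp add: list_all_iff)
    moreover have "?e m \<in> univ \<A>" for m using xs n a0 by (auto simp: in_listsD)
    ultimately have "sat \<A> (\<lambda>m. h (?e m)) ?\<phi> = sat \<A> ?e ?\<phi>" by (rule EEmbD(3)[OF h])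
    moreover have "map (val \<A> ?e) (map Var [0..<n]) = xs" using n by (intro nth_equalityI) auto
    moreover have "map (val \<A> (\<lambda>m. h (?e m))) (map Var [0..<n]) = map h xs"
      using n by (intro nth_equalityI) auto
    ultimately show ?thesis by (simp del: map_map)
  qed
  ultimately show ?thesis unfolding Aut_def by blast
qed

section \<open>Back and forth, density of the automorphisms, and strong amalgams\<close>

section \<open>Homogeneity and amalgamation\<close>

text \<open>Equality of the types of two initial segments. It goes through \<open>type_upto\<close>
  on pairs, so that one forth step and a swap yield both directions.\<close>

definition agree_upto ::
  "('f, 'r) language \<Rightarrow> ('u, 'f, 'r) fo_structure \<Rightarrow> nat \<Rightarrow> (nat \<Rightarrow> 'u) \<times> (nat \<Rightarrow> 'u) \<Rightarrow> bool"
  where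
  "agree_upto L \<A> n s \<longleftrightarrow> (\<forall>m. fst s m \<in> univ \<A>) \<and> type_upto L \<A> (sat \<A> (fst s)) n (snd s)"

lemma agree_upto_swap: "agree_upto L \<A> n (e, c) \<Longrightarrow> agree_upto L \<A> n (c, e)"
  unfolding agree_upto_def type_upto_def by simp

lemma agree_upto_forth:
  fixes L :: "('f, 'r) language" and \<A> :: "('u, 'f, 'r) fo_structure"
  assumes str: "is_structure L \<A>" and ctbl: "countable (univ \<A>)" and sat: "saturated L \<A>"
    and ag: "agree_upto L \<A> n (e, c)" and a: "a \<in> univ \<A>"
  shows "\<exists>d. agree_upto L \<A> (Suc n) (e(n := a), c(n := d))"
proof -
  have e: "(e(n := a)) m \<in> univ \<A>" for m using ag a by (simp add: agree_upto_def)
  have "sat \<A> (e(n := a)) \<phi> = sat \<A> e \<phi>" if "fv \<phi> \<subseteq> {..<n}" for \<phi> :: "('f, 'r) fm"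
    using that by (intro sat_cong) auto
  then have "type_upto L \<A> (sat \<A> (e(n := a))) n c" using ag
    by (simp add: agree_upto_def type_upto_def)
  from type_forth[OF str ctbl sat complete_type_sat[OF e] this] obtain d
    where "type_upto L \<A> (sat \<A> (e(n := a))) (Suc n) (c(n := d))" by blast
  then have "agree_upto L \<A> (Suc n) (e(n := a), c(n := d))" using e by (simp add: agree_upto_def)
  then show ?thesis by blast
qed

text \<open>Back and forth along an enumeration \<open>a\<close>: stage k puts \<open>a k\<close>
  into the first tuple at position \<open>N k\<close> and into the second at the next position. The
  limits \<open>E\<close> and \<open>C\<close> both exhaust the universe and have the same type, so
  sending \<open>E m\<close> to \<open>C m\<close> is an automorphism.\<close>

lemma homogeneous:
  fixes L :: "('f, 'r) language" and \<A> :: "('u, 'f, 'r) fo_structure"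
  assumes str: "is_structure L \<A>" and ctbl: "countable (univ \<A>)" and sat: "saturated L \<A>"
    and ag: "agree_upto L \<A> n (e, c)"
  shows "\<exists>g \<in> Aut L \<A>. \<forall>m < n. g (e m) = c m"
proof -
  let ?A = "univ \<A>"
  have ne: "?A \<noteq> {}" using str by (simp add: is_structure_def)
  define a where "a = from_nat_into ?A"
  have aA: "a k \<in> ?A" for k unfolding a_def using ne by (rule from_nat_into)
  define N where "N k = n + 2 * k" for k
  \<comment> \<open>The clause for k = 0 retains the starting pair, which dependent choice by itself
    would not prescribe.\<close>
  define P where "P k s \<longleftrightarrow> agree_upto L \<A> (N k) s \<and> (k = 0 \<longrightarrow> s = (e, c))" for k s
  define Q where "Q k s t \<longleftrightarrow> (\<forall>m < N k. fst t m = fst s m \<and> snd t m = snd s m) \<and>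
    fst t (N k) = a k \<and> snd t (Suc (N k)) = a k" for k and s t :: "(nat \<Rightarrow> 'u) \<times> (nat \<Rightarrow> 'u)"
  have "\<exists>f. \<forall>k. P k (f k) \<and> Q k (f k) (f (Suc k))"
  proof (rule dependent_nat_choice)
    show "\<exists>s. P 0 s" using ag by (auto simp: P_def N_def)
    fix s k assume "P k s"
    then obtain e1 c1 where s: "s = (e1, c1)" "agree_upto L \<A> (N k) (e1, c1)"
      by (cases s) (auto simp: P_def)
    obtain d where "agree_upto L \<A> (Suc (N k)) (e1(N k := a k), c1(N k := d))"
      using agree_upto_forth[OF str ctbl sat s(2) aA] by blast
    from agree_upto_forth[OF str ctbl sat agree_upto_swap[OF this] aA[of k]] obtain d' where
      "agree_upto L \<A> (Suc (Suc (N k))) (c1(N k := d, Suc (N k) := a k), e1(N k := a k, Suc (N k) := d'))"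
      by blast
    from agree_upto_swap[OF this]
    have "agree_upto L \<A> (N (Suc k)) (e1(N k := a k, Suc (N k) := d'), c1(N k := d, Suc (N k) := a k))"
      by (simp add: N_def)
    then show "\<exists>t. P (Suc k) t \<and> Q k s t"
      by (intro exI[of _ "(e1(N k := a k, Suc (N k) := d'), c1(N k := d, Suc (N k) := a k))"])
        (simp add: s(1) P_def Q_def)
  qed
  then obtain f where PQ: "\<And>k. P k (f k)" "\<And>k. Q k (f k) (f (Suc k))" by blast
  have f: "agree_upto L \<A> (N k) (f k)" for k using PQ(1)[of k] by (simp add: P_def)
  have f0: "f 0 = (e, c)" using PQ(1)[of 0] by (simp add: P_def)
  have stable1: "m < N k \<Longrightarrow> fst (f (Suc k)) m = fst (f k) m \<and> snd (f (Suc k)) m = snd (f k) m"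
    and hit1: "fst (f (Suc k)) (N k) = a k" and hit2: "snd (f (Suc k)) (Suc (N k)) = a k" for k m
    using PQ(2)[of k] by (auto simp: Q_def)
  have mono: "m < N k \<Longrightarrow> m < N (k + j)" for m k j by (simp add: N_def)
  have stable: "m < N k \<Longrightarrow> fst (f (k + j)) m = fst (f k) m \<and> snd (f (k + j)) m = snd (f k) m" for m k j
    by (induction j) (use stable1 mono in auto)
  define E where "E m = fst (f (Suc m)) m" for m
  define C where "C m = snd (f (Suc m)) m" for m
  have fE: "fst (f k) m = E m" and fC: "snd (f k) m = C m" if "m < N k" for k m
  proof -
    have "m < N (Suc m)" by (simp add: N_def)
    from stable[OF this, of k] stable[OF that, of "Suc m"] show "fst (f k) m = E m" "snd (f k) m = C m"
      by (simp_all add: E_def C_def add.commute)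
  qed
  have EA: "E m \<in> ?A" and CA: "C m \<in> ?A" for m
    using f[of "Suc m"] by (auto simp: E_def C_def agree_upto_def type_upto_def)
  have EC: "sat \<A> E \<phi> = sat \<A> C \<phi>" if \<phi>: "L_fm L \<phi>" for \<phi>
  proof -
    obtain M where M: "\<forall>m \<in> fv \<phi>. m < M" using bounded_vars by blast
    then have lt: "m < N M" if "m \<in> fv \<phi>" for m using that by (fastforce simp: N_def)
    have "sat \<A> E \<phi> = sat \<A> (fst (f M)) \<phi>" using fE lt by (intro sat_cong) auto
    also have "\<dots> = sat \<A> (snd (f M)) \<phi>" using f[of M] \<phi> lt by (auto simp: agree_upto_def type_upto_def)
    also have "\<dots> = sat \<A> C \<phi>" using fC lt by (intro sat_cong) auto
    finally show ?thesis .
  qed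
  have ek: "E (N k) = a k" and ck: "C (Suc (N k)) = a k" for k
    using fE[of "N k" "Suc k"] fC[of "Suc (N k)" "Suc k"] hit1[of k] hit2[of k] by (auto simp: N_def)
  have surjE: "\<exists>m. E m = x" and surjC: "\<exists>m. C m = x" if x: "x \<in> ?A" for x
  proof -
    obtain k where "a k = x" using from_nat_into_surj[OF ctbl x] by (auto simp: a_def)
    then show "\<exists>m. E m = x" "\<exists>m. C m = x" using ek[of k] ck[of k] by blast+
  qed
  define idx where "idx x = (SOME m. E m = x)" for x
  have idx: "E (idx x) = x" if "x \<in> ?A" for x
    unfolding idx_def using surjE[OF that] by (rule someI_ex)
  have E_C: "E m = E m' \<longleftrightarrow> C m = C m'" for m m'
    using EC[of "Eq (Var m) (Var m')"] by simp
  define g where "g = (\<lambda>x \<in> ?A. C (idx x))"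
  have gE: "g (E m) = C m" for m
    using E_C[of "idx (E m)" m] idx[OF EA] EA by (simp add: g_def)
  have "g \<in> EEmb L \<A>"
  proof (rule EEmbI)
    show "g \<in> ?A \<rightarrow>\<^sub>E ?A" using CA by (auto simp: g_def)
    fix \<phi> :: "('f, 'r) fm" and e :: "nat \<Rightarrow> 'u" assume \<phi>: "L_fm L \<phi>" and e: "\<And>m. e m \<in> ?A"
    \<comment> \<open>Each variable is renamed to an index of its value, which replaces the
      assignment by the enumeration \<open>E\<close>, for which the types are known to
      match.\<close>
    have "sat \<A> (\<lambda>m. g (e m)) \<phi> = sat \<A> C (ren (\<lambda>m. idx (e m)) \<phi>)"
      using e by (simp add: sat_ren g_def)
    also have "\<dots> = sat \<A> E (ren (\<lambda>m. idx (e m)) \<phi>)" using EC L_ren[OF \<phi>] by blast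
    also have "\<dots> = sat \<A> e \<phi>" using e by (simp add: sat_ren idx)
    finally show "sat \<A> (\<lambda>m. g (e m)) \<phi> = sat \<A> e \<phi>" .
  qed
  moreover have "bij_betw g ?A ?A"
  proof (rule bij_betw_imageI)
    show "inj_on g ?A" using EEmb_inj[OF calculation] .
    show "g ` ?A = ?A"
    proof
      show "g ` ?A \<subseteq> ?A" using CA by (auto simp: g_def)
      show "?A \<subseteq> g ` ?A"
      proof
        fix x assume "x \<in> ?A"
        then obtain m where "C m = x" using surjC by blast
        then have "x = g (E m)" using gE by simp
        then show "x \<in> g ` ?A" using EA by (rule image_eqI)
      qed
    qed
  qed
  ultimately have "g \<in> Aut L \<A>" by (rule EEmb_bij_Aut[OF str])
  moreover have "g (e m) = c m" if "m < n" for m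
    using gE[of m] fE[of m 0] fC[of m 0] that by (simp add: f0 N_def)
  ultimately show ?thesis by blast
qed

lemma Aut_dense:
  fixes L :: "('f, 'r) language" and \<A> :: "('u, 'f, 'r) fo_structure"
  assumes str: "is_structure L \<A>" and ctbl: "countable (univ \<A>)" and sat: "saturated L \<A>"
    and h: "h \<in> EEmb L \<A>" and F: "finite F" "F \<subseteq> univ \<A>"
  shows "\<exists>g \<in> Aut L \<A>. \<forall>x \<in> F. g x = h x"
proof -
  obtain xs where xs: "set xs = F" using F finite_list by blast
  obtain a0 where a0: "a0 \<in> univ \<A>" using str by (auto simp: is_structure_def)
  let ?e = "\<lambda>m. if m < length xs then xs ! m else a0"
  have e: "?e m \<in> univ \<A>" for m using xs F a0 by auto
  have "agree_upto L \<A> (length xs) (?e, \<lambda>m. h (?e m))"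
    using e EEmbD(2)[OF h e] EEmbD(3)[OF h _ e] by (simp add: agree_upto_def type_upto_def)
  from homogeneous[OF str ctbl sat this] obtain g where g: "g \<in> Aut L \<A>"
    "\<And>m. m < length xs \<Longrightarrow> g (xs ! m) = h (xs ! m)" by auto
  have "g x = h x" if "x \<in> F" for x using that g(2) xs by (auto simp: in_set_conv_nth)
  with g show ?thesis by blast
qed

text \<open>
  The amalgam is the complete type, averaged over an ultrafilter of automorphisms \<open>r\<close>
  that converge to a left inverse of \<open>g\<close>, of the points \<open>x\<close> together with the points \<open>f (r y)\<close>.
\<close>

lemma strong_amalgamation:
  fixes L :: "('f, 'r) language" and \<A> :: "('u, 'f, 'r) fo_structure"
  assumes str: "is_structure L \<A>" and ctbl: "countable (univ \<A>)" and sat: "saturated L \<A>"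
    and f: "f \<in> EEmb L \<A>" and g: "g \<in> EEmb L \<A>"
  shows "\<exists>u \<in> EEmb L \<A>. \<exists>v \<in> EEmb L \<A>. (\<forall>z \<in> univ \<A>. u (f z) = v (g z)) \<and>
    (\<forall>x \<in> univ \<A>. \<forall>y \<in> univ \<A>. u x = v y \<longrightarrow> (\<exists>z \<in> univ \<A>. x = f z \<and> y = g z))"
proof -
  let ?A = "univ \<A>"
  have ne: "?A \<noteq> {}" using str by (simp add: is_structure_def)
  note Aut_EEmb = subsetD[OF Aut_subset_EEmb[OF str]]
  define S where "S = insert (Aut L \<A>) ((\<lambda>z. {r. r (g z) = z}) ` ?A)"
  have "\<Inter> X \<noteq> {}" if X: "finite X" "X \<subseteq> S" for X
  proof -
    have "X - {Aut L \<A>} \<subseteq> (\<lambda>z. {r. r (g z) = z}) ` ?A" using X(2) by (auto simp: S_def)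
    then obtain Z where Z: "Z \<subseteq> ?A" "finite Z" "X - {Aut L \<A>} = (\<lambda>z. {r. r (g z) = z}) ` Z"
      using X(1) by (meson finite_Diff finite_subset_image)
    obtain xs where xs: "set xs = Z" using Z(2) finite_list by blast
    obtain a0 where a0: "a0 \<in> ?A" using ne by blast
    let ?e = "\<lambda>m. if m < length xs then xs ! m else a0"
    have e: "?e m \<in> ?A" for m using xs Z a0 by auto
    have "agree_upto L \<A> (length xs) (?e, \<lambda>m. g (?e m))"
      using e EEmbD(2)[OF g e] EEmbD(3)[OF g _ e] by (simp add: agree_upto_def type_upto_def)
    \<comment> \<open>With the roles exchanged, homogeneity moves the finitely many points g z back
      to z.\<close>
    from homogeneous[OF str ctbl sat agree_upto_swap[OF this]] obtain r where r: "r \<in> Aut L \<A>"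
      "\<And>m. m < length xs \<Longrightarrow> r (g (xs ! m)) = xs ! m" by auto
    have rg: "r (g z) = z" if "z \<in> Z" for z using that r(2) xs by (auto simp: in_set_conv_nth)
    have "r \<in> s" if "s \<in> X" for s
    proof (cases "s = Aut L \<A>")
      case False
      then have "s \<in> X - {Aut L \<A>}" using that by simp
      then show ?thesis unfolding Z(3) using rg by blast
    qed (simp add: r)
    then show ?thesis by blast
  qed
  then obtain U where U: "ultra U" and evS: "\<And>s. s \<in> S \<Longrightarrow> eventually (\<lambda>r. r \<in> s) U"
    using ultra_fip[of S] by blast
  have Ubot: "U \<noteq> bot" using U by (simp add: ultra_def)
  have evG: "eventually (\<lambda>r. r \<in> Aut L \<A>) U" by (rule evS) (simp add: S_def)
  have evg: "eventually (\<lambda>r. r (g z) = z) U" if "z \<in> ?A" for z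
    using evS[of "{r. r (g z) = z}"] that by (simp add: S_def)
  define a where "a = from_nat_into ?A"
  have aA: "a k \<in> ?A" for k unfolding a_def using ne by (rule from_nat_into)
  define idx where "idx = to_nat_on ?A"
  have idx: "a (idx x) = x" if "x \<in> ?A" for x using ctbl that by (simp add: a_def idx_def)
  define t where "t n r = (if even n then a (n div 2) else f (r (a (n div 2))))" for n and r :: "'u \<Rightarrow> 'u"
  define p where "p \<phi> = eventually (\<lambda>r. sat \<A> (\<lambda>n. t n r) \<phi>) U" for \<phi> :: "('f, 'r) fm"
  have evt: "eventually (\<lambda>r. t n r \<in> ?A) U" for n
    using evG
  proof eventually_elim
    case (elim r)
    from EEmbD(2)[OF f EEmbD(2)[OF Aut_EEmb[OF elim] aA]] show ?case by (simp add: t_def aA)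
  qed
  have "complete_type p" unfolding p_def using U evt by (rule complete_type_ultra)
  \<comment> \<open>At stage 0 only sentences matter, so any assignment can start the
    construction.\<close>
  moreover have "type_upto L \<A> p 0 a"
    unfolding type_upto_def
  proof (intro conjI allI impI)
    fix \<phi> :: "('f, 'r) fm" assume "fv \<phi> \<subseteq> {..<0}"
    then have "sat \<A> (\<lambda>n. t n r) \<phi> = sat \<A> a \<phi>" for r by (intro sat_cong) auto
    then show "p \<phi> = sat \<A> a \<phi>" using Ubot by (simp add: p_def eventually_const)
  qed (rule aA)
  ultimately obtain c where cA: "\<And>m. c m \<in> ?A" and c: "\<And>\<phi>. L_fm L \<phi> \<Longrightarrow> p \<phi> = sat \<A> c \<phi>"
    using realise_complete_type[OF str ctbl sat] by blast
  have c_eq: "c m = c n \<longleftrightarrow> eventually (\<lambda>r. t m r = t n r) U" for m n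
    using c[of "Eq (Var m) (Var n)"] by (simp add: p_def)
  define u where "u = (\<lambda>x \<in> ?A. c (2 * idx x))"
  define v where "v = (\<lambda>x \<in> ?A. c (Suc (2 * idx x)))"
  have t_u: "t (2 * idx x) r = x" and t_v: "t (Suc (2 * idx x)) r = f (r x)" if "x \<in> ?A" for x r
    using that by (auto simp: t_def idx)
  have "u \<in> EEmb L \<A>"
  proof (rule EEmbI)
    show "u \<in> ?A \<rightarrow>\<^sub>E ?A" using cA by (auto simp: u_def)
    fix \<phi> :: "('f, 'r) fm" and e :: "nat \<Rightarrow> 'u" assume \<phi>: "L_fm L \<phi>" and e: "\<And>m. e m \<in> ?A"
    have "sat \<A> (\<lambda>m. u (e m)) \<phi> = sat \<A> c (ren (\<lambda>m. 2 * idx (e m)) \<phi>)"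
      using e by (simp add: sat_ren u_def)
    also have "\<dots> = p (ren (\<lambda>m. 2 * idx (e m)) \<phi>)" using c L_ren[OF \<phi>] by blast
    also have "\<dots> = sat \<A> e \<phi>" using e Ubot by (simp add: p_def sat_ren t_u eventually_const)
    finally show "sat \<A> (\<lambda>m. u (e m)) \<phi> = sat \<A> e \<phi>" .
  qed
  moreover have "v \<in> EEmb L \<A>"
  proof (rule EEmbI)
    show "v \<in> ?A \<rightarrow>\<^sub>E ?A" using cA by (auto simp: v_def)
    fix \<phi> :: "('f, 'r) fm" and e :: "nat \<Rightarrow> 'u" assume \<phi>: "L_fm L \<phi>" and e: "\<And>m. e m \<in> ?A"
    have "sat \<A> (\<lambda>m. v (e m)) \<phi> = sat \<A> c (ren (\<lambda>m. Suc (2 * idx (e m))) \<phi>)"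
      using e by (simp add: sat_ren v_def)
    also have "\<dots> = p (ren (\<lambda>m. Suc (2 * idx (e m))) \<phi>)" using c L_ren[OF \<phi>] by blast
    also have "\<dots> = eventually (\<lambda>r. sat \<A> (\<lambda>m. f (r (e m))) \<phi>) U"
      using e by (simp add: p_def sat_ren t_v)
    also have "\<dots> = eventually (\<lambda>r. sat \<A> e \<phi>) U"
    proof (rule eventually_subst)
      show "eventually (\<lambda>r. sat \<A> (\<lambda>m. f (r (e m))) \<phi> = sat \<A> e \<phi>) U"
        using evG
      proof eventually_elim
        case (elim r)
        then have r: "r \<in> EEmb L \<A>" by (rule Aut_EEmb)
        have "sat \<A> (\<lambda>m. f (r (e m))) \<phi> = sat \<A> (\<lambda>m. r (e m)) \<phi>"
          using e by (intro EEmbD(3)[OF f \<phi>] EEmbD(2)[OF r])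
        also have "\<dots> = sat \<A> e \<phi>" using e by (intro EEmbD(3)[OF r \<phi>])
        finally show ?case .
      qed
    qed
    also have "\<dots> = sat \<A> e \<phi>" using Ubot by (simp add: eventually_const)
    finally show "sat \<A> (\<lambda>m. v (e m)) \<phi> = sat \<A> e \<phi>" .
  qed
  moreover have "u (f z) = v (g z)" if z: "z \<in> ?A" for z
  proof -
    have fz: "f z \<in> ?A" and gz: "g z \<in> ?A" using z EEmbD(2)[OF f] EEmbD(2)[OF g] by auto
    have "eventually (\<lambda>r. t (2 * idx (f z)) r = t (Suc (2 * idx (g z))) r) U"
      using evg[OF z] by eventually_elim (simp add: t_u[OF fz] t_v[OF gz])
    then show ?thesis using fz gz by (simp add: u_def v_def c_eq)
  qed
  moreover have "\<exists>z \<in> ?A. x = f z \<and> y = g z" if x: "x \<in> ?A" and y: "y \<in> ?A" and uv: "u x = v y" for x y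
  proof -
    have ev: "eventually (\<lambda>r. x = f (r y)) U" using uv x y by (simp add: u_def v_def c_eq t_u t_v)
    have "eventually (\<lambda>r. x = f (r y) \<and> r \<in> Aut L \<A>) U" using ev evG by (rule eventually_conj)
    \<comment> \<open>One member r0 determines almost all others at y: injectivity of
      \<open>f\<close> gives r y = r0 y = z. Since also r (g z) = z almost everywhere, injectivity
      of r yields y = g z.\<close>
    then obtain r0 where r0: "x = f (r0 y)" "r0 \<in> Aut L \<A>" using Ubot eventually_happens by blast
    define z where "z = r0 y"
    have z: "z \<in> ?A" unfolding z_def using Aut_EEmb[OF r0(2)] y by (rule EEmbD(2))
    have gz: "g z \<in> ?A" using EEmbD(2)[OF g z] .
    have "eventually (\<lambda>r. y = g z) U" using ev evG evg[OF z]
    proof eventually_elim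
      case (elim r)
      have r: "r \<in> EEmb L \<A>" using elim(2) by (rule Aut_EEmb)
      have "f (r y) = f z" using elim(1) r0(1) by (simp add: z_def)
      then have "r y = z" using EEmb_inj[OF f] EEmbD(2)[OF r y] z by (auto dest: inj_onD)
      then have "r y = r (g z)" using elim(3) by simp
      then show ?case using EEmb_inj[OF r] y gz by (auto dest: inj_onD)
    qed
    then have "y = g z" using Ubot by (simp add: eventually_const)
    then show ?thesis using r0(1) z by (auto simp: z_def)
  qed
  ultimately show ?thesis by blast
qed

section \<open>Direct limits and extension of partial maps, free of model theory\<close>

section \<open>Monoids with strong amalgamation over a dense group\<close>

text \<open>All that the rest of the argument uses about elementary self-embeddings
  (\<open>M\<close>) and automorphisms (\<open>G\<close>).\<close>

locale amalgamated_monoid =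
  fixes A :: "'a set" and G M :: "('a \<Rightarrow> 'a) set"
  assumes ctbl: "countable A" and ne: "A \<noteq> {}"
    and G_sub: "subgroup G (BijGroup A)"
    and M_E: "M \<subseteq> A \<rightarrow>\<^sub>E A"
    and M_comp: "f \<in> M \<Longrightarrow> g \<in> M \<Longrightarrow> compose A f g \<in> M"
    and G_M: "G \<subseteq> M"
    and M_bij: "f \<in> M \<Longrightarrow> bij_betw f A A \<Longrightarrow> f \<in> G"
    and M_closed: "h \<in> A \<rightarrow>\<^sub>E A \<Longrightarrow>
      (\<And>F. finite F \<Longrightarrow> F \<subseteq> A \<Longrightarrow> \<exists>m \<in> M. \<forall>x \<in> F. m x = h x) \<Longrightarrow> h \<in> M"
    and dense: "m \<in> M \<Longrightarrow> finite F \<Longrightarrow> F \<subseteq> A \<Longrightarrow> \<exists>g \<in> G. \<forall>x \<in> F. g x = m x"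
    and amalgamation: "f \<in> M \<Longrightarrow> g \<in> M \<Longrightarrow> \<exists>u \<in> M. \<exists>v \<in> M. (\<forall>z \<in> A. u (f z) = v (g z)) \<and>
      (\<forall>x \<in> A. \<forall>y \<in> A. u x = v y \<longrightarrow> (\<exists>z \<in> A. x = f z \<and> y = g z))"
begin

lemma M_app: "m \<in> M \<Longrightarrow> x \<in> A \<Longrightarrow> m x \<in> A"
  using M_E by blast

lemma M_eqI: "m \<in> M \<Longrightarrow> m' \<in> M \<Longrightarrow> (\<And>x. x \<in> A \<Longrightarrow> m x = m' x) \<Longrightarrow> m = m'"
  by (rule PiE_ext[of m A "\<lambda>_. A"]) (use M_E in blast)+

lemma G_Bij: "g \<in> G \<Longrightarrow> g \<in> Bij A"
  using subgroup.subset[OF G_sub] by (auto simp: BijGroup_def)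

lemma G_bij: "g \<in> G \<Longrightarrow> bij_betw g A A"
  using G_Bij by (auto simp: Bij_def)

lemma G_app: "g \<in> G \<Longrightarrow> x \<in> A \<Longrightarrow> g x \<in> A"
  using G_M M_app by blast

lemma G_comp: "g \<in> G \<Longrightarrow> g' \<in> G \<Longrightarrow> compose A g g' \<in> G"
  using subgroup.m_closed[OF G_sub, of g g'] G_Bij by (simp add: BijGroup_def)

lemma G_id: "(\<lambda>x \<in> A. x) \<in> G"
  using subgroup.one_closed[OF G_sub] by (simp add: BijGroup_def)

lemma G_inv: "g \<in> G \<Longrightarrow> \<exists>g' \<in> G. (\<forall>x \<in> A. g' (g x) = x) \<and> (\<forall>x \<in> A. g (g' x) = x)"
proof -
  assume g: "g \<in> G"
  have "(\<lambda>x \<in> A. inv_into A g x) \<in> G"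
    using subgroup.m_inv_closed[OF G_sub g] inv_BijGroup[OF G_Bij[OF g]] by simp
  moreover have "(\<lambda>x \<in> A. inv_into A g x) (g x) = x" "g ((\<lambda>x \<in> A. inv_into A g x) x) = x" if "x \<in> A" for x
    using G_bij[OF g] G_app[OF g] that
    by (auto simp: bij_betw_inv_into_left bij_betw_inv_into_right)
  ultimately show ?thesis by blast
qed

lemma M_inj: "m \<in> M \<Longrightarrow> x \<in> A \<Longrightarrow> y \<in> A \<Longrightarrow> m x = m y \<longleftrightarrow> x = y"
proof -
  assume m: "m \<in> M" and xy: "x \<in> A" "y \<in> A"
  obtain g where g: "g \<in> G" "\<forall>z \<in> {x, y}. g z = m z" using dense[OF m, of "{x, y}"] xy by auto
  then show ?thesis using G_bij[OF g(1)] xy by (auto simp: bij_betw_def inj_on_def)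
qed

text \<open>The limit of a chain of copies of \<open>A\<close> can be identified with
  \<open>A\<close>. Stage k holds a permutation in \<open>G\<close> that prescribes the limit map on
  a finite set of tracked points of level k. On a finite set \<open>w k\<close> agrees with an
  element of \<open>G\<close>, so the next permutation can be chosen to give the images of tracked
  points the same values; these values are final.\<close>

lemma direct_limit:
  assumes w: "\<And>k. w k \<in> M"
  shows "\<exists>v. (\<forall>k. v k \<in> M) \<and> (\<forall>k. \<forall>x \<in> A. v (Suc k) (w k x) = v k x) \<and>
    (\<forall>a \<in> A. \<exists>k. \<exists>x \<in> A. a = v k x)"
proof -
  define a where "a = from_nat_into A"
  have aA: "a k \<in> A" for k unfolding a_def using ne by (rule from_nat_into)
  define idx where "idx = to_nat_on A"
  have idx: "a (idx x) = x" if "x \<in> A" for x using ctbl that by (simp add: a_def idx_def)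
  \<comment> \<open>\<open>W l j\<close> is the composite map from level l to level l + j.\<close>
  define W where "W l = rec_nat (\<lambda>x \<in> A. x) (\<lambda>j m. compose A (w (l + j)) m)" for l
  have W0: "W l 0 = (\<lambda>x \<in> A. x)" and WS: "W l (Suc j) = compose A (w (l + j)) (W l j)" for l j
    by (simp_all add: W_def)
  have WM: "W l j \<in> M" for l j
  proof (induction j)
    case 0
    show ?case using G_id G_M unfolding W0 by blast
  next
    case (Suc j)
    show ?case unfolding WS using w Suc by (rule M_comp)
  qed
  have WA: "W l j x \<in> A" if "x \<in> A" for l j x using WM that by (rule M_app)
  have WS': "W l (Suc j) x = w (l + j) (W l j x)" if "x \<in> A" for l j x
    using that by (simp add: WS compose_def)
  have W_shift: "W (Suc l) j (w l x) = W l (Suc j) x" if x: "x \<in> A" for l j x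
  proof (induction j)
    case 0
    then show ?case using M_app[OF w x] x by (simp add: W0 WS compose_def)
  next
    case (Suc j)
    then show ?case using M_app[OF w x] x by (simp add: WS')
  qed
  \<comment> \<open>The images in level k of the first points of all levels up to k, so that every
    point of every level is eventually tracked.\<close>
  define B where "B k = (\<lambda>(l, i). W l (k - l) (a i)) ` ({..k} \<times> {..k})" for k
  have B: "finite (B k)" "B k \<subseteq> A" for k using WA aA by (auto simp: B_def)
  define P where "P k s \<longleftrightarrow> fst s \<in> G \<and> finite (snd s) \<and> snd s \<subseteq> A \<and> B k \<subseteq> snd s \<and>
    a k \<in> fst s ` snd s" for k and s :: "('a \<Rightarrow> 'a) \<times> 'a set"
  define Q where "Q k s t \<longleftrightarrow> w k ` snd s \<subseteq> snd t \<and> (\<forall>x \<in> snd s. fst t (w k x) = fst s x)"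
    for k and s t :: "('a \<Rightarrow> 'a) \<times> 'a set"
  have "\<exists>f. \<forall>k. P k (f k) \<and> Q k (f k) (f (Suc k))"
  proof (rule dependent_nat_choice)
    show "\<exists>s. P 0 s"
      by (rule exI[of _ "(\<lambda>x \<in> A. x, insert (a 0) (B 0))"]) (use G_id B aA in \<open>auto simp: P_def\<close>)
    fix s k assume "P k s"
    then obtain g F where s: "s = (g, F)" and g: "g \<in> G" and F: "finite F" "F \<subseteq> A"
      by (cases s) (auto simp: P_def)
    obtain \<gamma> where \<gamma>: "\<gamma> \<in> G" "\<forall>x \<in> F. \<gamma> x = w k x" using dense[OF w F] by blast
    obtain \<gamma>' where \<gamma>': "\<gamma>' \<in> G" "\<forall>x \<in> A. \<gamma>' (\<gamma> x) = x" using G_inv[OF \<gamma>(1)] by blast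
    define g1 where "g1 = compose A g \<gamma>'"
    have g1: "g1 \<in> G" unfolding g1_def using g \<gamma>'(1) by (rule G_comp)
    obtain g1' where g1': "g1' \<in> G" "\<forall>x \<in> A. g1 (g1' x) = x" using G_inv[OF g1] by blast
    have "g1 (w k x) = g x" if "x \<in> F" for x
    proof -
      have "x \<in> A" using F that by blast
      moreover have "\<gamma>' (w k x) = x" using \<gamma>(2) \<gamma>'(2) that calculation by metis
      ultimately show ?thesis using M_app[OF w] by (simp add: g1_def compose_def)
    qed
    \<comment> \<open>A preimage of the next enumerated element is tracked too, which makes the
      limit maps jointly onto.\<close>
    moreover have "a (Suc k) \<in> g1 ` insert (g1' (a (Suc k))) (w k ` F \<union> B (Suc k))"
      using g1'(2) aA by (intro image_eqI[of _ _ "g1' (a (Suc k))"]) auto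
    moreover have "w k ` F \<subseteq> A" using F M_app[OF w] by blast
    ultimately show "\<exists>t. P (Suc k) t \<and> Q k s t"
      using g1 F B[of "Suc k"] G_app[OF g1'(1) aA]
      by (intro exI[of _ "(g1, insert (g1' (a (Suc k))) (w k ` F \<union> B (Suc k)))"])
        (auto simp: P_def Q_def s)
  qed
  then obtain f where PQ: "\<And>k. P k (f k)" "\<And>k. Q k (f k) (f (Suc k))" by blast
  define g where "g k = fst (f k)" for k
  define F where "F k = snd (f k)" for k
  have gG: "g k \<in> G" and FA: "F k \<subseteq> A" and BF: "B k \<subseteq> F k" and hit: "a k \<in> g k ` F k" for k
    using PQ(1)[of k] by (auto simp: P_def g_def F_def)
  have wF: "w k x \<in> F (Suc k)" and gw: "g (Suc k) (w k x) = g k x" if "x \<in> F k" for k x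
    using PQ(2)[of k] that by (auto simp: Q_def g_def F_def)
  have persist: "W l (j + i) x \<in> F (l + (j + i)) \<and> g (l + (j + i)) (W l (j + i) x) = g (l + j) (W l j x)"
    if "W l j x \<in> F (l + j)" "x \<in> A" for l j i x
  proof (induction i)
    case (Suc i)
    have "W l (j + Suc i) x = w (l + (j + i)) (W l (j + i) x)" using that(2) by (simp add: WS')
    then show ?case using Suc wF[of "W l (j + i) x" "l + (j + i)"] gw[of "W l (j + i) x" "l + (j + i)"]
      by simp
  qed (use that in simp)
  have WB: "W l j x \<in> F (l + j)" if "x \<in> A" "idx x \<le> l + j" for l j x
  proof -
    have "W l j x = (\<lambda>(l', i). W l' (l + j - l') (a i)) (l, idx x)" using that by (simp add: idx)
    then have "W l j x \<in> B (l + j)" unfolding B_def by (rule image_eqI) (use that in auto)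
    then show ?thesis using BF by blast
  qed
  \<comment> \<open>After \<open>idx x\<close> further levels the image of x is tracked, so its
    value no longer changes.\<close>
  define v where "v l = (\<lambda>x \<in> A. g (l + idx x) (W l (idx x) x))" for l
  have v_eq: "v l x = g (l + j) (W l j x)" if "x \<in> A" "W l j x \<in> F (l + j)" for l j x
  proof -
    have "W l (idx x) x \<in> F (l + idx x)" using that(1) by (intro WB) auto
    from persist[OF this that(1), of j] persist[OF that(2,1), of "idx x"] that(1)
    show ?thesis by (simp add: v_def add.commute)
  qed
  have v_eq': "v l x = g (l + j) (W l j x)" if "x \<in> A" "idx x \<le> j" for l j x
    using that by (intro v_eq WB) auto
  have vM: "v l \<in> M" for l
  proof (rule M_closed)
    have "g (l + idx x) (W l (idx x) x) \<in> A" if "x \<in> A" for x using that by (intro G_app[OF gG] WA)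
    then show "v l \<in> A \<rightarrow>\<^sub>E A" by (auto simp: v_def)
    fix X assume X: "finite X" "X \<subseteq> A"
    define j where "j = Max (insert 0 (idx ` X))"
    have "v l x = compose A (g (l + j)) (W l j) x" if "x \<in> X" for x
    proof -
      have "idx x \<le> j" unfolding j_def using X that by (intro Max_ge) auto
      then show ?thesis using X that by (auto simp: v_eq' compose_def)
    qed
    moreover have "compose A (g (l + j)) (W l j) \<in> M" using gG G_M WM by (intro M_comp) auto
    ultimately show "\<exists>m \<in> M. \<forall>x \<in> X. m x = v l x" by (metis (no_types))
  qed
  moreover have "v (Suc l) (w l x) = v l x" if x: "x \<in> A" for l x
  proof -
    define j where "j = idx x + idx (w l x)"
    have "v (Suc l) (w l x) = g (Suc l + j) (W (Suc l) j (w l x))"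
      using M_app[OF w x] by (intro v_eq') (auto simp: j_def)
    also have "\<dots> = g (l + Suc j) (W l (Suc j) x)" using W_shift[OF x] by simp
    also have "\<dots> = v l x" using x by (intro v_eq'[symmetric]) (auto simp: j_def)
    finally show ?thesis .
  qed
  moreover have "\<exists>k. \<exists>x \<in> A. b = v k x" if b: "b \<in> A" for b
  proof -
    obtain y where y: "y \<in> F (idx b)" "b = g (idx b) y" using hit[of "idx b"] idx[OF b] by auto
    then have "y \<in> A" using FA by blast
    with y have "b = v (idx b) y" using v_eq[of y "idx b" 0] by (simp add: W0)
    with \<open>y \<in> A\<close> show ?thesis by blast
  qed
  ultimately show ?thesis by blast
qed

text \<open>The flag \<open>d\<close> tells whether the domain or the range is to absorb the old
  universe, embedded by \<open>w\<close>. For the domain, amalgamate with u q = v p and put w = p' =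
  u and q' = v; the other case is symmetric. A new fixed point is a common point of the two copies,
  and a strong amalgam has such points only over its base, where they come from old fixed
  points.\<close>

lemma extension_step:
  assumes p: "p \<in> M" and q: "q \<in> M"
  shows "\<exists>w p' q'. w \<in> M \<and> p' \<in> M \<and> q' \<in> M \<and>
    (\<forall>x \<in> A. \<exists>y \<in> A. p' y = w (p x) \<and> q' y = w (q x)) \<and>
    (\<forall>y \<in> A. p' y = q' y \<longrightarrow> (\<exists>x \<in> A. p x = q x \<and> p' y = w (p x))) \<and>
    (\<forall>x \<in> A. \<exists>y \<in> A. (if d then p' y else q' y) = w x)"
proof (cases d)
  case True
  obtain u v where uv: "u \<in> M" "v \<in> M" "\<forall>z \<in> A. u (q z) = v (p z)"
    "\<forall>x \<in> A. \<forall>y \<in> A. u x = v y \<longrightarrow> (\<exists>z \<in> A. x = q z \<and> y = p z)" using amalgamation[OF q p] by blast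
  have "\<exists>y \<in> A. u y = u (p x) \<and> v y = u (q x)" if "x \<in> A" for x
    using uv(3) that M_app[OF p that] by (intro bexI[of _ "p x"]) auto
  moreover have "\<exists>x \<in> A. p x = q x \<and> u y = u (p x)" if y: "y \<in> A" "u y = v y" for y
  proof -
    obtain z where "z \<in> A" "y = q z" "y = p z" using uv(4) y by blast
    then show ?thesis by (intro bexI[of _ z]) auto
  qed
  ultimately show ?thesis using uv(1,2) True
    by (intro exI[of _ u] exI[of _ u] exI[of _ v] conjI) auto
next
  case False
  obtain u v where uv: "u \<in> M" "v \<in> M" "\<forall>z \<in> A. u (p z) = v (q z)"
    "\<forall>x \<in> A. \<forall>y \<in> A. u x = v y \<longrightarrow> (\<exists>z \<in> A. x = p z \<and> y = q z)" using amalgamation[OF p q] by blast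
  have "\<exists>y \<in> A. v y = u (p x) \<and> u y = u (q x)" if "x \<in> A" for x
    using uv(3) that M_app[OF q that] by (intro bexI[of _ "q x"]) auto
  moreover have "\<exists>x \<in> A. p x = q x \<and> v y = u (p x)" if y: "y \<in> A" "v y = u y" for y
  proof -
    obtain z where "z \<in> A" "y = p z" "y = q z" using uv(4) y(1) y(2)[symmetric] by blast
    then show ?thesis using uv(3) by (intro bexI[of _ z]) auto
  qed
  ultimately show ?thesis using uv(1,2) False
    by (intro exI[of _ u] exI[of _ v] exI[of _ u] conjI) auto
qed

end

context amalgamated_monoid begin

text \<open>
  The pair \<open>(p, q)\<close> stands for the partial map \<open>p x \<mapsto> q x\<close>. Along a chain of self-embeddings
  of \<open>A\<close>, each pair is made total and onto without acquiring new fixed points.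
\<close>

lemma extend_to_automorphisms:
  assumes T: "countable T" "T \<noteq> {}" "T \<subseteq> M \<times> M"
  shows "\<exists>u \<in> M. \<forall>(p, q) \<in> T. \<exists>\<alpha> \<in> G. (\<forall>x \<in> A. \<alpha> (u (p x)) = u (q x)) \<and>
    (\<forall>a \<in> A. \<alpha> a = a \<longrightarrow> (\<exists>x \<in> A. p x = q x \<and> a = u (p x)))"
proof -
  have "\<forall>s d. \<exists>r. fst s \<in> M \<longrightarrow> snd s \<in> M \<longrightarrow> (case r of (w, p', q') \<Rightarrow>
    w \<in> M \<and> p' \<in> M \<and> q' \<in> M \<and>
    (\<forall>x \<in> A. \<exists>y \<in> A. p' y = w (fst s x) \<and> q' y = w (snd s x)) \<and>
    (\<forall>y \<in> A. p' y = q' y \<longrightarrow> (\<exists>x \<in> A. fst s x = snd s x \<and> p' y = w (fst s x))) \<and>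
    (\<forall>x \<in> A. \<exists>y \<in> A. (if d then p' y else q' y) = w x))"
    (is "\<forall>s d. \<exists>r. ?P s d r")
  proof (intro allI)
    fix s d
    show "\<exists>r. ?P s d r"
    proof (cases "fst s \<in> M \<and> snd s \<in> M")
      case True
      then obtain w p' q' where "w \<in> M \<and> p' \<in> M \<and> q' \<in> M \<and>
        (\<forall>x \<in> A. \<exists>y \<in> A. p' y = w (fst s x) \<and> q' y = w (snd s x)) \<and>
        (\<forall>y \<in> A. p' y = q' y \<longrightarrow> (\<exists>x \<in> A. fst s x = snd s x \<and> p' y = w (fst s x))) \<and>
        (\<forall>x \<in> A. \<exists>y \<in> A. (if d then p' y else q' y) = w x)"
        using extension_step[of "fst s" "snd s" d] by blast
      then show ?thesis by (intro exI[of _ "(w, p', q')"]) simp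
    qed auto
  qed
  then obtain R where R: "\<And>s d. ?P s d (R s d)" unfolding choice_iff by blast
  \<comment> \<open>Bookkeeping: the first component of \<open>prod_decode k\<close> encodes the
    pair to be treated and, by parity, the direction; the second makes each task recur beyond every
    stage.\<close>
  define dm where "dm k = even (fst (prod_decode k))" for k :: nat
  define tk where "tk k = fst (prod_decode k) div 2" for k :: nat
  have task: "\<exists>k \<ge> n. tk k = j \<and> dm k = d" for n j d
    by (rule exI[of _ "prod_encode (if d then 2 * j else Suc (2 * j), n)"])
      (simp add: tk_def dm_def le_prod_encode_2)
  \<comment> \<open>A single pair is enlarged at each stage; the others are carried along by the
    same embedding.\<close>
  define next_stage where "next_stage k S j = (case R (S (tk k)) (dm k) of (w, p', q') \<Rightarrow>
    if j = tk k then (p', q') else (compose A w (fst (S j)), compose A w (snd (S j))))" for k S j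
  define S where "S = rec_nat (from_nat_into T) next_stage"
  have S0: "S 0 = from_nat_into T" and SS: "S (Suc k) = next_stage k (S k)" for k
    by (simp_all add: S_def)
  define w where "w k = fst (R (S k (tk k)) (dm k))" for k
  define p where "p k j = fst (S k j)" for k j
  define q where "q k j = snd (S k j)" for k j
  have nxt: "S (Suc k) j = (if j = tk k then snd (R (S k (tk k)) (dm k))
      else (compose A (w k) (p k j), compose A (w k) (q k j)))" for k j
    unfolding SS next_stage_def w_def p_def q_def by (simp add: case_prod_beta)
  have pqM: "p k j \<in> M \<and> q k j \<in> M" and wM: "w k \<in> M" for k j
  proof -
    have *: "\<forall>j. p k j \<in> M \<and> q k j \<in> M" for k
    proof (induction k)
      case 0
      have "from_nat_into T j \<in> M \<times> M" for j using from_nat_into[OF T(2)] T(3) by blast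
      then show ?case by (auto simp: p_def q_def S0 mem_Times_iff)
    next
      case (Suc k)
      have R': "?P (S k (tk k)) (dm k) (R (S k (tk k)) (dm k))" by (rule R)
      show ?case
      proof
        fix j
        show "p (Suc k) j \<in> M \<and> q (Suc k) j \<in> M"
          using R' Suc[rule_format, of "tk k"] Suc[rule_format, of j]
          by (auto simp: p_def[of "Suc k"] q_def[of "Suc k"] nxt w_def p_def[of k "tk k"] q_def[of k "tk k"]
              case_prod_beta intro!: M_comp)
      qed
    qed
    show "p k j \<in> M \<and> q k j \<in> M" using * by blast
    show "w k \<in> M" using R[of "S k (tk k)" "dm k"] *[of k]
      by (simp add: w_def p_def q_def case_prod_beta)
  qed
  have active: "?P (S k (tk k)) (dm k) (w k, p (Suc k) (tk k), q (Suc k) (tk k))" for k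
  proof -
    have "(w k, p (Suc k) (tk k), q (Suc k) (tk k)) = R (S k (tk k)) (dm k)"
      by (simp add: p_def q_def nxt w_def)
    then show ?thesis using R[of "S k (tk k)" "dm k"] by simp
  qed
  have push: "\<exists>y \<in> A. p (Suc k) j y = w k (p k j x) \<and> q (Suc k) j y = w k (q k j x)"
    if "x \<in> A" for k j x
  proof (cases "j = tk k")
    case True
    then show ?thesis using active[of k] pqM[of k j] that by (simp add: p_def[of k] q_def[of k])
  next
    case False
    then show ?thesis using that
      by (intro bexI[of _ x]) (simp_all add: p_def[of "Suc k"] q_def[of "Suc k"] nxt compose_def)
  qed
  have fixed: "\<exists>x \<in> A. p k j x = q k j x \<and> p (Suc k) j y = w k (p k j x)"
    if "y \<in> A" "p (Suc k) j y = q (Suc k) j y" for k j y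
  proof (cases "j = tk k")
    case True
    then show ?thesis using active[of k] pqM[of k j] that by (simp add: p_def[of k] q_def[of k])
  next
    case False
    have "w k (p k j y) = w k (q k j y)" using that False
      by (simp add: p_def[of "Suc k"] q_def[of "Suc k"] nxt compose_def)
    then have "p k j y = q k j y" using M_inj[OF wM[of k]] pqM[of k j] M_app that(1) by blast
    then show ?thesis using that False
      by (intro bexI[of _ y]) (simp_all add: p_def[of "Suc k"] nxt compose_def)
  qed
  have total: "\<exists>y \<in> A. (if dm k then p (Suc k) (tk k) y else q (Suc k) (tk k) y) = w k x"
    if "x \<in> A" for k x
    using active[of k] pqM[of k "tk k"] that by (simp add: p_def[of k] q_def[of k])
  obtain v where vM: "\<And>k. v k \<in> M" and vw: "\<And>k x. x \<in> A \<Longrightarrow> v (Suc k) (w k x) = v k x"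
    and v_onto: "\<And>a. a \<in> A \<Longrightarrow> \<exists>k. \<exists>x \<in> A. a = v k x"
    using direct_limit[of w] wM by blast
  have v_up: "\<exists>y \<in> A. v k x = v (k + i) y" if "x \<in> A" for k i x
  proof (induction i)
    case (Suc i)
    then obtain y where y: "y \<in> A" "v k x = v (k + i) y" by blast
    then show ?case using vw[of y "k + i"] M_app[OF wM[of "k + i"] y(1)]
      by (intro bexI[of _ "w (k + i) y"]) auto
  qed (use that in auto)
  have aut: "\<exists>\<alpha> \<in> G. (\<forall>x \<in> A. \<alpha> (v 0 (p 0 j x)) = v 0 (q 0 j x)) \<and>
      (\<forall>a \<in> A. \<alpha> a = a \<longrightarrow> (\<exists>x \<in> A. p 0 j x = q 0 j x \<and> a = v 0 (p 0 j x)))" for j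
  proof -
    have pA: "p k j x \<in> A" and qA: "q k j x \<in> A" if "x \<in> A" for k x
      using pqM[of k j] M_app that by blast+
    have up: "\<exists>y \<in> A. v k (p k j x) = v (k + i) (p (k + i) j y) \<and>
        v k (q k j x) = v (k + i) (q (k + i) j y)" if "x \<in> A" for k i x
    proof (induction i)
      case (Suc i)
      then obtain y where y: "y \<in> A" "v k (p k j x) = v (k + i) (p (k + i) j y)"
        "v k (q k j x) = v (k + i) (q (k + i) j y)" by blast
      obtain z where z: "z \<in> A" "p (Suc (k + i)) j z = w (k + i) (p (k + i) j y)"
        "q (Suc (k + i)) j z = w (k + i) (q (k + i) j y)" using push[OF y(1)] by blast
      then show ?case using y vw[OF pA[OF y(1)], of "k + i" "k + i"] vw[OF qA[OF y(1)], of "k + i" "k + i"]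
        by (intro bexI[of _ z]) auto
    qed (use that in auto)
    \<comment> \<open>The union of all stages of pair j, seen in the limit; its graph grows with the
      stage, so finitely many instances can be compared at a common stage.\<close>
    define rel where "rel a b \<longleftrightarrow> (\<exists>k. \<exists>x \<in> A. a = v k (p k j x) \<and> b = v k (q k j x))" for a b
    have rel_up: "\<exists>N. \<forall>n \<ge> N. \<exists>x \<in> A. a = v n (p n j x) \<and> b = v n (q n j x)" if r: "rel a b" for a b
    proof -
      obtain k x where kx: "x \<in> A" "a = v k (p k j x)" "b = v k (q k j x)"
        using r by (auto simp: rel_def)
      have "\<exists>x \<in> A. a = v n (p n j x) \<and> b = v n (q n j x)" if "k \<le> n" for n
        using up[OF kx(1), of k "n - k"] kx that by auto
      then show ?thesis by blast
    qed
    have rel_A: "a \<in> A" "b \<in> A" if "rel a b" for a b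
      using that pA qA M_app[OF vM] by (auto simp: rel_def)
    have rel_inj: "a = a' \<longleftrightarrow> b = b'" if ab: "rel a b" "rel a' b'" for a b a' b'
    proof -
      obtain N N' where N: "\<And>n. N \<le> n \<Longrightarrow> \<exists>x \<in> A. a = v n (p n j x) \<and> b = v n (q n j x)"
        "\<And>n. N' \<le> n \<Longrightarrow> \<exists>x \<in> A. a' = v n (p n j x) \<and> b' = v n (q n j x)"
        using rel_up[OF ab(1)] rel_up[OF ab(2)] by blast
      define n where "n = max N N'"
      obtain x x' where x: "x \<in> A" "a = v n (p n j x)" "b = v n (q n j x)"
        "x' \<in> A" "a' = v n (p n j x')" "b' = v n (q n j x')"
        using N(1)[of n] N(2)[of n] by (auto simp: n_def)
      have "a = a' \<longleftrightarrow> x = x'" using x pA pqM[of n j] M_inj[OF vM] M_inj by simp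
      moreover have "b = b' \<longleftrightarrow> x = x'" using x qA pqM[of n j] M_inj[OF vM] M_inj by simp
      ultimately show ?thesis by simp
    qed
    have rel_total: "\<exists>b. if d then rel a b else rel b a" if a: "a \<in> A" for a d
    proof -
      obtain k0 x0 where x0: "x0 \<in> A" "a = v k0 x0" using v_onto[OF a] by blast
      obtain k where k: "k0 \<le> k" "tk k = j" "dm k = d" using task by blast
      obtain x where x: "x \<in> A" "a = v k x" using v_up[OF x0(1), of k0 "k - k0"] x0 k(1) by auto
      obtain y where y: "y \<in> A" "(if d then p (Suc k) j y else q (Suc k) j y) = w k x"
        using total[OF x(1), of k] k by auto
      have "a = v (Suc k) (if d then p (Suc k) j y else q (Suc k) j y)" using y(2) vw[OF x(1)] x(2) by simp
      then show ?thesis using y(1) unfolding rel_def by (cases d) auto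
    qed
    have dom: "\<exists>b. rel a b" if "a \<in> A" for a using rel_total[OF that, of True] by simp
    have ran: "\<exists>b. rel b a" if "a \<in> A" for a using rel_total[OF that, of False] by simp
    define \<alpha> where "\<alpha> = (\<lambda>a \<in> A. SOME b. rel a b)"
    have \<alpha>: "rel a (\<alpha> a)" if "a \<in> A" for a
      using someI_ex[OF dom[OF that]] that by (simp add: \<alpha>_def)
    have \<alpha>_eq: "\<alpha> a = b" if "rel a b" for a b
      using rel_inj[OF \<alpha>[OF rel_A(1)[OF that]] that] by simp
    have "\<alpha> \<in> M"
    proof (rule M_closed)
      show "\<alpha> \<in> A \<rightarrow>\<^sub>E A" using rel_A(2)[OF \<alpha>] by (auto simp: \<alpha>_def)
      fix F assume F: "finite F" "F \<subseteq> A"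
      have "\<forall>a \<in> F. \<exists>N. \<forall>n \<ge> N. \<exists>x \<in> A. a = v n (p n j x) \<and> \<alpha> a = v n (q n j x)"
        using rel_up[OF \<alpha>] F(2) by blast
      then obtain N where N: "\<And>a n. a \<in> F \<Longrightarrow> N a \<le> n \<Longrightarrow>
        \<exists>x \<in> A. a = v n (p n j x) \<and> \<alpha> a = v n (q n j x)" unfolding bchoice_iff by blast
      define n where "n = Max (insert 0 (N ` F))"
      have "N a \<le> n" if "a \<in> F" for a unfolding n_def using F that by (intro Max_ge) auto
      then have "\<forall>a \<in> F. \<exists>x. x \<in> A \<and> a = v n (p n j x) \<and> \<alpha> a = v n (q n j x)" using N by blast
      then obtain x where x: "\<And>a. a \<in> F \<Longrightarrow> x a \<in> A \<and> a = v n (p n j (x a)) \<and> \<alpha> a = v n (q n j (x a))"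
        unfolding bchoice_iff by blast
      have X: "finite (x ` F)" "x ` F \<subseteq> A" using F x by auto
      \<comment> \<open>On the finite set \<open>F\<close>, \<open>\<alpha>\<close> takes values of
        v p to values of v q. Replacing both composites by elements g1 and g2 of \<open>G\<close>
        makes the inverse of g1 followed by g2 an approximation of \<open>\<alpha>\<close>.\<close>
      have m: "compose A (v n) (p n j) \<in> M" "compose A (v n) (q n j) \<in> M"
        using vM pqM by (auto intro: M_comp)
      obtain g1 where g1: "g1 \<in> G" "\<forall>y \<in> x ` F. g1 y = compose A (v n) (p n j) y"
        using dense[OF m(1) X] by blast
      obtain g2 where g2: "g2 \<in> G" "\<forall>y \<in> x ` F. g2 y = compose A (v n) (q n j) y"
        using dense[OF m(2) X] by blast
      obtain g1' where g1': "g1' \<in> G" "\<forall>y \<in> A. g1' (g1 y) = y" using G_inv[OF g1(1)] by blast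
      have "compose A g2 g1' a = \<alpha> a" if a: "a \<in> F" for a
      proof -
        have xa: "x a \<in> A" "a = v n (p n j (x a))" "\<alpha> a = v n (q n j (x a))" using x[OF a] by auto
        have "g1 (x a) = a" using g1(2) a xa by (simp add: compose_def)
        then have "g1' a = x a" using g1'(2) xa(1) by metis
        moreover have "g2 (x a) = \<alpha> a" using g2(2) a xa by (simp add: compose_def)
        ultimately show ?thesis using a F(2) by (auto simp: compose_def)
      qed
      moreover have "compose A g2 g1' \<in> M" using G_comp[OF g2(1) g1'(1)] G_M by blast
      ultimately show "\<exists>m \<in> M. \<forall>a \<in> F. m a = \<alpha> a" by blast
    qed
    moreover have "bij_betw \<alpha> A A"
    proof (rule bij_betw_imageI)
      show "inj_on \<alpha> A" using rel_inj[OF \<alpha> \<alpha>] by (auto intro!: inj_onI)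
      show "\<alpha> ` A = A"
      proof
        show "\<alpha> ` A \<subseteq> A" using rel_A(2)[OF \<alpha>] by blast
        show "A \<subseteq> \<alpha> ` A"
        proof
          fix b assume "b \<in> A"
          then obtain a where a: "rel a b" using ran by blast
          show "b \<in> \<alpha> ` A" using \<alpha>_eq[OF a] rel_A(1)[OF a] by blast
        qed
      qed
    qed
    ultimately have "\<alpha> \<in> G" by (rule M_bij)
    moreover have "\<alpha> (v 0 (p 0 j x)) = v 0 (q 0 j x)" if "x \<in> A" for x
      using that by (intro \<alpha>_eq) (auto simp: rel_def)
    moreover have "\<exists>x \<in> A. p 0 j x = q 0 j x \<and> a = v 0 (p 0 j x)" if a: "a \<in> A" "\<alpha> a = a" for a
    proof -
      \<comment> \<open>A fixed point is traced back stage by stage to a fixed point of the original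
        pair, as no stage creates new ones.\<close>
      have down: "\<exists>x \<in> A. p 0 j x = q 0 j x \<and> v k (p k j y) = v 0 (p 0 j x)"
        if "y \<in> A" "p k j y = q k j y" for k y
        using that
      proof (induction k arbitrary: y)
        case (Suc k)
        then obtain x where x: "x \<in> A" "p k j x = q k j x" "p (Suc k) j y = w k (p k j x)"
          using fixed by blast
        then have "v (Suc k) (p (Suc k) j y) = v k (p k j x)"
            using vw[OF pA[OF x(1)], of k k] by (simp only:)
        with Suc.IH[OF x(1,2)] show ?case by simp
      qed auto
      have "rel a a" using \<alpha>[OF a(1)] a(2) by simp
      then obtain k y where y: "y \<in> A" "a = v k (p k j y)" "a = v k (q k j y)"
        unfolding rel_def by blast
      then have "p k j y = q k j y" using M_inj[OF vM] pA qA by metis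
      from down[OF y(1) this] y(2) show ?thesis by simp
    qed
    ultimately show ?thesis by blast
  qed
  show ?thesis
  proof (intro bexI[OF _ vM[of 0]] ballI)
    fix s assume "s \<in> T"
    then obtain j where "from_nat_into T j = s" using from_nat_into_surj[OF T(1)] by blast
    then have "s = (p 0 j, q 0 j)" by (auto simp: p_def q_def S0)
    then show "case s of (p, q) \<Rightarrow> \<exists>\<alpha> \<in> G. (\<forall>x \<in> A. \<alpha> (v 0 (p x)) = v 0 (q x)) \<and>
        (\<forall>a \<in> A. \<alpha> a = a \<longrightarrow> (\<exists>x \<in> A. p x = q x \<and> a = v 0 (p x)))"
      using aut[of j] by (simp only: prod.case)
  qed
qed

text \<open>One element of \<open>G\<close> is chosen for each finite partial map that extends to
  \<open>G\<close>; there are countably many such maps.\<close>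

lemma countable_dense_subset:
  "\<exists>B \<subseteq> G. countable B \<and> (\<forall>g \<in> G. \<forall>F. finite F \<longrightarrow> F \<subseteq> A \<longrightarrow> (\<exists>b \<in> B. \<forall>x \<in> F. b x = g x))"
proof -
  define P where "P = {P. finite P \<and> P \<subseteq> A \<times> A}"
  define R where "R p g \<longleftrightarrow> g \<in> G \<and> (\<forall>(x, y) \<in> p. g x = y)" for p and g :: "'a \<Rightarrow> 'a"
  define B where "B = (\<lambda>p. SOME g. R p g) ` {p \<in> P. \<exists>g. R p g}"
  have "countable P" unfolding P_def using ctbl by (intro countable_Collect_finite_subset) auto
  then have "countable {p \<in> P. \<exists>g. R p g}" by (rule countable_subset[rotated]) auto
  then have "countable B" unfolding B_def by (rule countable_image)
  moreover have "B \<subseteq> G"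
  proof
    fix b assume "b \<in> B"
    then obtain p where "b = (SOME g. R p g)" "\<exists>g. R p g" by (auto simp: B_def)
    then have "R p b" using someI_ex[of "R p"] by simp
    then show "b \<in> G" by (simp add: R_def)
  qed
  moreover have "\<exists>b \<in> B. \<forall>x \<in> F. b x = g x" if g: "g \<in> G" and F: "finite F" "F \<subseteq> A" for g F
  proof -
    define p where "p = (\<lambda>x. (x, g x)) ` F"
    have ex: "\<exists>g. R p g" using g by (intro exI[of _ g]) (auto simp: R_def p_def)
    have "p \<in> P" using F G_app[OF g] by (auto simp: P_def p_def)
    then have "(SOME g. R p g) \<in> B" using ex by (auto simp: B_def)
    moreover define b where "b = (SOME g. R p g)"
    have "R p b" unfolding b_def using ex by (rule someI_ex)
    then have "\<forall>x \<in> F. b x = g x" by (simp add: R_def p_def)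
    ultimately show ?thesis unfolding b_def by blast
  qed
  ultimately show ?thesis by (intro exI[of _ B]) simp
qed

end

section \<open>Endomorphisms of the monoid that are the identity on the group\<close>

locale fixing_endomorphism = amalgamated_monoid +
  fixes \<iota> :: "('a \<Rightarrow> 'a) \<Rightarrow> 'a \<Rightarrow> 'a"
  assumes center: "z \<in> G \<Longrightarrow> (\<And>g. g \<in> G \<Longrightarrow> compose A z g = compose A g z) \<Longrightarrow> z = (\<lambda>x \<in> A. x)"
    and \<iota>_M: "m \<in> M \<Longrightarrow> \<iota> m \<in> M"
    and \<iota>_comp: "m \<in> M \<Longrightarrow> m' \<in> M \<Longrightarrow> \<iota> (compose A m m') = compose A (\<iota> m) (\<iota> m')"
    and \<iota>_G: "g \<in> G \<Longrightarrow> \<iota> g = g"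
begin

text \<open>
  The fixed points of \<open>\<sigma>\<close> force \<open>\<iota> f = f \<circ> k\<close>; then \<open>k\<close> commutes with a dense subset of \<open>G\<close>, so
  \<open>k\<close> maps each orbit of \<open>G\<close> equivariantly, hence onto, to itself and lies in the center.
\<close>

lemma fixes_good:
  assumes f: "f \<in> M" and \<sigma>: "\<sigma> \<in> G" "\<And>x. x \<in> A \<Longrightarrow> \<sigma> x = x \<longleftrightarrow> x \<in> f ` A"
    and ext: "\<And>g F. g \<in> G \<Longrightarrow> finite F \<Longrightarrow> F \<subseteq> A \<Longrightarrow>
      \<exists>\<beta> \<in> G. \<exists>\<alpha> \<in> G. (\<forall>x \<in> F. \<beta> x = g x) \<and> (\<forall>x \<in> A. \<alpha> (f x) = f (\<beta> x))"
  shows "\<iota> f = f"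
proof -
  note GM = subsetD[OF G_M]
  have \<iota>fA: "\<iota> f x \<in> A" if "x \<in> A" for x using \<iota>_M[OF f] that by (rule M_app)
  have fA: "f x \<in> A" if "x \<in> A" for x using f that by (rule M_app)
  have "compose A \<sigma> f = f" using \<sigma>(2) fA M_comp[OF GM[OF \<sigma>(1)] f] f
    by (intro M_eqI) (auto simp: compose_def)
  then have "compose A \<sigma> (\<iota> f) = \<iota> f" using \<iota>_comp[OF GM[OF \<sigma>(1)] f] \<iota>_G[OF \<sigma>(1)] by simp
  then have "\<sigma> (\<iota> f x) = \<iota> f x" if "x \<in> A" for x using that compose_eq[of x A \<sigma> "\<iota> f"] by simp
  then have "\<forall>x \<in> A. \<exists>z. z \<in> A \<and> \<iota> f x = f z" using \<sigma>(2) \<iota>fA by blast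
  then obtain k0 where k0: "\<And>x. x \<in> A \<Longrightarrow> k0 x \<in> A \<and> \<iota> f x = f (k0 x)" unfolding bchoice_iff by blast
  define k where "k = restrict k0 A"
  have kA: "k x \<in> A" and fk: "f (k x) = \<iota> f x" if "x \<in> A" for x using k0[OF that] that by (auto simp: k_def)
  have f_inj: "f x = f y \<longleftrightarrow> x = y" if "x \<in> A" "y \<in> A" for x y using M_inj[OF f that] .
  have kM: "k \<in> M"
  proof (rule M_closed)
    show "k \<in> A \<rightarrow>\<^sub>E A" using k0 by (auto simp: k_def)
    fix F assume F: "finite F" "F \<subseteq> A"
    \<comment> \<open>\<open>k\<close> is \<open>\<iota> f\<close> followed by the inverse of
      \<open>f\<close>; on finitely many points both factors can be replaced by elements of
      \<open>G\<close>.\<close>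
    have kF: "finite (k ` F)" "k ` F \<subseteq> A" using F kA by auto
    obtain g1 where g1: "g1 \<in> G" "\<forall>x \<in> k ` F. g1 x = f x" using dense[OF f kF] by blast
    obtain g2 where g2: "g2 \<in> G" "\<forall>x \<in> F. g2 x = \<iota> f x" using dense[OF \<iota>_M[OF f] F] by blast
    obtain g1' where g1': "g1' \<in> G" "\<forall>x \<in> A. g1' (g1 x) = x" using G_inv[OF g1(1)] by blast
    have "compose A g1' g2 x = k x" if x: "x \<in> F" for x
    proof -
      have xA: "x \<in> A" using F x by blast
      have "g2 x = g1 (k x)" using g1(2) g2(2) x fk[OF xA] by simp
      then show ?thesis using g1'(2) kA[OF xA] xA by (simp add: compose_def)
    qed
    moreover have "compose A g1' g2 \<in> M" using G_comp[OF g1'(1) g2(1)] by (rule GM)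
    ultimately show "\<exists>m \<in> M. \<forall>x \<in> F. m x = k x" by blast
  qed
  have comm: "k (g x) = g (k x)" if g: "g \<in> G" and x: "x \<in> A" for g x
  proof -
    \<comment> \<open>Commutation at x involves \<open>g\<close> only at x and k x, so a \<beta>
      agreeing with \<open>g\<close> there suffices. Applying \<open>\<iota>\<close> to \<alpha> f =
      f \<beta> shows that k and \<beta> commute.\<close>
    have "{x, k x} \<subseteq> A" using x kA by auto
    then obtain \<beta> \<alpha> where \<beta>: "\<beta> \<in> G" "\<alpha> \<in> G" "\<beta> x = g x" "\<beta> (k x) = g (k x)"
      "\<And>y. y \<in> A \<Longrightarrow> \<alpha> (f y) = f (\<beta> y)" using ext[OF g, of "{x, k x}"] by auto
    have eq: "compose A \<alpha> f = compose A f \<beta>"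
      using \<beta> f GM by (intro M_eqI M_comp) (auto simp: compose_def)
    have "compose A \<alpha> (\<iota> f) = \<iota> (compose A \<alpha> f)"
      using \<iota>_comp[OF GM[OF \<beta>(2)] f] \<iota>_G[OF \<beta>(2)] by simp
    also have "\<dots> = compose A (\<iota> f) \<beta>"
      unfolding eq using \<iota>_comp[OF f GM[OF \<beta>(1)]] \<iota>_G[OF \<beta>(1)] by simp
    finally have "compose A \<alpha> (\<iota> f) x = compose A (\<iota> f) \<beta> x" by simp
    then have "\<alpha> (\<iota> f x) = \<iota> f (\<beta> x)" using x by (simp add: compose_def)
    then have "f (\<beta> (k x)) = f (k (\<beta> x))" using \<beta>(5)[OF kA[OF x]] fk[OF x] fk[OF G_app[OF \<beta>(1) x]] by simp
    then have "\<beta> (k x) = k (\<beta> x)" using f_inj G_app[OF \<beta>(1)] kA x by blast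
    then show ?thesis using \<beta> by simp
  qed
  have "bij_betw k A A"
  proof (rule bij_betw_imageI)
    show "inj_on k A" using M_inj[OF kM] by (auto intro: inj_onI)
    show "k ` A = A"
    proof
      show "k ` A \<subseteq> A" using kA by blast
      show "A \<subseteq> k ` A"
      proof
        fix y assume y: "y \<in> A"
        obtain g where g: "g \<in> G" "g y = k y" using dense[OF kM, of "{y}"] y by auto
        obtain g' where g': "g' \<in> G" "\<forall>x \<in> A. g' (g x) = x" using G_inv[OF g(1)] by blast
        have "k (g' y) = g' (k y)" using comm[OF g'(1) y] .
        also have "\<dots> = y" using g' g(2) y by metis
        finally show "y \<in> k ` A" using G_app[OF g'(1) y] by (metis imageI)
      qed
    qed
  qed
  with kM have kG: "k \<in> G" by (rule M_bij)
  have "k = (\<lambda>x \<in> A. x)"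
  proof (rule center[OF kG])
    fix g assume g: "g \<in> G"
    show "compose A k g = compose A g k"
      using comm[OF g] GM[OF g] kM by (intro M_eqI M_comp) (auto simp: compose_def)
  qed
  then show ?thesis using fk by (intro M_eqI[OF \<iota>_M[OF f] f]) simp
qed

lemma fixes_all:
  assumes h: "h \<in> M"
  shows "\<iota> h = h"
proof -
  note GM = subsetD[OF G_M]
  obtain B where B: "B \<subseteq> G" "countable B"
    and B_dense: "\<forall>g \<in> G. \<forall>F. finite F \<longrightarrow> F \<subseteq> A \<longrightarrow> (\<exists>b \<in> B. \<forall>x \<in> F. b x = g x)"
    using countable_dense_subset by (elim exE conjE)
  let ?id = "\<lambda>x \<in> A. x"
  \<comment> \<open>One u has to serve itself and u h. The identical pairs give automorphisms whose
    fixed points are precisely the ranges of u and of u h; the pairs built from b make b extend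
    along u and along u h.\<close>
  define T where "T = {(?id, ?id), (h, h)} \<union> Pair ?id ` B \<union> (\<lambda>b. (h, compose A h b)) ` B"
  have id_M: "?id \<in> M" using G_id by (rule GM)
  have "(h, compose A h b) \<in> M \<times> M" "(?id, b) \<in> M \<times> M" if "b \<in> B" for b
    using M_comp[OF h GM[OF subsetD[OF B(1) that]]] GM[OF subsetD[OF B(1) that]] h id_M by simp_all
  then have T1: "T \<subseteq> M \<times> M" using h id_M unfolding T_def by (intro Un_least image_subsetI) simp_all
  have T2: "countable T" using B(2) by (simp add: T_def)
  have T3: "T \<noteq> {}" by (simp add: T_def)
  obtain u where u: "u \<in> M" and ext_T: "\<forall>(p, q) \<in> T. \<exists>\<alpha> \<in> G.
      (\<forall>x \<in> A. \<alpha> (u (p x)) = u (q x)) \<and>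
      (\<forall>a \<in> A. \<alpha> a = a \<longrightarrow> (\<exists>x \<in> A. p x = q x \<and> a = u (p x)))"
    using extend_to_automorphisms[OF T2 T3 T1] by (rule bexE)
  have ext: "\<exists>\<alpha> \<in> G. (\<forall>x \<in> A. \<alpha> (u (p x)) = u (q x)) \<and>
      (\<forall>a \<in> A. \<alpha> a = a \<longrightarrow> (\<exists>x \<in> A. p x = q x \<and> a = u (p x)))" if "(p, q) \<in> T" for p q
    using bspec[OF ext_T that] by (simp only: prod.case)
  have uh: "compose A u h \<in> M" using u h by (rule M_comp)
  have "\<iota> u = u"
  proof -
    have "(?id, ?id) \<in> T" by (simp add: T_def)
    from ext[OF this] obtain \<sigma> where \<sigma>: "\<sigma> \<in> G" "\<forall>x \<in> A. \<sigma> (u x) = u x"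
      "\<forall>a \<in> A. \<sigma> a = a \<longrightarrow> (\<exists>x \<in> A. a = u x)" by auto
    show ?thesis
    proof (rule fixes_good[OF u \<sigma>(1)])
      show "\<sigma> x = x \<longleftrightarrow> x \<in> u ` A" if "x \<in> A" for x using \<sigma>(2,3) that by blast
      fix g F assume g: "g \<in> G" and F: "finite F" "F \<subseteq> A"
      obtain b where b: "b \<in> B" "\<forall>x \<in> F. b x = g x" using B_dense g F by blast
      have "(?id, b) \<in> T" using b by (auto simp: T_def)
      from ext[OF this] obtain \<alpha> where "\<alpha> \<in> G" "\<forall>x \<in> A. \<alpha> (u x) = u (b x)" by auto
      then show "\<exists>\<beta> \<in> G. \<exists>\<alpha> \<in> G. (\<forall>x \<in> F. \<beta> x = g x) \<and> (\<forall>x \<in> A. \<alpha> (u x) = u (\<beta> x))"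
        using b B(1) by blast
    qed
  qed
  moreover have "\<iota> (compose A u h) = compose A u h"
  proof -
    have "(h, h) \<in> T" by (simp add: T_def)
    from ext[OF this] obtain \<sigma> where \<sigma>: "\<sigma> \<in> G" "\<forall>x \<in> A. \<sigma> (u (h x)) = u (h x)"
      "\<forall>a \<in> A. \<sigma> a = a \<longrightarrow> (\<exists>x \<in> A. a = u (h x))" by blast
    show ?thesis
    proof (rule fixes_good[OF uh \<sigma>(1)])
      show "\<sigma> x = x \<longleftrightarrow> x \<in> compose A u h ` A" if "x \<in> A" for x
        using \<sigma>(2,3) that by (force simp: compose_def)
      fix g F assume g: "g \<in> G" and F: "finite F" "F \<subseteq> A"
      obtain b where b: "b \<in> B" "\<forall>x \<in> F. b x = g x" using B_dense g F by blast
      have "(h, compose A h b) \<in> T" using b by (auto simp: T_def)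
      from ext[OF this] obtain \<alpha> where \<alpha>: "\<alpha> \<in> G" "\<forall>x \<in> A. \<alpha> (u (h x)) = u (compose A h b x)" by blast
      have bG: "b \<in> G" using b B(1) by blast
      have "\<forall>x \<in> A. \<alpha> (compose A u h x) = compose A u h (b x)"
        using \<alpha>(2) G_app[OF bG] by (simp add: compose_def)
      then show "\<exists>\<beta> \<in> G. \<exists>\<alpha> \<in> G. (\<forall>x \<in> F. \<beta> x = g x) \<and>
          (\<forall>x \<in> A. \<alpha> (compose A u h x) = compose A u h (\<beta> x))"
        using b(2) bG \<alpha>(1) by blast
    qed
  qed
  ultimately have eq: "compose A u (\<iota> h) = compose A u h" using \<iota>_comp[OF u h] by simp
  show ?thesis
  proof (rule M_eqI[OF \<iota>_M[OF h] h])
    fix x assume x: "x \<in> A"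
    have "u (\<iota> h x) = u (h x)" using fun_cong[OF eq, of x] x by (simp add: compose_def)
    then show "\<iota> h x = h x" using M_inj[OF u] M_app[OF h x] M_app[OF \<iota>_M[OF h] x] by simp
  qed
qed

end

section \<open>Open sets, closed sets and homeomorphisms through agreement on finite sets\<close>

section \<open>The pointwise topology\<close>

lemma openin_pointwise:
  "openin (subtopology (pointwise_topology A) S) U \<longleftrightarrow> U \<subseteq> S \<inter> (A \<rightarrow>\<^sub>E A) \<and>
    (\<forall>f \<in> U. \<exists>F. finite F \<and> F \<subseteq> A \<and> (\<forall>g \<in> S \<inter> (A \<rightarrow>\<^sub>E A). (\<forall>x \<in> F. g x = f x) \<longrightarrow> g \<in> U))"
    (is "?L \<longleftrightarrow> ?R")
proof
  assume ?L
  then obtain T where T: "openin (pointwise_topology A) T" "U = T \<inter> S" by (auto simp: openin_subtopology)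
  have sub: "T \<subseteq> A \<rightarrow>\<^sub>E A" using openin_subset[OF T(1)] by (simp add: pointwise_topology_def)
  have loc: "\<exists>F. finite F \<and> F \<subseteq> A \<and> (\<forall>g \<in> S \<inter> (A \<rightarrow>\<^sub>E A). (\<forall>x \<in> F. g x = f x) \<longrightarrow> g \<in> U)" if "f \<in> U" for f
  proof -
    have "f \<in> T" using that T by blast
    then obtain W where W: "finite {i \<in> A. W i \<noteq> A}" "\<And>i. i \<in> A \<Longrightarrow> W i \<subseteq> A" "f \<in> Pi\<^sub>E A W" "Pi\<^sub>E A W \<subseteq> T"
      using T(1) unfolding pointwise_topology_def openin_product_topology_alt by fastforce
    have "g \<in> U" if g: "g \<in> S \<inter> (A \<rightarrow>\<^sub>E A)" "\<forall>x \<in> {i \<in> A. W i \<noteq> A}. g x = f x" for g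
    proof -
      have "g i \<in> W i" if "i \<in> A" for i
      proof (cases "W i = A")
        case True
        then show ?thesis using g(1) that by auto
      next
        case False
        then have "g i = f i" using g(2) that by blast
        then show ?thesis using W(3) that by (auto simp: PiE_iff)
      qed
      then have "g \<in> Pi\<^sub>E A W" using g(1) by (auto simp: PiE_iff)
      then show ?thesis using W(4) g(1) T(2) by blast
    qed
    then show ?thesis using W(1) by (intro exI[of _ "{i \<in> A. W i \<noteq> A}"]) blast
  qed
  show ?R
  proof (intro conjI ballI)
    show "U \<subseteq> S \<inter> (A \<rightarrow>\<^sub>E A)" using sub T(2) by blast
  qed (rule loc)
next
  assume R: ?R
  obtain F where F_all: "\<forall>f \<in> U. finite (F f) \<and> F f \<subseteq> A \<and>
    (\<forall>g \<in> S \<inter> (A \<rightarrow>\<^sub>E A). (\<forall>x \<in> F f. g x = f x) \<longrightarrow> g \<in> U)"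
    using bchoice[OF conjunct2[OF R]] by (rule exE)
  have F: "finite (F f)" "F f \<subseteq> A" if "f \<in> U" for f using F_all that by blast+
  define T where "T = {g \<in> A \<rightarrow>\<^sub>E A. \<exists>f \<in> U. \<forall>x \<in> F f. g x = f x}"
  have "openin (pointwise_topology A) T"
    unfolding pointwise_topology_def openin_product_topology_alt
  proof
    fix g assume "g \<in> T"
    then obtain f where f: "f \<in> U" "\<forall>x \<in> F f. g x = f x" and g: "g \<in> A \<rightarrow>\<^sub>E A" by (auto simp: T_def)
    let ?W = "\<lambda>i. if i \<in> F f then {g i} else A"
    have "{i \<in> A. ?W i \<noteq> A} \<subseteq> F f" by auto
    then have "finite {i \<in> A. ?W i \<noteq> A}" using F(1)[OF f(1)] by (rule finite_subset)
    moreover have "Pi\<^sub>E A ?W \<subseteq> T"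
    proof
      fix g' assume g': "g' \<in> Pi\<^sub>E A ?W"
      have in_A: "g' i \<in> A" if "i \<in> A" for i
        using PiE_mem[OF g' that] PiE_mem[OF g that] by (auto split: if_splits)
      then have "g' \<in> A \<rightarrow>\<^sub>E A" using g' by (auto simp: PiE_iff)
      moreover have "\<forall>x \<in> F f. g' x = f x"
      proof
        fix x assume x: "x \<in> F f"
        then have "x \<in> A" using F(2)[OF f(1)] by blast
        from PiE_mem[OF g' this] show "g' x = f x" using x f(2) by simp
      qed
      ultimately show "g' \<in> T" using f(1) by (auto simp: T_def)
    qed
    moreover have "g \<in> Pi\<^sub>E A ?W" using g by (auto simp: PiE_iff)
    moreover have "openin (discrete_topology A) (?W i)" if "i \<in> A" for i using PiE_mem[OF g that] by simp
    ultimately show "\<exists>W. finite {i \<in> A. W i \<noteq> topspace (discrete_topology A)} \<and>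
        (\<forall>i \<in> A. openin (discrete_topology A) (W i)) \<and> g \<in> Pi\<^sub>E A W \<and> Pi\<^sub>E A W \<subseteq> T"
      by (intro exI[of _ ?W]) simp
  qed
  moreover have "U = T \<inter> S"
  proof
    show "U \<subseteq> T \<inter> S" using conjunct1[OF R] unfolding T_def by blast
    show "T \<inter> S \<subseteq> U" using F_all unfolding T_def by blast
  qed
  ultimately show ?L unfolding openin_subtopology by blast
qed

lemma topspace_pointwise:
  "topspace (subtopology (pointwise_topology A) S) = S \<inter> (A \<rightarrow>\<^sub>E A)"
  by (auto simp: pointwise_topology_def)

lemma closedin_pointwise:
  "closedin (subtopology (pointwise_topology A) S) H \<longleftrightarrow> H \<subseteq> S \<inter> (A \<rightarrow>\<^sub>E A) \<and>
    (\<forall>h \<in> S \<inter> (A \<rightarrow>\<^sub>E A). (\<forall>F. finite F \<longrightarrow> F \<subseteq> A \<longrightarrow> (\<exists>m \<in> H. \<forall>x \<in> F. m x = h x)) \<longrightarrow> h \<in> H)"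
    (is "?L \<longleftrightarrow> ?R")
proof
  assume L: ?L
  then have sub: "H \<subseteq> S \<inter> (A \<rightarrow>\<^sub>E A)" unfolding closedin_def topspace_pointwise by blast
  have op: "openin (subtopology (pointwise_topology A) S) (S \<inter> (A \<rightarrow>\<^sub>E A) - H)"
    using L unfolding closedin_def topspace_pointwise by blast
  have "h \<in> H" if h: "h \<in> S \<inter> (A \<rightarrow>\<^sub>E A)"
    and approx: "\<forall>F. finite F \<longrightarrow> F \<subseteq> A \<longrightarrow> (\<exists>m \<in> H. \<forall>x \<in> F. m x = h x)" for h
  proof (rule ccontr)
    assume "h \<notin> H"
    then obtain F where F: "finite F" "F \<subseteq> A"
      "\<forall>g \<in> S \<inter> (A \<rightarrow>\<^sub>E A). (\<forall>x \<in> F. g x = h x) \<longrightarrow> g \<in> S \<inter> (A \<rightarrow>\<^sub>E A) - H"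
      using op h unfolding openin_pointwise by blast
    obtain m where "m \<in> H" "\<forall>x \<in> F. m x = h x" using approx F by blast
    then show False using F(3) sub by blast
  qed
  with sub show ?R by blast
next
  assume R: ?R
  have "openin (subtopology (pointwise_topology A) S) (S \<inter> (A \<rightarrow>\<^sub>E A) - H)"
    unfolding openin_pointwise
  proof (intro conjI ballI)
    fix h assume h: "h \<in> S \<inter> (A \<rightarrow>\<^sub>E A) - H"
    then obtain F where "finite F" "F \<subseteq> A" "\<not> (\<exists>m \<in> H. \<forall>x \<in> F. m x = h x)" using R by blast
    then show "\<exists>F. finite F \<and> F \<subseteq> A \<and>
        (\<forall>g \<in> S \<inter> (A \<rightarrow>\<^sub>E A). (\<forall>x \<in> F. g x = h x) \<longrightarrow> g \<in> S \<inter> (A \<rightarrow>\<^sub>E A) - H)" by blast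
  qed blast
  then show ?L using R unfolding closedin_def topspace_pointwise by blast
qed

lemma closedin_pointwise_UNIV:
  "closedin (pointwise_topology A) H \<longleftrightarrow> H \<subseteq> A \<rightarrow>\<^sub>E A \<and>
    (\<forall>h \<in> A \<rightarrow>\<^sub>E A. (\<forall>F. finite F \<longrightarrow> F \<subseteq> A \<longrightarrow> (\<exists>m \<in> H. \<forall>x \<in> F. m x = h x)) \<longrightarrow> h \<in> H)"
  using closedin_pointwise[of A UNIV H] by simp

text \<open>The two last hypotheses are uniform continuity of \<open>\<theta>\<close> and of its
  inverse: the finite set does not depend on the point. It is this uniform form that passes from a
  dense subset to the whole monoid.\<close>

lemma homeomorphic_map_pointwise:
  assumes S: "S \<subseteq> A \<rightarrow>\<^sub>E A" and T: "T \<subseteq> A \<rightarrow>\<^sub>E A" and bij: "bij_betw \<theta> S T"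
    and unif: "\<And>F. finite F \<Longrightarrow> F \<subseteq> A \<Longrightarrow> \<exists>E. finite E \<and> E \<subseteq> A \<and>
      (\<forall>m \<in> S. \<forall>m' \<in> S. (\<forall>x \<in> E. m x = m' x) \<longrightarrow> (\<forall>x \<in> F. \<theta> m x = \<theta> m' x))"
    and unif': "\<And>E. finite E \<Longrightarrow> E \<subseteq> A \<Longrightarrow> \<exists>F. finite F \<and> F \<subseteq> A \<and>
      (\<forall>m \<in> S. \<forall>m' \<in> S. (\<forall>x \<in> F. \<theta> m x = \<theta> m' x) \<longrightarrow> (\<forall>x \<in> E. m x = m' x))"
  shows "homeomorphic_map (subtopology (pointwise_topology A) S) (subtopology (pointwise_topology A) T) \<theta>"
proof (rule bijective_open_imp_homeomorphic_map)
  have topS: "S \<inter> (A \<rightarrow>\<^sub>E A) = S" and topT: "T \<inter> (A \<rightarrow>\<^sub>E A) = T" using S T by auto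
  have \<theta>T: "\<theta> m \<in> T" if "m \<in> S" for m using bij that by (rule bij_betw_apply)
  have \<theta>_img: "\<theta> ` S = T" using bij by (simp add: bij_betw_def)
  show "continuous_map (subtopology (pointwise_topology A) S) (subtopology (pointwise_topology A) T) \<theta>"
    unfolding continuous_map topspace_pointwise topS topT
  proof (intro conjI allI impI)
    show "\<theta> ` S \<subseteq> T" using \<theta>_img by simp
    fix U assume U: "openin (subtopology (pointwise_topology A) T) U"
    show "openin (subtopology (pointwise_topology A) S) {x \<in> S. \<theta> x \<in> U}"
      unfolding openin_pointwise topS
    proof (intro conjI ballI)
      fix m assume "m \<in> {x \<in> S. \<theta> x \<in> U}"
      then have m: "m \<in> S" "\<theta> m \<in> U" by auto
      obtain F where F: "finite F" "F \<subseteq> A" "\<forall>g \<in> T. (\<forall>x \<in> F. g x = \<theta> m x) \<longrightarrow> g \<in> U"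
        using U m(2) unfolding openin_pointwise topT by blast
      obtain E where E: "finite E" "E \<subseteq> A"
        "\<forall>m \<in> S. \<forall>m' \<in> S. (\<forall>x \<in> E. m x = m' x) \<longrightarrow> (\<forall>x \<in> F. \<theta> m x = \<theta> m' x)"
        using unif[OF F(1,2)] by blast
      have "\<forall>g \<in> S. (\<forall>x \<in> E. g x = m x) \<longrightarrow> g \<in> {x \<in> S. \<theta> x \<in> U}"
        using E(3) F(3) m(1) \<theta>T by blast
      then show "\<exists>F. finite F \<and> F \<subseteq> A \<and> (\<forall>g \<in> S. (\<forall>x \<in> F. g x = m x) \<longrightarrow> g \<in> {x \<in> S. \<theta> x \<in> U})"
        using E(1,2) by blast
    qed blast
  qed
  show "open_map (subtopology (pointwise_topology A) S) (subtopology (pointwise_topology A) T) \<theta>"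
    unfolding open_map_def
  proof (intro allI impI)
    fix U assume U: "openin (subtopology (pointwise_topology A) S) U"
    then have US: "U \<subseteq> S" unfolding openin_pointwise by blast
    show "openin (subtopology (pointwise_topology A) T) (\<theta> ` U)"
      unfolding openin_pointwise topT
    proof (intro conjI ballI)
      show "\<theta> ` U \<subseteq> T" using US \<theta>T by blast
      fix h assume "h \<in> \<theta> ` U"
      then obtain m where m: "m \<in> U" "h = \<theta> m" by blast
      obtain E where E: "finite E" "E \<subseteq> A" "\<forall>g \<in> S. (\<forall>x \<in> E. g x = m x) \<longrightarrow> g \<in> U"
        using U m(1) unfolding openin_pointwise topS by blast
      obtain F where F: "finite F" "F \<subseteq> A"
        "\<forall>m \<in> S. \<forall>m' \<in> S. (\<forall>x \<in> F. \<theta> m x = \<theta> m' x) \<longrightarrow> (\<forall>x \<in> E. m x = m' x)"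
        using unif'[OF E(1,2)] by blast
      have "g \<in> \<theta> ` U" if g: "g \<in> T" "\<forall>x \<in> F. g x = h x" for g
      proof -
        obtain m' where m': "m' \<in> S" "g = \<theta> m'" using g(1) \<theta>_img by blast
        have "\<forall>x \<in> E. m' x = m x" using F(3) m'(1) m US g(2) m'(2) by blast
        then have "m' \<in> U" using E(3) m'(1) by blast
        then show ?thesis using m'(2) by blast
      qed
      then show "\<exists>F. finite F \<and> F \<subseteq> A \<and> (\<forall>g \<in> T. (\<forall>x \<in> F. g x = h x) \<longrightarrow> g \<in> \<theta> ` U)"
        using F(1,2) by blast
    qed
  qed
  show "\<theta> ` topspace (subtopology (pointwise_topology A) S) = topspace (subtopology (pointwise_topology A) T)"
    using \<theta>_img unfolding topspace_pointwise topS topT .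
  show "inj_on \<theta> (topspace (subtopology (pointwise_topology A) S))"
    using bij unfolding topspace_pointwise topS by (simp add: bij_betw_def)
qed

section \<open>Passing from the automorphism group to the monoid\<close>

section \<open>Automatic homeomorphicity\<close>

lemma iso_carrier:
  "\<theta> \<in> iso (K\<lparr>carrier := S\<rparr>) (K\<lparr>carrier := T\<rparr>) \<longleftrightarrow> bij_betw \<theta> S T \<and>
    (\<forall>x \<in> S. \<forall>y \<in> S. \<theta> (x \<otimes>\<^bsub>K\<^esub> y) = \<theta> x \<otimes>\<^bsub>K\<^esub> \<theta> y)"
  by (auto simp: iso_def hom_def dest: bij_betw_apply)

text \<open>Continuity on a group is uniform, so each a has a finite set \<open>E1 a\<close> on
  which agreement of two elements of \<open>G\<close> decides the values of their images at a. This
  modulus defines the extension \<open>\<Theta>\<close>. Once \<open>\<Theta>\<close> is known to be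
  \<open>\<theta>\<close>, it yields continuity of \<open>\<theta>\<close> on \<open>M\<close>, and
  together with \<open>unif_G'\<close> that of the inverse.\<close>

lemma (in amalgamated_monoid) automatic_homeomorphicity:
  assumes center: "\<And>z. z \<in> G \<Longrightarrow> (\<And>g. g \<in> G \<Longrightarrow> compose A z g = compose A g z) \<Longrightarrow> z = (\<lambda>x \<in> A. x)"
    and G_auto: "group_auto_homeo A G"
    and N: "closed_trans_monoid A N"
    and \<theta>: "\<theta> \<in> iso (full_trans_monoid A\<lparr>carrier := M\<rparr>) (full_trans_monoid A\<lparr>carrier := N\<rparr>)"
  shows "homeomorphic_map (subtopology (pointwise_topology A) M) (subtopology (pointwise_topology A) N) \<theta>"
proof -
  note GM = subsetD[OF G_M]
  let ?id = "\<lambda>x \<in> A. x"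
  have N_sub: "submonoid N (full_trans_monoid A)" using N by (simp add: closed_trans_monoid_def)
  have NE: "N \<subseteq> A \<rightarrow>\<^sub>E A" and N_closed: "\<And>h. h \<in> A \<rightarrow>\<^sub>E A \<Longrightarrow>
      \<forall>F. finite F \<longrightarrow> F \<subseteq> A \<longrightarrow> (\<exists>m \<in> N. \<forall>x \<in> F. m x = h x) \<Longrightarrow> h \<in> N"
    using N unfolding closed_trans_monoid_def closedin_pointwise_UNIV by blast+
  have id_N: "?id \<in> N" using submonoid.one_closed[OF N_sub] by (simp add: full_trans_monoid_def)
  have bij: "bij_betw \<theta> M N" and \<theta>_comp: "\<theta> (compose A m m') = compose A (\<theta> m) (\<theta> m')"
    if "m \<in> M" "m' \<in> M" for m m'
    using \<theta> that unfolding iso_carrier by (auto simp: full_trans_monoid_def)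
  have id_M: "?id \<in> M" using G_id by (rule GM)
  note bij = bij[OF id_M id_M]
  have \<theta>N: "\<theta> m \<in> N" if "m \<in> M" for m using bij that by (rule bij_betw_apply)
  have \<theta>A: "\<theta> m x \<in> A" if "m \<in> M" "x \<in> A" for m x using \<theta>N[OF that(1)] NE that(2) by blast
  have \<theta>E: "\<theta> m \<in> A \<rightarrow>\<^sub>E A" if "m \<in> M" for m using \<theta>N[OF that] NE by blast
  have \<theta>_inj: "m = m'" if "\<theta> m = \<theta> m'" "m \<in> M" "m' \<in> M" for m m'
    using bij that by (auto simp: bij_betw_def dest: inj_onD)
  have \<theta>_app: "\<theta> (compose A m m') x = \<theta> m (\<theta> m' x)" if "m \<in> M" "m' \<in> M" "x \<in> A" for m m' x
    using \<theta>_comp[OF that(1,2)] that(3) by (simp add: compose_def)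
  have \<theta>_onto: "\<exists>m \<in> M. h = \<theta> m" if "h \<in> N" for h
    using bij that by (auto simp: bij_betw_def)
  have \<theta>_id: "\<theta> ?id = ?id"
  proof -
    obtain e where e: "e \<in> M" "?id = \<theta> e" using \<theta>_onto[OF id_N] by blast
    have "compose A ?id e = e"
      by (rule M_eqI[OF M_comp[OF id_M e(1)] e(1)]) (simp add: compose_def M_app[OF e(1)])
    then have "\<theta> e = compose A (\<theta> ?id) (\<theta> e)" using \<theta>_comp[OF id_M e(1)] by simp
    also have "\<dots> = \<theta> ?id" unfolding e(2)[symmetric]
      by (rule PiE_ext[of _ A "\<lambda>_. A"]) (use \<theta>E[OF id_M] \<theta>A[OF id_M] in \<open>auto simp: compose_def\<close>)
    finally show ?thesis using e(2) by simp
  qed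
  have \<theta>_inv: "\<exists>g' \<in> G. (\<forall>x \<in> A. g' (g x) = x) \<and> (\<forall>x \<in> A. g (g' x) = x) \<and>
      (\<forall>x \<in> A. \<theta> g' (\<theta> g x) = x) \<and> (\<forall>x \<in> A. \<theta> g (\<theta> g' x) = x)" if g: "g \<in> G" for g
  proof -
    obtain g' where g': "g' \<in> G" "\<forall>x \<in> A. g' (g x) = x" "\<forall>x \<in> A. g (g' x) = x" using G_inv[OF g] by blast
    have "compose A g' g = ?id" "compose A g g' = ?id" using g' by (auto simp: compose_def)
    then have "\<theta> g' (\<theta> g x) = x" "\<theta> g (\<theta> g' x) = x" if "x \<in> A" for x
      using \<theta>_app[OF GM[OF g'(1)] GM[OF g] that] \<theta>_app[OF GM[OF g] GM[OF g'(1)] that] \<theta>_id that by auto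
    with g' show ?thesis by blast
  qed
  define H where "H = \<theta> ` G"
  have H_Bij: "\<theta> g \<in> Bij A" if g: "g \<in> G" for g
  proof -
    obtain g' where g': "g' \<in> G" "\<forall>x \<in> A. \<theta> g' (\<theta> g x) = x" "\<forall>x \<in> A. \<theta> g (\<theta> g' x) = x"
      using \<theta>_inv[OF g] by blast
    have "bij_betw (\<theta> g) A A"
      by (rule bij_betw_byWitness[of _ "\<theta> g'"]) (use g' \<theta>A[OF GM[OF g]] \<theta>A[OF GM[OF g'(1)]] in auto)
    then show ?thesis using \<theta>E[OF GM[OF g]] by (simp add: Bij_def PiE_def)
  qed
  have HN: "H \<subseteq> N" using \<theta>N GM by (auto simp: H_def)
  have H_perm: "closed_perm_group A H"
    unfolding closed_perm_group_def
  proof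
    show "subgroup H (BijGroup A)"
    proof
      show "H \<subseteq> carrier (BijGroup A)" using H_Bij by (auto simp: H_def BijGroup_def)
      show "\<one>\<^bsub>BijGroup A\<^esub> \<in> H" using \<theta>_id G_id unfolding H_def by (metis BijGroup_def image_eqI monoid.select_convs(2))
      fix h assume "h \<in> H"
      then obtain g where g: "g \<in> G" "h = \<theta> g" by (auto simp: H_def)
      obtain g' where g': "g' \<in> G" "\<forall>x \<in> A. \<theta> g' (\<theta> g x) = x" "\<forall>x \<in> A. \<theta> g (\<theta> g' x) = x"
        using \<theta>_inv[OF g(1)] by blast
      have b: "bij_betw (\<theta> g) A A" using H_Bij[OF g(1)] by (simp add: Bij_def)
      have "(\<lambda>x \<in> A. inv_into A (\<theta> g) x) = \<theta> g'"
      proof (rule PiE_ext[of _ A "\<lambda>_. A"])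
        show "(\<lambda>x \<in> A. inv_into A (\<theta> g) x) \<in> A \<rightarrow>\<^sub>E A"
          using bij_betw_apply[OF bij_betw_inv_into[OF b]] by auto
        show "\<theta> g' \<in> A \<rightarrow>\<^sub>E A" using \<theta>E GM g'(1) by blast
        fix x assume x: "x \<in> A"
        have "inv_into A (\<theta> g) (\<theta> g (\<theta> g' x)) = \<theta> g' x"
          using \<theta>A[OF GM[OF g'(1)] x] b by (rule bij_betw_inv_into_left[rotated])
        then show "(\<lambda>x \<in> A. inv_into A (\<theta> g) x) x = \<theta> g' x" using g'(3) x by simp
      qed
      then show "inv\<^bsub>BijGroup A\<^esub> h \<in> H" using inv_BijGroup[OF H_Bij[OF g(1)]] g'(1) g(2) by (simp add: H_def)
      fix k assume "k \<in> H"
      then obtain g2 where g2: "g2 \<in> G" "k = \<theta> g2" by (auto simp: H_def)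
      have "h \<otimes>\<^bsub>BijGroup A\<^esub> k = \<theta> (compose A g g2)"
        using H_Bij g g2 \<theta>_comp[OF GM GM] by (simp add: BijGroup_def)
      then show "h \<otimes>\<^bsub>BijGroup A\<^esub> k \<in> H" using G_comp[OF g(1) g2(1)] by (simp add: H_def)
    qed
    show "closedin (subtopology (pointwise_topology A) (Bij A)) H"
      unfolding closedin_pointwise
    proof (intro conjI ballI impI)
      show "H \<subseteq> Bij A \<inter> (A \<rightarrow>\<^sub>E A)" using H_Bij \<theta>E GM by (auto simp: H_def)
      fix h assume h: "h \<in> Bij A \<inter> (A \<rightarrow>\<^sub>E A)"
        and approx: "\<forall>F. finite F \<longrightarrow> F \<subseteq> A \<longrightarrow> (\<exists>m \<in> H. \<forall>x \<in> F. m x = h x)"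
      have "\<forall>F. finite F \<longrightarrow> F \<subseteq> A \<longrightarrow> (\<exists>m \<in> N. \<forall>x \<in> F. m x = h x)" using approx HN by blast
      then have hN: "h \<in> N" using N_closed h by blast
      have b: "bij_betw h A A" using h by (simp add: Bij_def)
      \<comment> \<open>The inverse of a limit of elements of \<open>H\<close> is a limit of their
        inverses and hence also in \<open>N\<close>. The preimages of both under
        \<open>\<theta>\<close> are inverse to each other, so they are bijections and belong to
        \<open>G\<close>.\<close>
      define h' where "h' = (\<lambda>x \<in> A. inv_into A h x)"
      have h'A: "h' x \<in> A" and hh': "h (h' x) = x" and h'h: "h' (h x) = x" if "x \<in> A" for x
        using that bij_betw_apply[OF bij_betw_inv_into[OF b]] bij_betw_apply[OF b]
        by (auto simp: h'_def bij_betw_inv_into_right[OF b] bij_betw_inv_into_left[OF b])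
      have "h' \<in> N"
      proof (rule N_closed)
        show "h' \<in> A \<rightarrow>\<^sub>E A" using h'A by (auto simp: h'_def)
        show "\<forall>F. finite F \<longrightarrow> F \<subseteq> A \<longrightarrow> (\<exists>m \<in> N. \<forall>x \<in> F. m x = h' x)"
        proof (intro allI impI)
          fix F assume F: "finite F" "F \<subseteq> A"
          have "finite (h' ` F)" "h' ` F \<subseteq> A" using F h'A by auto
          then obtain k where k: "k \<in> H" "\<forall>x \<in> h' ` F. k x = h x" using approx by blast
          obtain g where g: "g \<in> G" "k = \<theta> g" using k(1) by (auto simp: H_def)
          obtain g' where g': "g' \<in> G" "\<forall>x \<in> A. \<theta> g' (\<theta> g x) = x" using \<theta>_inv[OF g(1)] by blast
          have "\<theta> g' x = h' x" if x: "x \<in> F" for x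
          proof -
            have xA: "x \<in> A" using F x by blast
            have "\<theta> g (h' x) = x" using k(2) x hh'[OF xA] g(2) by simp
            then show ?thesis using g'(2) h'A[OF xA] by metis
          qed
          then show "\<exists>m \<in> N. \<forall>x \<in> F. m x = h' x" using \<theta>N[OF GM[OF g'(1)]] by blast
        qed
      qed
      obtain m where m: "m \<in> M" "h = \<theta> m" using \<theta>_onto[OF hN] by blast
      obtain m' where m': "m' \<in> M" "h' = \<theta> m'" using \<theta>_onto[OF \<open>h' \<in> N\<close>] by blast
      have mm'_id: "compose A m m' = ?id"
      proof (rule \<theta>_inj[OF _ M_comp[OF m(1) m'(1)] id_M])
        show "\<theta> (compose A m m') = \<theta> ?id"
          unfolding \<theta>_comp[OF m(1) m'(1)] \<theta>_id m(2)[symmetric] m'(2)[symmetric]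
          using hh' by (auto simp: compose_def)
      qed
      have mm': "m (m' x) = x" if "x \<in> A" for x
        using fun_cong[OF mm'_id, of x] that by (simp add: compose_def)
      have m'm_id: "compose A m' m = ?id"
      proof (rule \<theta>_inj[OF _ M_comp[OF m'(1) m(1)] id_M])
        show "\<theta> (compose A m' m) = \<theta> ?id"
          unfolding \<theta>_comp[OF m'(1) m(1)] \<theta>_id m(2)[symmetric] m'(2)[symmetric]
          using h'h by (auto simp: compose_def)
      qed
      have m'm: "m' (m x) = x" if "x \<in> A" for x
        using fun_cong[OF m'm_id, of x] that by (simp add: compose_def)
      have "bij_betw m A A"
        by (rule bij_betw_byWitness[of _ m']) (use mm' m'm M_app[OF m(1)] M_app[OF m'(1)] in auto)
      then have "m \<in> G" using M_bij m(1) by blast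
      then show "h \<in> H" using m(2) by (simp add: H_def)
    qed
  qed
  have "bij_betw \<theta> G H" unfolding H_def using bij G_M by (rule bij_betw_subset) simp
  moreover have "\<theta> (x \<otimes>\<^bsub>BijGroup A\<^esub> y) = \<theta> x \<otimes>\<^bsub>BijGroup A\<^esub> \<theta> y" if "x \<in> G" "y \<in> G" for x y
    using \<theta>_comp[OF GM[OF that(1)] GM[OF that(2)]] G_Bij H_Bij that by (simp add: BijGroup_def)
  ultimately have "\<theta> \<in> iso (BijGroup A\<lparr>carrier := G\<rparr>) (BijGroup A\<lparr>carrier := H\<rparr>)"
    unfolding iso_carrier by blast
  then have homeo: "homeomorphic_map (subtopology (pointwise_topology A) G) (subtopology (pointwise_topology A) H) \<theta>"
    using G_auto H_perm unfolding group_auto_homeo_def by blast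
  have topG: "G \<inter> (A \<rightarrow>\<^sub>E A) = G" using G_M M_E by blast
  have topH: "H \<inter> (A \<rightarrow>\<^sub>E A) = H" using HN NE by blast
  \<comment> \<open>Continuity at the identity becomes uniform by translation: two group elements
    are compared through the quotient of one by the other.\<close>
  have unif_G: "\<exists>E. finite E \<and> E \<subseteq> A \<and>
      (\<forall>g \<in> G. \<forall>g' \<in> G. (\<forall>x \<in> E. g x = g' x) \<longrightarrow> (\<forall>x \<in> F. \<theta> g x = \<theta> g' x))"
    if F: "finite F" "F \<subseteq> A" for F
  proof -
    define V where "V = {h \<in> H. \<forall>x \<in> F. h x = x}"
    have "openin (subtopology (pointwise_topology A) H) V"
      unfolding openin_pointwise topH
    proof (intro conjI ballI)
      fix h assume "h \<in> V"
      then have "\<forall>g \<in> H. (\<forall>x \<in> F. g x = h x) \<longrightarrow> g \<in> V" by (simp add: V_def)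
      then show "\<exists>F. finite F \<and> F \<subseteq> A \<and> (\<forall>g \<in> H. (\<forall>x \<in> F. g x = h x) \<longrightarrow> g \<in> V)" using F by blast
    qed (simp add: V_def)
    then have op: "openin (subtopology (pointwise_topology A) G) {g \<in> G. \<theta> g \<in> V}"
      using homeomorphic_imp_continuous_map[OF homeo] unfolding continuous_map topspace_pointwise topG by blast
    have "?id \<in> {g \<in> G. \<theta> g \<in> V}" using G_id \<theta>_id F by (auto simp: V_def H_def image_iff intro!: bexI[of _ ?id])
    then obtain E where E: "finite E" "E \<subseteq> A" "\<forall>g \<in> G. (\<forall>x \<in> E. g x = ?id x) \<longrightarrow> g \<in> {g \<in> G. \<theta> g \<in> V}"
      using op unfolding openin_pointwise topG by blast
    have "\<theta> g x = \<theta> g2 x" if g: "g \<in> G" "g2 \<in> G" "\<forall>x \<in> E. g x = g2 x" and x: "x \<in> F" for g g2 x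
    proof -
      obtain g' where g': "g' \<in> G" "\<forall>x \<in> A. g' (g x) = x" "\<forall>x \<in> A. \<theta> g (\<theta> g' x) = x" using \<theta>_inv[OF g(1)] by blast
      have "compose A g' g2 y = ?id y" if y: "y \<in> E" for y
      proof -
        have "y \<in> A" using E(2) y by blast
        moreover have "g' (g2 y) = y" using g(3) g'(2) y calculation by metis
        ultimately show ?thesis by (simp add: compose_def)
      qed
      then have "\<theta> (compose A g' g2) \<in> V" using E(3) G_comp[OF g'(1) g(2)] by blast
      then have "\<theta> (compose A g' g2) x = x" using x by (simp add: V_def)
      moreover have xA: "x \<in> A" using F x by blast
      ultimately have "\<theta> g' (\<theta> g2 x) = x" using \<theta>_app[OF GM[OF g'(1)] GM[OF g(2)] xA] by simp
      then show ?thesis using g'(3) \<theta>A[OF GM[OF g(2)] xA] by metis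
    qed
    then show ?thesis using E(1,2) by blast
  qed
  have unif_G': "\<exists>F. finite F \<and> F \<subseteq> A \<and>
      (\<forall>g \<in> G. \<forall>g' \<in> G. (\<forall>x \<in> F. \<theta> g x = \<theta> g' x) \<longrightarrow> (\<forall>x \<in> E. g x = g' x))"
    if E: "finite E" "E \<subseteq> A" for E
  proof -
    define V where "V = {g \<in> G. \<forall>x \<in> E. g x = x}"
    have "openin (subtopology (pointwise_topology A) G) V"
      unfolding openin_pointwise topG
    proof (intro conjI ballI)
      fix h assume "h \<in> V"
      then have "\<forall>g \<in> G. (\<forall>x \<in> E. g x = h x) \<longrightarrow> g \<in> V" by (simp add: V_def)
      then show "\<exists>F. finite F \<and> F \<subseteq> A \<and> (\<forall>g \<in> G. (\<forall>x \<in> F. g x = h x) \<longrightarrow> g \<in> V)" using E by blast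
    qed (simp add: V_def)
    then have op: "openin (subtopology (pointwise_topology A) H) (\<theta> ` V)"
      using homeomorphic_imp_open_map[OF homeo] unfolding open_map_def by blast
    have "?id \<in> V" using G_id E by (auto simp: V_def)
    then have "?id \<in> \<theta> ` V" using \<theta>_id by (metis imageI)
    then obtain F where F: "finite F" "F \<subseteq> A" "\<forall>h \<in> H. (\<forall>x \<in> F. h x = ?id x) \<longrightarrow> h \<in> \<theta> ` V"
      using op unfolding openin_pointwise topH by blast
    have "g x = g2 x" if g: "g \<in> G" "g2 \<in> G" "\<forall>x \<in> F. \<theta> g x = \<theta> g2 x" and x: "x \<in> E" for g g2 x
    proof -
      obtain g' where g': "g' \<in> G" "\<forall>x \<in> A. g (g' x) = x" "\<forall>x \<in> A. \<theta> g' (\<theta> g x) = x" using \<theta>_inv[OF g(1)] by blast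
      have comp: "compose A g' g2 \<in> G" using g'(1) g(2) by (rule G_comp)
      have "\<theta> (compose A g' g2) y = ?id y" if y: "y \<in> F" for y
      proof -
        have yA: "y \<in> A" using F(2) y by blast
        have "\<theta> g' (\<theta> g2 y) = y" using g(3) g'(3) y yA by metis
        then show ?thesis using \<theta>_app[OF GM[OF g'(1)] GM[OF g(2)] yA] yA by simp
      qed
      moreover have "\<theta> (compose A g' g2) \<in> H" using comp by (simp add: H_def)
      ultimately obtain k where k: "k \<in> V" "\<theta> (compose A g' g2) = \<theta> k" using F(3) by blast
      have "k \<in> G" using k(1) by (simp add: V_def)
      then have "compose A g' g2 = k" by (rule \<theta>_inj[OF k(2) GM[OF comp] GM])
      then have "compose A g' g2 x = x" using k(1) x by (simp add: V_def)
      moreover have xA: "x \<in> A" using E x by blast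
      ultimately have "g' (g2 x) = x" by (simp add: compose_def)
      then show ?thesis using g'(2) G_app[OF g(2) xA] by metis
    qed
    then show ?thesis using F(1,2) by blast
  qed
  have "\<forall>a \<in> A. \<exists>E. finite E \<and> E \<subseteq> A \<and>
      (\<forall>g \<in> G. \<forall>g' \<in> G. (\<forall>x \<in> E. g x = g' x) \<longrightarrow> (\<forall>x \<in> {a}. \<theta> g x = \<theta> g' x))"
    by (intro ballI unif_G) auto
  from bchoice[OF this] obtain E1 where E1_all: "\<forall>a \<in> A. finite (E1 a) \<and> E1 a \<subseteq> A \<and>
      (\<forall>g \<in> G. \<forall>g' \<in> G. (\<forall>x \<in> E1 a. g x = g' x) \<longrightarrow> (\<forall>x \<in> {a}. \<theta> g x = \<theta> g' x))"
    by (rule exE)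
  have E1: "finite (E1 a)" "E1 a \<subseteq> A" if "a \<in> A" for a using E1_all that by blast+
  have E1_eq: "\<theta> g a = \<theta> g' a" if "a \<in> A" "g \<in> G" "g' \<in> G" "\<forall>x \<in> E1 a. g x = g' x" for a g g'
    using E1_all that by blast
  define ap where "ap m E = (SOME g. g \<in> G \<and> (\<forall>x \<in> E. g x = m x))" for m and E :: "'a set"
  have ap: "ap m E \<in> G \<and> (\<forall>x \<in> E. ap m E x = m x)" if "m \<in> M" "finite E" "E \<subseteq> A" for m E
  proof -
    have "\<exists>g. g \<in> G \<and> (\<forall>x \<in> E. g x = m x)" using dense[OF that] by blast
    then show ?thesis unfolding ap_def by (rule someI_ex)
  qed
  \<comment> \<open>The choice of the approximating group element does not matter, as any two of
    them agree on \<open>E1 a\<close>.\<close>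
  define \<Theta> where "\<Theta> m = (\<lambda>a \<in> A. \<theta> (ap m (E1 a)) a)" for m
  have \<Theta>: "\<Theta> m a = \<theta> g a" if "m \<in> M" "a \<in> A" "g \<in> G" "\<forall>x \<in> E1 a. g x = m x" for m a g
  proof -
    have "\<theta> (ap m (E1 a)) a = \<theta> g a"
      using ap[OF that(1) E1[OF that(2)]] that(4) by (intro E1_eq[OF that(2) _ that(3)]) auto
    then show ?thesis using that(2) by (simp add: \<Theta>_def)
  qed
  define EF where "EF F = (\<Union>a \<in> F. E1 a)" for F
  have EF: "finite (EF F)" "EF F \<subseteq> A" if "finite F" "F \<subseteq> A" for F
    using that E1 unfolding EF_def by blast+
  have \<Theta>N: "\<Theta> m \<in> N" if m: "m \<in> M" for m
  proof (rule N_closed)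
    have "\<theta> (ap m (E1 a)) a \<in> A" if "a \<in> A" for a using ap[OF m E1[OF that]] GM \<theta>A that by blast
    then show "\<Theta> m \<in> A \<rightarrow>\<^sub>E A" by (auto simp: \<Theta>_def)
    show "\<forall>F. finite F \<longrightarrow> F \<subseteq> A \<longrightarrow> (\<exists>n \<in> N. \<forall>x \<in> F. n x = \<Theta> m x)"
    proof (intro allI impI)
      fix F assume F: "finite F" "F \<subseteq> A"
      obtain g where g: "g \<in> G" "\<forall>x \<in> EF F. g x = m x" using dense[OF m EF[OF F]] by blast
      have "\<theta> g a = \<Theta> m a" if "a \<in> F" for a
        using that F g by (intro \<Theta>[OF m _ g(1), symmetric]) (auto simp: EF_def)
      then show "\<exists>n \<in> N. \<forall>x \<in> F. n x = \<Theta> m x" using \<theta>N[OF GM[OF g(1)]] by blast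
    qed
  qed
  have \<Theta>_G: "\<Theta> g = \<theta> g" if g: "g \<in> G" for g
  proof (rule PiE_ext[of _ A "\<lambda>_. A"])
    show "\<Theta> g \<in> A \<rightarrow>\<^sub>E A" using \<Theta>N[OF GM[OF g]] NE by blast
    show "\<theta> g \<in> A \<rightarrow>\<^sub>E A" using \<theta>E[OF GM[OF g]] .
    show "\<Theta> g a = \<theta> g a" if "a \<in> A" for a using \<Theta>[OF GM[OF g] that g] by blast
  qed
  have \<Theta>_comp: "\<Theta> (compose A m m') = compose A (\<Theta> m) (\<Theta> m')" if m: "m \<in> M" "m' \<in> M" for m m'
  proof (rule PiE_ext[of _ A "\<lambda>_. A"])
    have \<Theta>A: "\<Theta> k x \<in> A" if "k \<in> M" "x \<in> A" for k x using \<Theta>N[OF that(1)] NE that(2) by blast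
    show "\<Theta> (compose A m m') \<in> A \<rightarrow>\<^sub>E A" using \<Theta>N[OF M_comp[OF m]] NE by blast
    show "compose A (\<Theta> m) (\<Theta> m') \<in> A \<rightarrow>\<^sub>E A" using \<Theta>A m by (auto simp: compose_def)
    fix a assume a: "a \<in> A"
    define b where "b = \<Theta> m' a"
    have b: "b \<in> A" unfolding b_def using m(2) a by (rule \<Theta>A)
    obtain g' where g': "g' \<in> G" "\<forall>x \<in> E1 a. g' x = m' x" using dense[OF m(2) E1[OF a]] by blast
    \<comment> \<open>The approximant of m is needed on \<open>E1 b\<close> for the value at b, and
      on the image of \<open>E1 a\<close> so that the composite approximates m m' on
      \<open>E1 a\<close>.\<close>
    have im: "finite (E1 b \<union> m' ` E1 a)" "E1 b \<union> m' ` E1 a \<subseteq> A"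
      using E1[OF a] E1[OF b] M_app[OF m(2)] by auto
    obtain g where g: "g \<in> G" "\<forall>x \<in> E1 b \<union> m' ` E1 a. g x = m x" using dense[OF m(1) im] by blast
    have "\<forall>x \<in> E1 a. compose A g g' x = compose A m m' x"
      using g(2) g'(2) E1(2)[OF a] by (auto simp: compose_def)
    then have "\<Theta> (compose A m m') a = \<theta> (compose A g g') a"
      by (intro \<Theta>[OF M_comp[OF m] a] G_comp g(1) g'(1))
    also have "\<dots> = \<theta> g (\<theta> g' a)" using GM g(1) g'(1) a by (intro \<theta>_app)
    also have "\<theta> g' a = b" unfolding b_def using \<Theta>[OF m(2) a g'] by simp
    also have "\<theta> g b = \<Theta> m b" using g by (intro \<Theta>[OF m(1) b, symmetric]) auto
    finally show "\<Theta> (compose A m m') a = compose A (\<Theta> m) (\<Theta> m') a" using a by (simp add: compose_eq b_def)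
  qed
  define \<iota> where "\<iota> m = inv_into M \<theta> (\<Theta> m)" for m
  have \<iota>M: "\<iota> m \<in> M" and \<theta>_\<iota>: "\<theta> (\<iota> m) = \<Theta> m" if "m \<in> M" for m
    using \<Theta>N[OF that] bij by (auto simp: \<iota>_def bij_betw_def inv_into_into f_inv_into_f)
  interpret fixing_endomorphism A G M \<iota>
  proof
    fix m m' assume m: "m \<in> M" "m' \<in> M"
    have "\<theta> (\<iota> (compose A m m')) = \<theta> (compose A (\<iota> m) (\<iota> m'))"
      unfolding \<theta>_\<iota>[OF M_comp[OF m]] \<theta>_comp[OF \<iota>M[OF m(1)] \<iota>M[OF m(2)]] \<theta>_\<iota>[OF m(1)] \<theta>_\<iota>[OF m(2)]
      by (rule \<Theta>_comp[OF m])
    then show "\<iota> (compose A m m') = compose A (\<iota> m) (\<iota> m')"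
      by (rule \<theta>_inj) (intro \<iota>M M_comp m)+
  next
    fix g assume g: "g \<in> G"
    have "\<theta> (\<iota> g) = \<theta> g" using \<theta>_\<iota>[OF GM[OF g]] \<Theta>_G[OF g] by simp
    then show "\<iota> g = g" by (rule \<theta>_inj) (intro \<iota>M GM g)+
  qed (fact center \<iota>M)+
  have \<Theta>_eq: "\<Theta> m = \<theta> m" if "m \<in> M" for m using \<theta>_\<iota>[OF that] fixes_all[OF that] by simp
  show ?thesis
  proof (rule homeomorphic_map_pointwise[OF M_E NE bij])
    fix F assume F: "finite F" "F \<subseteq> A"
    have "\<theta> m a = \<theta> m' a" if m: "m \<in> M" "m' \<in> M" "\<forall>x \<in> EF F. m x = m' x" and a: "a \<in> F" for m m' a
    proof -
      obtain g where g: "g \<in> G" "\<forall>x \<in> EF F. g x = m x" using dense[OF m(1) EF[OF F]] by blast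
      have aA: "a \<in> A" using F a by blast
      have "\<Theta> m a = \<theta> g a" "\<Theta> m' a = \<theta> g a"
        using g m(3) a by (auto simp: EF_def intro!: \<Theta>[OF m(1) aA g(1)] \<Theta>[OF m(2) aA g(1)])
      then show ?thesis using \<Theta>_eq m by simp
    qed
    then show "\<exists>E. finite E \<and> E \<subseteq> A \<and>
      (\<forall>m \<in> M. \<forall>m' \<in> M. (\<forall>x \<in> E. m x = m' x) \<longrightarrow> (\<forall>x \<in> F. \<theta> m x = \<theta> m' x))" using EF[OF F] by blast
  next
    fix E assume E: "finite E" "E \<subseteq> A"
    obtain F where F: "finite F" "F \<subseteq> A"
      "\<forall>g \<in> G. \<forall>g' \<in> G. (\<forall>x \<in> F. \<theta> g x = \<theta> g' x) \<longrightarrow> (\<forall>x \<in> E. g x = g' x)" using unif_G'[OF E] by blast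
    \<comment> \<open>Agreement on \<open>EF F\<close> transfers equality of the images on
      \<open>F\<close> from m, m' to their approximants; agreement on \<open>E\<close> transfers the
      conclusion back.\<close>
    have EE: "finite (E \<union> EF F)" "E \<union> EF F \<subseteq> A" using E EF[OF F(1,2)] by auto
    have "m x = m' x" if m: "m \<in> M" "m' \<in> M" "\<forall>a \<in> F. \<theta> m a = \<theta> m' a" and x: "x \<in> E" for m m' x
    proof -
      obtain g where g: "g \<in> G" "\<forall>x \<in> E \<union> EF F. g x = m x" using dense[OF m(1) EE] by blast
      obtain g' where g': "g' \<in> G" "\<forall>x \<in> E \<union> EF F. g' x = m' x" using dense[OF m(2) EE] by blast
      have "\<theta> g a = \<theta> g' a" if a: "a \<in> F" for a
      proof -
        have aA: "a \<in> A" using F a by blast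
        have "\<forall>x \<in> E1 a. g x = m x" "\<forall>x \<in> E1 a. g' x = m' x" using g(2) g'(2) a by (auto simp: EF_def)
        then have "\<Theta> m a = \<theta> g a" "\<Theta> m' a = \<theta> g' a"
          using \<Theta>[OF m(1) aA g(1)] \<Theta>[OF m(2) aA g'(1)] by blast+
        then show ?thesis using \<Theta>_eq m a by simp
      qed
      then have "g x = g' x" using F(3) g(1) g'(1) x by blast
      then show ?thesis using g(2) g'(2) x by auto
    qed
    then show "\<exists>F. finite F \<and> F \<subseteq> A \<and>
      (\<forall>m \<in> M. \<forall>m' \<in> M. (\<forall>x \<in> F. \<theta> m x = \<theta> m' x) \<longrightarrow> (\<forall>x \<in> E. m x = m' x))" using F(1,2) by blast
  qed
qed

theorem theorem2p2:
  fixes L :: "('f, 'r) language" and \<A> :: "('a, 'f, 'r) fo_structure"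
  assumes "is_structure L \<A>"
    and "countable (univ \<A>)"
    and "saturated L \<A>"
    and "group_auto_homeo (univ \<A>) (Aut L \<A>)"
    and "group_center (BijGroup (univ \<A>)\<lparr>carrier := Aut L \<A>\<rparr>) = {\<one>\<^bsub>BijGroup (univ \<A>)\<^esub>}"
  shows "monoid_auto_homeo (univ \<A>) (EEmb L \<A>)"
proof -
  let ?A = "univ \<A>"
  have G_sub: "subgroup (Aut L \<A>) (BijGroup ?A)"
    using assms(4) by (simp add: group_auto_homeo_def closed_perm_group_def)
  have M_E: "EEmb L \<A> \<subseteq> ?A \<rightarrow>\<^sub>E ?A" using EEmbD(1) by blast
  have am: "amalgamated_monoid ?A (Aut L \<A>) (EEmb L \<A>)"
  proof (rule amalgamated_monoid.intro)
    show "countable ?A" "subgroup (Aut L \<A>) (BijGroup ?A)" "EEmb L \<A> \<subseteq> ?A \<rightarrow>\<^sub>E ?A"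
      "Aut L \<A> \<subseteq> EEmb L \<A>"
      using assms(2) G_sub M_E Aut_subset_EEmb[OF assms(1)] .
    show "?A \<noteq> {}" using assms(1) by (simp add: is_structure_def)
    show "compose ?A f g \<in> EEmb L \<A>" if "f \<in> EEmb L \<A>" "g \<in> EEmb L \<A>" for f g
      using that by (rule EEmb_compose)
    show "f \<in> Aut L \<A>" if "f \<in> EEmb L \<A>" "bij_betw f ?A ?A" for f
      using EEmb_bij_Aut[OF assms(1) that] .
    show "h \<in> EEmb L \<A>" if "h \<in> ?A \<rightarrow>\<^sub>E ?A"
      "\<And>F. finite F \<Longrightarrow> F \<subseteq> ?A \<Longrightarrow> \<exists>m \<in> EEmb L \<A>. \<forall>x \<in> F. m x = h x" for h
      using that by (rule EEmb_closed)
    show "\<exists>g \<in> Aut L \<A>. \<forall>x \<in> F. g x = m x" if "m \<in> EEmb L \<A>" "finite F" "F \<subseteq> ?A" for m F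
      using Aut_dense[OF assms(1-3) that] .
  qed (rule strong_amalgamation[OF assms(1-3)])
  have center: "z = (\<lambda>x \<in> ?A. x)"
    if z: "z \<in> Aut L \<A>" "\<And>g. g \<in> Aut L \<A> \<Longrightarrow> compose ?A z g = compose ?A g z" for z
  proof -
    have Bij: "g \<in> Bij ?A" if "g \<in> Aut L \<A>" for g using that by (simp add: Aut_def)
    have "z \<in> group_center (BijGroup ?A\<lparr>carrier := Aut L \<A>\<rparr>)"
      using z Bij by (simp add: group_center_def BijGroup_def)
    then show ?thesis unfolding assms(5) by (simp add: BijGroup_def)
  qed
  have "submonoid (EEmb L \<A>) (full_trans_monoid ?A)"
  proof
    show "EEmb L \<A> \<subseteq> carrier (full_trans_monoid ?A)" using M_E by (simp add: full_trans_monoid_def)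
    show "f \<otimes>\<^bsub>full_trans_monoid ?A\<^esub> g \<in> EEmb L \<A>" if "f \<in> EEmb L \<A>" "g \<in> EEmb L \<A>" for f g
      using EEmb_compose[OF that] by (simp add: full_trans_monoid_def)
    have "(\<lambda>x \<in> ?A. x) \<in> EEmb L \<A>"
      using amalgamated_monoid.G_id[OF am] Aut_subset_EEmb[OF assms(1)] by blast
    then show "\<one>\<^bsub>full_trans_monoid ?A\<^esub> \<in> EEmb L \<A>" by (simp add: full_trans_monoid_def)
  qed
  moreover have "closedin (pointwise_topology ?A) (EEmb L \<A>)"
    unfolding closedin_pointwise_UNIV
  proof (intro conjI ballI impI)
    fix h assume "h \<in> ?A \<rightarrow>\<^sub>E ?A"
      "\<forall>F. finite F \<longrightarrow> F \<subseteq> ?A \<longrightarrow> (\<exists>m \<in> EEmb L \<A>. \<forall>x \<in> F. m x = h x)"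
    then show "h \<in> EEmb L \<A>" by (intro EEmb_closed) simp_all
  qed (rule M_E)
  ultimately have "closed_trans_monoid ?A (EEmb L \<A>)" by (simp add: closed_trans_monoid_def)
  then show ?thesis
    unfolding monoid_auto_homeo_def
    by (intro conjI allI impI amalgamated_monoid.automatic_homeomorphicity[OF am center assms(4)])
      (erule conjunct1 conjunct2 | assumption)+
qed

end
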